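(* Let $n\ge 2$, let $\Omega\subset\mathbb R^2$ be a smooth bounded simply connected domain, and let $g_1,\dots,g_n:\partial\Omega\to S^1$ be smooth maps with degrees $d_j=\deg(g_j,\partial\Omega)\ge 0$ for all $1\le j\le n$. Then $\mathcal X(g_1,\dots,g_n)\neq\emptyset$. Furthermore, the minimization problem $$\beta(g_1,\dots,g_n)=\inf\{I(u_1,\dots,u_n):(u_1,\dots,u_n)\in\mathcal X(g_1,\dots,g_n)\},\qquad I(u_1,\dots,u_n)=\sum_{j=1}^n\int_\Omega|\nabla u_j|^2\,dx,$$ is achieved in $\mathcal X(g_1,\dots,g_n)$.
   Context: $S^1=\{z\in\mathbb C:|z|=1\}$. For smooth $g:\partial\Omega\to S^1$, $H^1_g(\Omega;\mathbb C)=\{u\in H^1(\Omega;\mathbb C):u=g\text{ on }\partial\Omega\}$ (in the trace sense). Define $$\mathcal X(g_1,\dots,g_n)=\Big\{(u_1,\dots,u_n)\in H^1_{g_1}(\Omega;\mathbb C)\times\cdots\times H^1_{g_n}(\Omega;\mathbb C):\ \sum_{j=1}^n|u_j|^2=n\ \text{a.e. on }\Omega\Big\}.$$ *)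

theory Defs
  imports "HOL-Complex_Analysis.Complex_Analysis"
begin

text \<open>The plane \<open>\<real>\<^sup>2\<close> is identified with \<^typ>\<open>complex\<close>, whose \<^term>\<open>Basis\<close> is \<open>{1, \<i>}\<close>.\<close>

section \<open>Smooth functions, domains and boundary maps\<close>

text \<open>These are the usual notions only for open \<open>S\<close>; the partial derivatives are the
  directional derivatives along the basis vectors.\<close>

fun Ck_on :: "nat \<Rightarrow> 'a::euclidean_space set \<Rightarrow> ('a \<Rightarrow> 'b::real_normed_vector) \<Rightarrow> bool" where
  "Ck_on 0 S f \<longleftrightarrow> continuous_on S f"
| "Ck_on (Suc k) S f \<longleftrightarrow>
     f differentiable_on S \<and> (\<forall>b\<in>Basis. Ck_on k S (\<lambda>x. frechet_derivative f (at x) b))"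

definition smooth_on :: "'a::euclidean_space set \<Rightarrow> ('a \<Rightarrow> 'b::real_normed_vector) \<Rightarrow> bool" where
  "smooth_on S f \<longleftrightarrow> (\<forall>k. Ck_on k S f)"

text \<open>The boundary is smooth if, near each of its points and after a rotation of the axes
  (multiplication by the unit number \<open>e\<close>), the set is the part above the graph of a smooth
  function.\<close>

definition smooth_boundary :: "complex set \<Rightarrow> bool" where
  "smooth_boundary \<Omega> \<longleftrightarrow>
     (\<forall>p\<in>frontier \<Omega>. \<exists>r>0. \<exists>e h. cmod e = 1 \<and> smooth_on UNIV (h :: real \<Rightarrow> real) \<and>
        \<Omega> \<inter> ball p r = {z \<in> ball p r. Im (z / e) > h (Re (z / e))})"

definition smooth_bounded_domain :: "complex set \<Rightarrow> bool" where
  "smooth_bounded_domain \<Omega> \<longleftrightarrow>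
     \<Omega> \<noteq> {} \<and> open \<Omega> \<and> connected \<Omega> \<and> bounded \<Omega> \<and> smooth_boundary \<Omega>"

text \<open>Smoothness of a map on the curve \<open>\<partial>\<Omega>\<close> means local extendability to smooth maps on open
  sets; the values of \<open>g\<close> off \<open>\<partial>\<Omega>\<close> play no role.\<close>

definition smooth_boundary_map :: "complex set \<Rightarrow> (complex \<Rightarrow> complex) \<Rightarrow> bool" where
  "smooth_boundary_map \<Omega> g \<longleftrightarrow>
     g ` frontier \<Omega> \<subseteq> sphere 0 1 \<and>
     (\<forall>p\<in>frontier \<Omega>. \<exists>U G. open U \<and> p \<in> U \<and> smooth_on U G \<and> (\<forall>x\<in>U \<inter> frontier \<Omega>. G x = g x))"

text \<open>The degree is defined for domains bounded by a single Jordan curve. It is the winding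
  number about \<open>0\<close> of \<open>g\<close> along the boundary traversed once counterclockwise, and does not
  depend on the parametrization.\<close>

definition positive_boundary_loop :: "complex set \<Rightarrow> (real \<Rightarrow> complex) \<Rightarrow> bool" where
  "positive_boundary_loop \<Omega> \<gamma> \<longleftrightarrow>
     simple_path \<gamma> \<and> pathfinish \<gamma> = pathstart \<gamma> \<and> path_image \<gamma> = frontier \<Omega> \<and>
     (\<forall>z\<in>\<Omega>. winding_number \<gamma> z = 1)"

definition boundary_degree :: "complex set \<Rightarrow> (complex \<Rightarrow> complex) \<Rightarrow> int" where
  "boundary_degree \<Omega> g =
     (THE d. \<exists>\<gamma>. positive_boundary_loop \<Omega> \<gamma> \<and> winding_number (g \<circ> \<gamma>) 0 = of_int d)"

section \<open>Arc length as one-dimensional Hausdorff measure\<close>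

definition small_covers :: "real \<Rightarrow> 'a::metric_space set \<Rightarrow> (nat \<Rightarrow> 'a set) set" where
  "small_covers \<delta> A = {C. A \<subseteq> (\<Union>i. C i) \<and> (\<forall>i. bounded (C i) \<and> diameter (C i) \<le> \<delta>)}"

definition hausdorff1_pre :: "real \<Rightarrow> 'a::metric_space set \<Rightarrow> ennreal" where
  "hausdorff1_pre \<delta> A = (INF C\<in>small_covers \<delta> A. \<Sum>i. ennreal (diameter (C i)))"

definition hausdorff1_outer :: "'a::metric_space set \<Rightarrow> ennreal" where
  "hausdorff1_outer A = (SUP \<delta>\<in>{0<..}. hausdorff1_pre \<delta> A)"

definition hausdorff1 :: "'a::metric_space measure" where
  "hausdorff1 = measure_of UNIV (sets borel) hausdorff1_outer"

text \<open>The following lemmas show that \<open>hausdorff1\<close> takes the values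
  \<open>hausdorff1_outer\<close> on Borel sets, i.e. that \<^const>\<open>measure_of\<close> does not degenerate.\<close>

lemma hausdorff1_pre_mono: "A \<subseteq> B \<Longrightarrow> hausdorff1_pre \<delta> A \<le> hausdorff1_pre \<delta> B"
  unfolding hausdorff1_pre_def by (rule INF_superset_mono) (auto simp: small_covers_def)

lemma hausdorff1_pre_antimono: "\<delta> \<le> \<epsilon> \<Longrightarrow> hausdorff1_pre \<epsilon> A \<le> hausdorff1_pre \<delta> A"
  unfolding hausdorff1_pre_def
  by (rule INF_superset_mono) (auto simp: small_covers_def intro: order_trans)

lemma hausdorff1_pre_empty: "\<delta> > 0 \<Longrightarrow> hausdorff1_pre \<delta> {} = 0"
proof -
  assume "\<delta> > 0"
  then have "(\<lambda>_. {}) \<in> small_covers \<delta> {}" by (auto simp: small_covers_def)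
  then have "hausdorff1_pre \<delta> ({} :: 'a set) \<le> (\<Sum>i. ennreal (diameter ((\<lambda>_::nat. {} :: 'a set) i)))"
    unfolding hausdorff1_pre_def by (rule INF_lower)
  then show ?thesis by simp
qed

lemma hausdorff1_pre_subadditive:
  "hausdorff1_pre \<delta> (\<Union>n. A n) \<le> (\<Sum>n. hausdorff1_pre \<delta> (A n :: 'a::metric_space set))"
proof (rule ennreal_le_epsilon)
  let ?O = "hausdorff1_pre \<delta> :: 'a set \<Rightarrow> ennreal"
  let ?f = "\<lambda>S :: 'a set. ennreal (diameter S)"
  fix e :: real assume "0 < e" "(\<Sum>n. ?O (A n)) < top"
  then have *: "?O (A n) < ?O (A n) + e * (1/2)^Suc n" for n
    by (auto simp add: less_top dest!: ennreal_suminf_lessD)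
  have "\<exists>C\<in>small_covers \<delta> (A n). (\<Sum>i. ?f (C i)) < ?O (A n) + e * (1/2)^Suc n" for n
    using *[of n] by (subst (asm) (1) hausdorff1_pre_def) (simp only: INF_less_iff)
  then obtain B where B: "\<And>n. B n \<in> small_covers \<delta> (A n)"
    and Ble: "\<And>n. (\<Sum>i. ?f (B n i)) < ?O (A n) + e * (1/2)^Suc n"
    by metis
  define C where "C = case_prod B \<circ> prod_decode"
  have sub: "(\<Union>i. A i) \<subseteq> (\<Union>i. C i)"
  proof
    fix x assume "x \<in> (\<Union>i. A i)"
    then obtain n where "x \<in> A n" by auto
    then obtain i where "x \<in> B n i" using B[of n] by (auto simp: small_covers_def)
    then have "x \<in> C (prod_encode (n, i))" by (simp add: C_def)
    then show "x \<in> (\<Union>i. C i)" by blast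
  qed
  have "C \<in> small_covers \<delta> (\<Union>n. A n)"
    using B sub by (auto simp: small_covers_def C_def split: prod.splits)
  then have "?O (\<Union>n. A n) \<le> (\<Sum>i. ?f (C i))"
    unfolding hausdorff1_pre_def by (rule INF_lower)
  also have "\<dots> = (\<Sum>n. \<Sum>i. ?f (B n i))"
    unfolding C_def comp_def
    by (rule suminf_ennreal_2dimen[where f = "\<lambda>p. ?f (case_prod B p)", simplified]) simp
  also have "\<dots> \<le> (\<Sum>n. ?O (A n) + e * (1/2) ^ Suc n)"
    using Ble by (intro suminf_le allI) (auto intro: less_imp_le)
  also have "\<dots> = (\<Sum>n. ?O (A n)) + (\<Sum>n. ennreal e * ennreal ((1/2) ^ Suc n))"
    using \<open>0 < e\<close> by (subst suminf_add[symmetric])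
      (auto simp del: ennreal_suminf_cmult simp add: ennreal_mult[symmetric])
  also have "\<dots> = (\<Sum>n. ?O (A n)) + e"
    unfolding ennreal_suminf_cmult
    by (subst suminf_ennreal_eq[OF zero_le_power power_half_series]) auto
  finally show "?O (\<Union>n. A n) \<le> (\<Sum>n. ?O (A n)) + e" .
qed

lemma hausdorff1_pre_separated:
  fixes A B :: "'a::metric_space set"
  assumes "\<delta> < d" and sep: "\<And>x y. x \<in> A \<Longrightarrow> y \<in> B \<Longrightarrow> d \<le> dist x y" and "\<delta> > 0"
  shows "hausdorff1_pre \<delta> A + hausdorff1_pre \<delta> B \<le> hausdorff1_pre \<delta> (A \<union> B)"
  unfolding hausdorff1_pre_def[of \<delta> "A \<union> B"]
proof (rule INF_greatest)
  fix C assume C: "C \<in> small_covers \<delta> (A \<union> B)"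
  define CA where "CA = (\<lambda>i. if C i \<inter> A = {} then {} else C i)"
  define CB where "CB = (\<lambda>i. if C i \<inter> A = {} then C i else {})"
  have "CA \<in> small_covers \<delta> A"
    using C \<open>\<delta> > 0\<close> unfolding small_covers_def CA_def by fastforce
  then have 1: "hausdorff1_pre \<delta> A \<le> (\<Sum>i. ennreal (diameter (CA i)))"
    unfolding hausdorff1_pre_def by (rule INF_lower)
  have disj: "C i \<inter> A = {}" if "y \<in> C i" "y \<in> B" for i y
  proof (rule ccontr)
    assume "C i \<inter> A \<noteq> {}"
    then obtain x where x: "x \<in> C i" "x \<in> A" by auto
    have "dist x y \<le> diameter (C i)"
      using C x that by (intro diameter_bounded_bound) (auto simp: small_covers_def)
    also have "\<dots> \<le> \<delta>" using C by (auto simp: small_covers_def)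
    finally show False using sep[OF x(2) that(2)] \<open>\<delta> < d\<close> by linarith
  qed
  have "B \<subseteq> (\<Union>i. CB i)"
  proof
    fix y assume y: "y \<in> B"
    then obtain i where "y \<in> C i" using C by (auto simp: small_covers_def)
    with disj[OF this y] show "y \<in> (\<Union>i. CB i)" by (auto simp: CB_def)
  qed
  then have "CB \<in> small_covers \<delta> B"
    using C \<open>\<delta> > 0\<close> by (auto simp: small_covers_def CB_def)
  then have 2: "hausdorff1_pre \<delta> B \<le> (\<Sum>i. ennreal (diameter (CB i)))"
    unfolding hausdorff1_pre_def by (rule INF_lower)
  have "hausdorff1_pre \<delta> A + hausdorff1_pre \<delta> B
      \<le> (\<Sum>i. ennreal (diameter (CA i))) + (\<Sum>i. ennreal (diameter (CB i)))"
    using 1 2 by (rule add_mono)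
  also have "\<dots> = (\<Sum>i. ennreal (diameter (CA i)) + ennreal (diameter (CB i)))"
    by (rule suminf_add) auto
  also have "\<dots> = (\<Sum>i. ennreal (diameter (C i)))"
    by (rule suminf_cong) (auto simp: CA_def CB_def)
  finally show "hausdorff1_pre \<delta> A + hausdorff1_pre \<delta> B \<le> (\<Sum>i. ennreal (diameter (C i)))" .
qed

lemma hausdorff1_outer_mono: "A \<subseteq> B \<Longrightarrow> hausdorff1_outer A \<le> hausdorff1_outer B"
  unfolding hausdorff1_outer_def by (rule SUP_mono) (auto intro: hausdorff1_pre_mono)

lemma hausdorff1_outer_empty: "hausdorff1_outer {} = 0"
  unfolding hausdorff1_outer_def by (simp add: hausdorff1_pre_empty)

lemma hausdorff1_outer_subadditive:
  "hausdorff1_outer (\<Union>n. A n) \<le> (\<Sum>n. hausdorff1_outer (A n :: 'a::metric_space set))"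
  unfolding hausdorff1_outer_def[of "\<Union>n. A n"]
proof (rule SUP_least)
  fix \<delta> :: real assume "\<delta> \<in> {0<..}"
  then have "(\<Sum>n. hausdorff1_pre \<delta> (A n)) \<le> (\<Sum>n. hausdorff1_outer (A n))"
    unfolding hausdorff1_outer_def by (intro suminf_le SUP_upper) auto
  with hausdorff1_pre_subadditive[of \<delta> A]
  show "hausdorff1_pre \<delta> (\<Union>n. A n) \<le> (\<Sum>n. hausdorff1_outer (A n))"
    by (rule order_trans)
qed

lemma hausdorff1_outer_subadditive2:
  fixes A B :: "'a::metric_space set"
  shows "hausdorff1_outer (A \<union> B) \<le> hausdorff1_outer A + hausdorff1_outer B"
proof -
  have "(\<Sum>n. hausdorff1_outer ((binaryset A B) n)) = hausdorff1_outer A + hausdorff1_outer B"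
    by (rule sums_unique[OF binaryset_sums, symmetric]) (rule hausdorff1_outer_empty)
  then show ?thesis
    using hausdorff1_outer_subadditive[of "binaryset A B"] by (simp add: UN_binaryset_eq)
qed

lemma hausdorff1_outer_separated:
  fixes A B :: "'a::metric_space set"
  assumes "d > 0" and sep: "\<And>x y. x \<in> A \<Longrightarrow> y \<in> B \<Longrightarrow> d \<le> dist x y"
  shows "hausdorff1_outer A + hausdorff1_outer B \<le> hausdorff1_outer (A \<union> B)"
proof -
  have "hausdorff1_outer A + hausdorff1_outer B
      = (SUP \<delta>\<in>{0<..}. hausdorff1_pre \<delta> A + hausdorff1_pre \<delta> B)"
    unfolding hausdorff1_outer_def
  proof (rule SUP_add_directed_ennreal[symmetric])
    fix i j :: real assume "i \<in> {0<..}" "j \<in> {0<..}"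
    then show "\<exists>k\<in>{0<..}. hausdorff1_pre i A + hausdorff1_pre j B
        \<le> hausdorff1_pre k A + hausdorff1_pre k B"
      by (intro bexI[of _ "min i j"] add_mono hausdorff1_pre_antimono) auto
  qed
  also have "\<dots> \<le> hausdorff1_outer (A \<union> B)"
  proof (rule SUP_least)
    fix \<delta> :: real assume "\<delta> \<in> {0<..}"
    then have \<delta>: "\<delta> > 0" by simp
    let ?\<epsilon> = "min \<delta> (d / 2)"
    have \<epsilon>: "?\<epsilon> > 0" "?\<epsilon> < d" using \<delta> \<open>d > 0\<close> by auto
    have "hausdorff1_pre \<delta> A + hausdorff1_pre \<delta> B \<le> hausdorff1_pre ?\<epsilon> A + hausdorff1_pre ?\<epsilon> B"
      by (intro add_mono hausdorff1_pre_antimono) auto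
    also have "\<dots> \<le> hausdorff1_pre ?\<epsilon> (A \<union> B)"
      using \<epsilon> sep by (intro hausdorff1_pre_separated[of _ d]) auto
    also have "\<dots> \<le> hausdorff1_outer (A \<union> B)"
      unfolding hausdorff1_outer_def using \<epsilon> by (intro SUP_upper) auto
    finally show "hausdorff1_pre \<delta> A + hausdorff1_pre \<delta> B \<le> hausdorff1_outer (A \<union> B)" .
  qed
  finally show ?thesis .
qed

lemma hausdorff1_outer_separated_sum:
  fixes R :: "nat \<Rightarrow> 'a::metric_space set"
  assumes sep: "\<And>m n. m < n \<Longrightarrow> \<exists>d>0. \<forall>x\<in>R m. \<forall>y\<in>R n. d \<le> dist x y"
  shows "(\<Sum>k<N. hausdorff1_outer (R k)) \<le> hausdorff1_outer (\<Union>k<N. R k)"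
proof (induction N)
  case 0
  show ?case by (simp add: hausdorff1_outer_empty)
next
  case (Suc N)
  have "\<exists>d>0. \<forall>m<M. \<forall>x\<in>R m. \<forall>y\<in>R N. d \<le> dist x y" if "M \<le> N" for M
    using that
  proof (induction M)
    case 0
    show ?case by (intro exI[of _ 1]) auto
  next
    case (Suc M)
    then obtain d where d: "d > 0" "\<forall>m<M. \<forall>x\<in>R m. \<forall>y\<in>R N. d \<le> dist x y" by auto
    obtain d' where d': "d' > 0" "\<forall>x\<in>R M. \<forall>y\<in>R N. d' \<le> dist x y"
      using sep[of M N] Suc.prems by auto
    show ?case
      using d d' by (intro exI[of _ "min d d'"]) (auto simp: less_Suc_eq intro: min.coboundedI1 min.coboundedI2)
  qed
  from this[of N] obtain d where d: "d > 0" "\<forall>m<N. \<forall>x\<in>R m. \<forall>y\<in>R N. d \<le> dist x y" by auto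
  have "(\<Sum>k<Suc N. hausdorff1_outer (R k)) \<le> hausdorff1_outer (\<Union>k<N. R k) + hausdorff1_outer (R N)"
    using Suc.IH by (simp add: add_right_mono)
  also have "\<dots> \<le> hausdorff1_outer ((\<Union>k<N. R k) \<union> R N)"
    using d by (intro hausdorff1_outer_separated[of d]) auto
  also have "(\<Union>k<N. R k) \<union> R N = (\<Union>k<Suc N. R k)"
    by (auto simp: lessThan_Suc)
  finally show ?case .
qed

lemma hausdorff1_outer_closed_split:
  fixes A C :: "'a::metric_space set"
  assumes "closed C"
  shows "hausdorff1_outer (A \<inter> C) + hausdorff1_outer (A - C) \<le> hausdorff1_outer A"
proof (cases "C = {} \<or> hausdorff1_outer A = \<infinity>")
  case True
  then show ?thesis by (auto simp: hausdorff1_outer_empty)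
next
  case False
  let ?H = "hausdorff1_outer :: 'a set \<Rightarrow> ennreal"
  let ?d = "\<lambda>x. infdist x C"
  define T where "T n = {x \<in> A. 1 / (real n + 1) \<le> ?d x}" for n
  define R where "R n = {x \<in> A. 1 / (real n + 2) \<le> ?d x \<and> ?d x < 1 / (real n + 1)}" for n
  have Rsep: "\<exists>d>0. \<forall>x\<in>R m. \<forall>y\<in>R n. d \<le> dist x y" if "m + 2 \<le> n" for m n
  proof (intro exI[of _ "1 / (real m + 2) - 1 / (real m + 3)"] conjI ballI)
    show "1 / (real m + 2) - 1 / (real m + 3) > 0"
      using divide_strict_left_mono[of "real m + 2" "real m + 3" 1] by simp
    fix x y assume "x \<in> R m" "y \<in> R n"
    then have "1 / (real m + 2) \<le> ?d x" "?d y < 1 / (real n + 1)" by (auto simp: R_def)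
    moreover have "1 / (real n + 1) \<le> 1 / (real m + 3)"
      using that by (intro divide_left_mono) auto
    moreover have "?d x \<le> ?d y + dist x y" by (rule infdist_triangle)
    ultimately show "1 / (real m + 2) - 1 / (real m + 3) \<le> dist x y" by linarith
  qed
  have half: "(\<Sum>k<N. ?H (R (2 * k + c))) \<le> ?H A" for N c
  proof -
    have "(\<Sum>k<N. ?H (R (2 * k + c))) \<le> ?H (\<Union>k<N. R (2 * k + c))"
      by (rule hausdorff1_outer_separated_sum[of "\<lambda>k. R (2 * k + c)"]) (auto intro!: Rsep)
    also have "\<dots> \<le> ?H A" by (rule hausdorff1_outer_mono) (auto simp: R_def)
    finally show ?thesis .
  qed
  have double: "(\<Sum>k<2 * N. f k) = (\<Sum>k<N. f (2 * k)) + (\<Sum>k<N. f (2 * k + 1))"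
    for f :: "nat \<Rightarrow> ennreal" and N
    by (induction N) (auto simp: algebra_simps)
  have "(\<Sum>n. ?H (R n)) \<le> ?H A + ?H A"
  proof (rule suminf_le_const)
    fix N
    have "(\<Sum>k<N. ?H (R k)) \<le> (\<Sum>k<2 * N. ?H (R k))"
      by (rule sum_mono2) auto
    also have "\<dots> \<le> ?H A + ?H A"
      unfolding double using half[where c = 0] half[where c = 1] by (intro add_mono) auto
    finally show "(\<Sum>k<N. ?H (R k)) \<le> ?H A + ?H A" .
  qed auto
  then have fin: "(\<Sum>n. ?H (R n)) \<noteq> \<infinity>"
    using False by (auto simp: top_unique)
  have tail: "(\<lambda>n. \<Sum>k. ?H (R (k + n))) \<longlonglongrightarrow> 0"
  proof -
    define h where "h n = enn2real (?H (R n))" for n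
    have hR: "?H (R n) = ennreal (h n)" for n
      using fin ennreal_suminf_lessD[of "\<lambda>n. ?H (R n)" \<infinity> n] by (auto simp: h_def less_top)
    have h0: "h n \<ge> 0" for n by (simp add: h_def)
    have sm: "summable h"
      using fin h0 by (intro summable_suminf_not_top) (auto simp: hR)
    have "(\<Sum>k. ?H (R (k + n))) = ennreal (\<Sum>k. h (k + n))" for n
      unfolding hR using h0 sm by (intro suminf_ennreal2) (auto simp: summable_iff_shift)
    moreover have "(\<lambda>n. ennreal (\<Sum>k. h (k + n))) \<longlonglongrightarrow> ennreal 0"
      by (rule tendsto_ennrealI, rule suminf_exist_split2[OF sm])
    ultimately show ?thesis by simp
  qed
  have bound: "?H (A \<inter> C) + ?H (A - C) \<le> ?H A + (\<Sum>k. ?H (R (k + n)))" for n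
  proof -
    have cover: "A - C \<subseteq> T n \<union> (\<Union>k. R (k + n))"
    proof
      fix x assume x: "x \<in> A - C"
      then have pos: "?d x > 0"
        using False \<open>closed C\<close> by (intro infdist_pos_not_in_closed) auto
      show "x \<in> T n \<union> (\<Union>k. R (k + n))"
      proof (cases "x \<in> T n")
        case False
        obtain m :: nat where "1 / (real m + 1) \<le> ?d x"
          using reals_Archimedean[OF pos] by (auto simp: inverse_eq_divide add.commute intro: less_imp_le)
        then have ex: "x \<in> T m" using x by (auto simp: T_def)
        define p where "p = (LEAST m. x \<in> T m)"
        have p: "x \<in> T p" unfolding p_def using ex by (rule LeastI)
        have np: "x \<notin> T q" if "q < p" for q using that unfolding p_def by (rule not_less_Least)
        have mono: "T a \<subseteq> T b" if "a \<le> b" for a b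
        proof -
          have "1 / (real b + 1) \<le> 1 / (real a + 1)" using that by (intro divide_left_mono) auto
          then show ?thesis by (auto simp: T_def)
        qed
        have "n < p" using False p mono[of p n] by (meson not_le subsetD)
        then obtain k where k: "p = Suc (k + n)" by (metis less_imp_Suc_add add.commute)
        have "x \<in> R (k + n)"
          using p np[of "k + n"] x by (auto simp: R_def T_def k add_ac)
        then show ?thesis by auto
      qed simp
    qed
    have "?H (A - C) \<le> ?H (T n \<union> (\<Union>k. R (k + n)))" by (rule hausdorff1_outer_mono[OF cover])
    also have "\<dots> \<le> ?H (T n) + ?H (\<Union>k. R (k + n))" by (rule hausdorff1_outer_subadditive2)
    also have "\<dots> \<le> ?H (T n) + (\<Sum>k. ?H (R (k + n)))"
      by (intro add_left_mono hausdorff1_outer_subadditive)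
    finally have "?H (A \<inter> C) + ?H (A - C) \<le> (?H (A \<inter> C) + ?H (T n)) + (\<Sum>k. ?H (R (k + n)))"
      by (metis add.assoc add_left_mono)
    also have "?H (A \<inter> C) + ?H (T n) \<le> ?H ((A \<inter> C) \<union> T n)"
    proof (rule hausdorff1_outer_separated)
      show "1 / (real n + 1) > 0" by simp
      fix x y assume "x \<in> A \<inter> C" "y \<in> T n"
      then show "1 / (real n + 1) \<le> dist x y"
        using infdist_le[of x C y] by (auto simp: T_def dist_commute)
    qed
    also have "\<dots> \<le> ?H A" by (rule hausdorff1_outer_mono) (auto simp: T_def)
    finally show ?thesis by (simp add: add_right_mono)
  qed
  have "(\<lambda>n. ?H A + (\<Sum>k. ?H (R (k + n)))) \<longlonglongrightarrow> ?H A + 0"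
    by (intro tendsto_add tendsto_const tail)
  then show ?thesis
    using bound by (intro LIMSEQ_le_const[where X = "\<lambda>n. ?H A + (\<Sum>k. ?H (R (k + n)))"]) auto
qed

lemma measure_space_hausdorff1_outer:
  "measure_space UNIV (sets borel) (hausdorff1_outer :: 'a::metric_space set \<Rightarrow> ennreal)"
proof -
  let ?H = "hausdorff1_outer :: 'a set \<Rightarrow> ennreal"
  let ?L = "lambda_system UNIV UNIV ?H"
  have "outer_measure_space UNIV ?H"
    by (auto simp: outer_measure_space_def positive_def increasing_def countably_subadditive_def
        hausdorff1_outer_empty hausdorff1_outer_mono hausdorff1_outer_subadditive)
  then have ms: "measure_space UNIV ?L ?H"
    using sigma_algebra.caratheodory_lemma[OF sigma_algebra_Pow, of UNIV ?H] by simp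
  then interpret L: sigma_algebra UNIV ?L by (simp add: measure_space_def)
  have closed: "C \<in> ?L" if "closed C" for C
  proof -
    have "?H (C \<inter> A) + ?H ((UNIV - C) \<inter> A) = ?H A" for A
    proof (rule antisym)
      show "?H (C \<inter> A) + ?H ((UNIV - C) \<inter> A) \<le> ?H A"
        using hausdorff1_outer_closed_split[OF that, of A]
        by (simp add: Int_commute Diff_eq)
      have "A = (C \<inter> A) \<union> ((UNIV - C) \<inter> A)" by auto
      then show "?H A \<le> ?H (C \<inter> A) + ?H ((UNIV - C) \<inter> A)"
        by (metis hausdorff1_outer_subadditive2)
    qed
    then show ?thesis by (simp add: lambda_system_def)
  qed
  have "sets borel \<subseteq> ?L"
    unfolding borel_eq_closed
    by (subst sets_measure_of) (auto intro!: L.sigma_sets_subset closed)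
  moreover have "sigma_algebra UNIV (sets (borel :: 'a measure))"
    using sets.sigma_algebra_axioms[of borel] by simp
  ultimately show ?thesis using measure_down[OF ms] by blast
qed

lemma emeasure_hausdorff1:
  fixes A :: "'a::metric_space set"
  assumes "A \<in> sets borel"
  shows "emeasure hausdorff1 A = hausdorff1_outer A"
  using assms measure_space_hausdorff1_outer[where 'a = 'a]
    sets.sigma_sets_eq[of "borel :: 'a measure"]
  by (simp add: hausdorff1_def emeasure_measure_of_conv)

definition boundary_measure :: "complex set \<Rightarrow> complex measure" where
  "boundary_measure \<Omega> = restrict_space hausdorff1 (frontier \<Omega>)"

section \<open>Sobolev functions and traces\<close>

definition square_integrable :: "'a measure \<Rightarrow> ('a \<Rightarrow> complex) \<Rightarrow> bool" where
  "square_integrable M f \<longleftrightarrow> f \<in> borel_measurable M \<and> integrable M (\<lambda>x. (cmod (f x))\<^sup>2)"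

definition test_functions :: "complex set \<Rightarrow> (complex \<Rightarrow> real) set" where
  "test_functions \<Omega> =
     {\<phi>. smooth_on UNIV \<phi> \<and> (\<exists>K. compact K \<and> K \<subseteq> \<Omega> \<and> (\<forall>x. x \<notin> K \<longrightarrow> \<phi> x = 0))}"

definition has_weak_partial ::
  "complex set \<Rightarrow> complex \<Rightarrow> (complex \<Rightarrow> complex) \<Rightarrow> (complex \<Rightarrow> complex) \<Rightarrow> bool" where
  "has_weak_partial \<Omega> b u v \<longleftrightarrow>
     (\<forall>\<phi>\<in>test_functions \<Omega>.
        (LINT x|lebesgue_on \<Omega>. frechet_derivative \<phi> (at x) b *\<^sub>R u x)
          = - (LINT x|lebesgue_on \<Omega>. \<phi> x *\<^sub>R v x))"

text \<open>Elements of \<open>H\<^sup>1(\<Omega>; \<complex>)\<close> are represented by functions rather than by classes modulo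
  equality almost everywhere, and their values outside \<open>\<Omega>\<close> are irrelevant.\<close>

definition H1 :: "complex set \<Rightarrow> (complex \<Rightarrow> complex) set" where
  "H1 \<Omega> = {u. square_integrable (lebesgue_on \<Omega>) u \<and>
     (\<forall>b\<in>Basis. \<exists>v. square_integrable (lebesgue_on \<Omega>) v \<and> has_weak_partial \<Omega> b u v)}"

text \<open>For \<open>u \<in> H\<^sup>1(\<Omega>; \<complex>)\<close> the chosen function is unique almost everywhere on \<open>\<Omega>\<close>.\<close>

definition weak_partial :: "complex set \<Rightarrow> complex \<Rightarrow> (complex \<Rightarrow> complex) \<Rightarrow> complex \<Rightarrow> complex" where
  "weak_partial \<Omega> b u =
     (SOME v. square_integrable (lebesgue_on \<Omega>) v \<and> has_weak_partial \<Omega> b u v)"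

definition dirichlet_energy :: "complex set \<Rightarrow> (complex \<Rightarrow> complex) \<Rightarrow> real" where
  "dirichlet_energy \<Omega> u =
     (LINT x|lebesgue_on \<Omega>. (\<Sum>b\<in>Basis. (cmod (weak_partial \<Omega> b u x))\<^sup>2))"

definition H1_norm :: "complex set \<Rightarrow> (complex \<Rightarrow> complex) \<Rightarrow> real" where
  "H1_norm \<Omega> u = sqrt ((LINT x|lebesgue_on \<Omega>. (cmod (u x))\<^sup>2) + dirichlet_energy \<Omega> u)"

text \<open>The trace operator \<open>H\<^sup>1(\<Omega>) \<rightarrow> L\<^sup>2(\<partial>\<Omega>)\<close> is the continuous extension of the restriction
  \<open>\<phi> \<mapsto> \<phi>|\<^bsub>\<partial>\<Omega>\<^esub>\<close> from the dense subspace of functions smooth up to the boundary.\<close>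

definition has_trace :: "complex set \<Rightarrow> (complex \<Rightarrow> complex) \<Rightarrow> (complex \<Rightarrow> complex) \<Rightarrow> bool" where
  "has_trace \<Omega> u g \<longleftrightarrow>
     square_integrable (boundary_measure \<Omega>) g \<and>
     (\<exists>\<phi> :: nat \<Rightarrow> complex \<Rightarrow> complex.
        (\<forall>k. smooth_on UNIV (\<phi> k)) \<and>
        (\<lambda>k. H1_norm \<Omega> (\<lambda>x. \<phi> k x - u x)) \<longlonglongrightarrow> 0 \<and>
        (\<lambda>k. LINT x|boundary_measure \<Omega>. (cmod (\<phi> k x - g x))\<^sup>2) \<longlonglongrightarrow> 0)"

definition H1_bc :: "complex set \<Rightarrow> (complex \<Rightarrow> complex) \<Rightarrow> (complex \<Rightarrow> complex) set" where
  "H1_bc \<Omega> g = {u \<in> H1 \<Omega>. has_trace \<Omega> u g}"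

section \<open>The minimization problem\<close>

definition admissible ::
  "complex set \<Rightarrow> nat \<Rightarrow> (nat \<Rightarrow> complex \<Rightarrow> complex) \<Rightarrow> (nat \<Rightarrow> complex \<Rightarrow> complex) set" where
  "admissible \<Omega> n g =
     {u \<in> (\<Pi>\<^sub>E j\<in>{1..n}. H1_bc \<Omega> (g j)).
        AE x in lebesgue_on \<Omega>. (\<Sum>j=1..n. (cmod (u j x))\<^sup>2) = real n}"

definition energy :: "complex set \<Rightarrow> nat \<Rightarrow> (nat \<Rightarrow> complex \<Rightarrow> complex) \<Rightarrow> real" where
  "energy \<Omega> n u = (\<Sum>j=1..n. dirichlet_energy \<Omega> (u j))"

definition min_energy :: "complex set \<Rightarrow> nat \<Rightarrow> (nat \<Rightarrow> complex \<Rightarrow> complex) \<Rightarrow> real" where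
  "min_energy \<Omega> n g = (INF u\<in>admissible \<Omega> n g. energy \<Omega> n u)"

end

theory Submission
  imports Defs
begin

text \<open>
  A minimizing sequence is bounded in \<open>H\<^sup>1\<close> and, because of the constraint, uniformly bounded. By the
  Poincare inequality on small squares it has a subsequence converging in \<open>L\<^sup>2\<close>, hence (again after
  passing to a subsequence) almost everywhere, so the limit satisfies the constraint. Suitable convex
  combinations of the sequence have the same \<open>L\<^sup>2\<close> limit and, by the parallelogram law, converge in
  \<open>H\<^sup>1\<close>; this preserves the traces and shows that the limit has minimal energy.

  The admissible class is not empty, whatever the degrees, since the sphere in \<open>\<complex>\<^sup>n\<close> is simply connected for
  \<open>n \<ge> 2\<close>: a smooth extension of the boundary data to a map into \<open>\<complex>\<^sup>n\<close> can be perturbed away from the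
  boundary so as to avoid the origin, and is then projected to the sphere.
\<close>

section \<open>Smooth functions\<close>

text \<open>Two obstacles shape the argument. \<open>has_trace\<close> speaks of approximation by
  smooth functions in \<open>H1_norm\<close>, so it hands boundary values on along strong
  convergence in H^1, which a minimizing sequence need not have. The constraint, on the other hand,
  is not convex, so the combinations that repair the convergence leave the admissible class, and
  their energies may even fall below the infimum. Hence both sequences are kept: the original one
  passes the constraint on to the common limit, the combinations pass on the boundary values and an
  upper bound for the energy. The limit is then admissible itself, which turns the upper bound into
  equality.

  Compactness uses squares inside the domain only. They leave a remainder of small measure, on which
  the bound from the constraint controls the L^2 norm. The smooth approximations contained in the
  definition of a trace carry the Poincare inequality from smooth functions to the admissible
  ones.\<close>

lemma Ck_on_cong:
  assumes "open S" "\<And>x. x \<in> S \<Longrightarrow> f x = g x"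
  shows "Ck_on k S f \<longleftrightarrow> Ck_on k S g"
  using assms(2)
proof (induction k arbitrary: f g)
  case 0
  then show ?case by (auto intro: continuous_on_cong)
next
  case (Suc k)
  have d: "(f has_derivative D) (at x) \<longleftrightarrow> (g has_derivative D) (at x)" if "x \<in> S" for x D
    using Suc.prems that \<open>open S\<close> by (metis has_derivative_transform_within_open)
  then have "frechet_derivative f (at x) = frechet_derivative g (at x)" if "x \<in> S" for x
    using that by (simp add: frechet_derivative_def)
  then have "Ck_on k S (\<lambda>x. frechet_derivative f (at x) b) \<longleftrightarrow> Ck_on k S (\<lambda>x. frechet_derivative g (at x) b)" for b
    by (intro Suc.IH) simp
  moreover have "f differentiable_on S \<longleftrightarrow> g differentiable_on S"
    using d \<open>open S\<close> by (simp add: differentiable_on_eq_differentiable_at differentiable_def)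
  ultimately show ?case by simp
qed

lemma Ck_on_Suc_imp: "Ck_on (Suc k) S f \<Longrightarrow> Ck_on k S f"
  by (induction k arbitrary: f) (auto intro: differentiable_imp_continuous_on)

text \<open>Derivatives at points of an open set are unique, so any explicit derivative may stand in
  for the chosen \<open>frechet_derivative\<close>. The closure proofs below exhibit such
  derivatives.\<close>

lemma Ck_on_SucI:
  assumes "open S" "\<And>x. x \<in> S \<Longrightarrow> (f has_derivative f' x) (at x)"
    and "\<And>b. b \<in> Basis \<Longrightarrow> Ck_on k S (\<lambda>x. f' x b)"
  shows "Ck_on (Suc k) S f"
proof -
  have "f differentiable_on S"
    using assms(1,2) by (auto simp: differentiable_on_eq_differentiable_at differentiable_def)
  moreover have "Ck_on k S (\<lambda>x. frechet_derivative f (at x) b)" if "b \<in> Basis" for b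
    by (subst Ck_on_cong[OF assms(1), of _ "\<lambda>x. f' x b"])
       (use assms(2,3) that frechet_derivative_at in fastforce)+
  ultimately show ?thesis by simp
qed

lemma Ck_on_SucD:
  assumes "open S" "Ck_on (Suc k) S f"
  shows "x \<in> S \<Longrightarrow> (f has_derivative frechet_derivative f (at x)) (at x)"
    and "b \<in> Basis \<Longrightarrow> Ck_on k S (\<lambda>x. frechet_derivative f (at x) b)"
  using assms by (auto simp: differentiable_on_eq_differentiable_at frechet_derivative_works[symmetric])

lemma Ck_on_const: "open S \<Longrightarrow> Ck_on k S (\<lambda>x. c)"
  by (induction k arbitrary: c) (auto intro!: Ck_on_SucI[where f'="\<lambda>_ _. 0"] simp del: Ck_on.simps(2))

lemma Ck_on_bounded_linear: "open S \<Longrightarrow> bounded_linear f \<Longrightarrow> Ck_on k S f"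
  by (cases k) (auto intro!: Ck_on_SucI[where f'="\<lambda>_. f"] Ck_on_const linear_continuous_on
      bounded_linear_imp_has_derivative simp del: Ck_on.simps(2))

lemma Ck_on_add:
  assumes "open S" "Ck_on k S f" "Ck_on k S g"
  shows "Ck_on k S (\<lambda>x. f x + g x)"
  using assms(2,3)
proof (induction k arbitrary: f g)
  case 0
  then show ?case by (auto intro: continuous_on_add)
next
  case (Suc k)
  show ?case
    by (intro Ck_on_SucI[OF assms(1), where
          f'="\<lambda>x h. frechet_derivative f (at x) h + frechet_derivative g (at x) h"]
        has_derivative_add Suc.IH Ck_on_SucD[OF assms(1) Suc.prems(1)] Ck_on_SucD[OF assms(1) Suc.prems(2)])
qed

text \<open>In each term of the product rule only one factor is differentiated; the other is
  weakened by \<open>Ck_on_Suc_imp\<close> before the induction hypothesis applies. General bounded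
  bilinear maps settle scaling, inner products and multiplication at once.\<close>

lemma Ck_on_bilinear:
  fixes f :: "'a::euclidean_space \<Rightarrow> 'b::real_normed_vector"
    and g :: "'a \<Rightarrow> 'c::real_normed_vector" and prod :: "'b \<Rightarrow> 'c \<Rightarrow> 'd::real_normed_vector"
  assumes "open S" "bounded_bilinear prod" "Ck_on k S f" "Ck_on k S g"
  shows "Ck_on k S (\<lambda>x. prod (f x) (g x))"
  using assms(3,4)
proof (induction k arbitrary: f g)
  case 0
  then show ?case by (auto intro: bounded_bilinear.continuous_on[OF assms(2)])
next
  case (Suc k)
  show ?case
    by (intro Ck_on_SucI[OF assms(1), where
          f'="\<lambda>x h. prod (f x) (frechet_derivative g (at x) h) + prod (frechet_derivative f (at x) h) (g x)"]
        bounded_bilinear.FDERIV[OF assms(2)] Ck_on_add[OF assms(1)] Suc.IH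
        Ck_on_SucD[OF assms(1) Suc.prems(1)] Ck_on_SucD[OF assms(1) Suc.prems(2)]
        Ck_on_Suc_imp[OF Suc.prems(1)] Ck_on_Suc_imp[OF Suc.prems(2)])
qed

text \<open>With a real variable in between, the chain rule yields the scalar \<open>?g' x b\<close>
  times the vector \<open>?f' (g x)\<close>, so the induction step is an instance of
  \<open>Ck_on_bilinear\<close>. Later compositions are with \<open>flat\<close> and with real
  powers.\<close>

lemma Ck_on_compose_real:
  fixes f :: "real \<Rightarrow> 'b::real_normed_vector" and g :: "'a::euclidean_space \<Rightarrow> real"
  assumes "open S" "open T" "g ` S \<subseteq> T" "Ck_on k T f" "Ck_on k S g"
  shows "Ck_on k S (\<lambda>x. f (g x))"
  using assms(4,5)
proof (induction k arbitrary: f)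
  case 0
  then show ?case
    using assms(3) by (auto intro: continuous_on_compose2)
next
  case (Suc k)
  let ?f' = "\<lambda>y. frechet_derivative f (at y) 1" and ?g' = "\<lambda>x. frechet_derivative g (at x)"
  \<comment> \<open>A linear map on the reals is determined by its value at 1.\<close>
  have f': "frechet_derivative f (at y) h = h *\<^sub>R ?f' y" if "y \<in> T" for y h
    using linear_simps(5)[OF has_derivative_bounded_linear[OF Ck_on_SucD(1)[OF assms(2) Suc.prems(1) that]], of h 1]
    by simp
  show ?case
  proof (rule Ck_on_SucI[OF assms(1)])
    fix x assume x: "x \<in> S"
    then have gx: "g x \<in> T" using assms(3) by blast
    have eq: "(\<lambda>h. frechet_derivative f (at (g x)) (?g' x h)) = (\<lambda>h. ?g' x h *\<^sub>R ?f' (g x))"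
      by (rule ext) (rule f'[OF gx])
    show "((\<lambda>x. f (g x)) has_derivative (\<lambda>h. ?g' x h *\<^sub>R ?f' (g x))) (at x)"
      by (rule has_derivative_eq_rhs[OF has_derivative_compose[OF Ck_on_SucD(1)[OF assms(1) Suc.prems(2) x]
            Ck_on_SucD(1)[OF assms(2) Suc.prems(1) gx]] eq])
  next
    fix b :: 'a assume b: "b \<in> Basis"
    have "Ck_on k S (\<lambda>x. ?f' (g x))"
      by (rule Suc.IH[OF Ck_on_SucD(2)[OF assms(2) Suc.prems(1)] Ck_on_Suc_imp[OF Suc.prems(2)]]) simp
    then show "Ck_on k S (\<lambda>x. ?g' x b *\<^sub>R ?f' (g x))"
      by (intro Ck_on_bilinear[OF assms(1) bounded_bilinear_scaleR] Ck_on_SucD(2)[OF assms(1) Suc.prems(2) b])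
  qed
qed

lemma Ck_on_subset:
  assumes "open S" "open T" "T \<subseteq> S" "Ck_on k S f" shows "Ck_on k T f"
  using assms(4)
proof (induction k arbitrary: f)
  case 0
  then show ?case using assms(3) by (auto intro: continuous_on_subset)
next
  case (Suc k)
  then show ?case using assms(3) by (auto intro: differentiable_on_subset)
qed

lemma Ck_on_local:
  assumes "open S" "\<And>x. x \<in> S \<Longrightarrow> \<exists>U. open U \<and> x \<in> U \<and> U \<subseteq> S \<and> Ck_on k U f"
  shows "Ck_on k S f"
  using assms(2)
proof (induction k arbitrary: f)
  case 0
  then have "continuous (at x) f" if "x \<in> S" for x
    using that by (metis Ck_on.simps(1) continuous_on_eq_continuous_at)
  then show ?case by (simp add: continuous_at_imp_continuous_on)
next
  case (Suc k)
  show ?case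
  proof (rule Ck_on_SucI[OF assms(1)])
    fix x assume "x \<in> S"
    then show "(f has_derivative frechet_derivative f (at x)) (at x)"
      using Suc.prems Ck_on_SucD(1) by metis
  next
    fix b :: 'a assume "b \<in> Basis"
    show "Ck_on k S (\<lambda>x. frechet_derivative f (at x) b)"
    proof (rule Suc.IH)
      fix x assume "x \<in> S"
      then obtain U where U: "open U" "x \<in> U" "U \<subseteq> S" "Ck_on (Suc k) U f"
        using Suc.prems by blast
      from Ck_on_SucD(2)[OF U(1,4) \<open>b \<in> Basis\<close>] U(1-3)
      show "\<exists>U. open U \<and> x \<in> U \<and> U \<subseteq> S \<and> Ck_on k U (\<lambda>x. frechet_derivative f (at x) b)"
        by blast
    qed
  qed
qed

section \<open>Closure properties of smooth functions\<close>

lemma smooth_on_cong: "open S \<Longrightarrow> (\<And>x. x \<in> S \<Longrightarrow> f x = g x) \<Longrightarrow> smooth_on S f \<longleftrightarrow> smooth_on S g"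
  unfolding smooth_on_def using Ck_on_cong by metis

lemma smooth_on_subset: "smooth_on S f \<Longrightarrow> open S \<Longrightarrow> open T \<Longrightarrow> T \<subseteq> S \<Longrightarrow> smooth_on T f"
  unfolding smooth_on_def using Ck_on_subset by metis

lemma smooth_on_local:
  assumes "open S" "\<And>x. x \<in> S \<Longrightarrow> \<exists>U. open U \<and> x \<in> U \<and> U \<subseteq> S \<and> smooth_on U f"
  shows "smooth_on S f"
  unfolding smooth_on_def
proof
  show "Ck_on k S f" for k
    using assms(2) by (intro Ck_on_local[OF assms(1)]) (meson smooth_on_def)
qed

lemma smooth_on_const: "open S \<Longrightarrow> smooth_on S (\<lambda>x. c)"
  by (simp add: smooth_on_def Ck_on_const)

lemma smooth_on_bounded_linear: "open S \<Longrightarrow> bounded_linear f \<Longrightarrow> smooth_on S f"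
  by (simp add: smooth_on_def Ck_on_bounded_linear)

lemma smooth_on_add: "open S \<Longrightarrow> smooth_on S f \<Longrightarrow> smooth_on S g \<Longrightarrow> smooth_on S (\<lambda>x. f x + g x)"
  by (simp add: smooth_on_def Ck_on_add)

lemma smooth_on_scaleR:
  "open S \<Longrightarrow> smooth_on S f \<Longrightarrow> smooth_on S g \<Longrightarrow> smooth_on S (\<lambda>x. f x *\<^sub>R g x)"
  by (simp add: smooth_on_def Ck_on_bilinear[OF _ bounded_bilinear_scaleR])

lemma smooth_on_inner:
  "open S \<Longrightarrow> smooth_on S f \<Longrightarrow> smooth_on S g \<Longrightarrow> smooth_on S (\<lambda>x. f x \<bullet> g x)"
  by (simp add: smooth_on_def Ck_on_bilinear[OF _ bounded_bilinear_inner])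

lemma smooth_on_mult:
  fixes f g :: "'a::euclidean_space \<Rightarrow> 'b::real_normed_algebra"
  shows "open S \<Longrightarrow> smooth_on S f \<Longrightarrow> smooth_on S g \<Longrightarrow> smooth_on S (\<lambda>x. f x * g x)"
  by (simp add: smooth_on_def Ck_on_bilinear[OF _ bounded_bilinear_mult])

lemma smooth_on_compose_real:
  fixes f :: "real \<Rightarrow> 'b::real_normed_vector" and g :: "'a::euclidean_space \<Rightarrow> real"
  shows "open S \<Longrightarrow> open T \<Longrightarrow> g ` S \<subseteq> T \<Longrightarrow> smooth_on T f \<Longrightarrow> smooth_on S g
    \<Longrightarrow> smooth_on S (\<lambda>x. f (g x))"
  by (simp add: smooth_on_def Ck_on_compose_real)

lemma smooth_on_diff: 
  assumes "open S" "smooth_on S f" "smooth_on S g" shows "smooth_on S (\<lambda>x. f x - g x)"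
  using smooth_on_add[OF assms(1,2) smooth_on_scaleR[OF assms(1) smooth_on_const[OF assms(1), of "-1"] assms(3)]]
  by simp

lemma smooth_on_sum:
  "open S \<Longrightarrow> (\<And>i. i \<in> I \<Longrightarrow> smooth_on S (f i)) \<Longrightarrow> smooth_on S (\<lambda>x. \<Sum>i\<in>I. f i x)"
  by (induction I rule: infinite_finite_induct) (auto intro!: smooth_on_const smooth_on_add)

lemma smooth_on_norm_power2: "open S \<Longrightarrow> smooth_on S f \<Longrightarrow> smooth_on S (\<lambda>x. (norm (f x :: 'b::real_inner))\<^sup>2)"
  by (simp add: power2_norm_eq_inner smooth_on_inner)

lemma smooth_on_frechet_derivative:
  assumes "smooth_on S f" "b \<in> Basis"
  shows "smooth_on S (\<lambda>x. frechet_derivative f (at x) b)"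
  unfolding smooth_on_def
proof
  fix k
  have "Ck_on (Suc k) S f" using assms(1) by (simp only: smooth_on_def)
  then show "Ck_on k S (\<lambda>x. frechet_derivative f (at x) b)" using assms(2) by simp
qed

lemma smooth_on_has_derivative:
  assumes "open S" "smooth_on S f" "x \<in> S"
  shows "(f has_derivative frechet_derivative f (at x)) (at x)"
  using assms Ck_on_SucD(1)[of S 0 f x] by (simp add: smooth_on_def del: Ck_on.simps)

lemma smooth_on_imp_continuous_on: "smooth_on S f \<Longrightarrow> continuous_on S f"
  using Ck_on.simps(1) unfolding smooth_on_def by blast

text \<open>The exponent is left general because differentiation lowers it by one. The exponents -1
  and -1/2 provide the reciprocals and the normalizing factor of the constructions below.\<close>

lemma smooth_on_powr: "smooth_on {0<..} (\<lambda>t::real. t powr a)"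
  unfolding smooth_on_def
proof
  show "Ck_on k {0<..} (\<lambda>t::real. t powr a)" for k
  proof (induction k arbitrary: a)
    case 0
    show ?case by (auto intro!: continuous_intros)
  next
    case (Suc k)
    show ?case
    proof (rule Ck_on_SucI)
      fix x :: real assume "x \<in> {0<..}"
      then show "((\<lambda>t. t powr a) has_derivative (\<lambda>h. h *\<^sub>R (a *\<^sub>R x powr (a - 1)))) (at x)"
        using has_real_derivative_powr[of x a] by (simp add: has_field_derivative_def mult_commute_abs mult_ac)
    next
      fix b :: real assume b: "b \<in> Basis"
      show "Ck_on k {0<..} (\<lambda>x. b *\<^sub>R (a *\<^sub>R x powr (a - 1)))"
        by (intro Ck_on_bilinear[OF _ bounded_bilinear_scaleR] Ck_on_const Suc open_greaterThan)
    qed auto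
  qed
qed

text \<open>The family with the extra factor \<open>t\<^sup>-\<^sup>n\<close> is closed under differentiation.\<close>

definition flat :: "nat \<Rightarrow> real \<Rightarrow> real" where
  "flat n t = (if t \<le> 0 then 0 else exp (- inverse t) * inverse t ^ n)"

lemma flat_has_real_derivative:
  "(flat n has_real_derivative (flat (n + 2) t - real n * flat (n + 1) t)) (at t)"
proof (cases "t = 0")
  case False
  show ?thesis
  proof (cases "t < 0")
    case True
    have "((\<lambda>_. 0) has_real_derivative (flat (n + 2) t - real n * flat (n + 1) t)) (at t)"
      using True by (auto simp: flat_def)
    then show ?thesis
      by (rule has_field_derivative_transform_within_open[where S="{..<0}"]) (use True in \<open>auto simp: flat_def\<close>)
  next
    case t: False
    with \<open>t \<noteq> 0\<close> have t: "t > 0" by simp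
    have "((\<lambda>t. exp (- inverse t) * inverse t ^ n) has_real_derivative
      exp (- inverse t) * (inverse t)\<^sup>2 * inverse t ^ n
        - exp (- inverse t) * (real n * (inverse t)\<^sup>2 * inverse t ^ (n - 1))) (at t)"
      using t by (auto intro!: derivative_eq_intros simp: power2_eq_square)
    also have "exp (- inverse t) * (inverse t)\<^sup>2 * inverse t ^ n
        - exp (- inverse t) * (real n * (inverse t)\<^sup>2 * inverse t ^ (n - 1))
      = flat (n + 2) t - real n * flat (n + 1) t"
      using t by (cases n) (simp_all add: flat_def power2_eq_square)
    finally show ?thesis
      by (rule has_field_derivative_transform_within_open[where S="{0<..}"]) (use t in \<open>auto simp: flat_def\<close>)
  qed
next
  case True
  have "((\<lambda>h. flat n h / h) \<longlongrightarrow> 0) (at_left 0)"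
    by (rule tendsto_eventually) (auto simp: eventually_at_filter flat_def)
  moreover have "((\<lambda>h. flat n h / h) \<longlongrightarrow> 0) (at_right 0)"
  proof -
    \<comment> \<open>With s = 1/h the right difference quotient is
      \<open>s ^ (n + 1) / exp s\<close>; the division by h raises the power by one.\<close>
    have "((\<lambda>s::real. s ^ (n + 1) / exp s) \<longlongrightarrow> 0) at_top"
      by (rule tendsto_power_div_exp_0)
    then have "((\<lambda>h::real. inverse h ^ (n + 1) / exp (inverse h)) \<longlongrightarrow> 0) (at_right 0)"
      by (rule filterlim_compose) (rule filterlim_inverse_at_top_right)
    then show ?thesis
      by (rule Lim_transform_eventually)
         (auto simp: eventually_at_filter flat_def exp_minus field_simps)
  qed
  ultimately have "((\<lambda>h. flat n h / h) \<longlongrightarrow> 0) (at 0)"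
    by (simp add: filterlim_split_at)
  then show ?thesis
    using True by (simp add: has_field_derivative_iff flat_def)
qed

lemma Ck_on_flat: "Ck_on k UNIV (flat n)"
proof (induction k arbitrary: n)
  case 0
  show ?case
    using flat_has_real_derivative by (auto intro!: continuous_at_imp_continuous_on DERIV_isCont)
next
  case (Suc k)
  show ?case
  proof (rule Ck_on_SucI)
    fix x
    show "(flat n has_derivative (\<lambda>h. h *\<^sub>R (flat (n + 2) x + (- real n) *\<^sub>R flat (n + 1) x))) (at x)"
      using flat_has_real_derivative[of n x] by (simp add: has_field_derivative_def mult_commute_abs)
  next
    fix b :: real assume b: "b \<in> Basis"
    show "Ck_on k UNIV (\<lambda>x. b *\<^sub>R (flat (n + 2) x + (- real n) *\<^sub>R flat (n + 1) x))"
      by (intro Ck_on_add Ck_on_bilinear[OF _ bounded_bilinear_scaleR] Ck_on_const Suc open_UNIV)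
  qed auto
qed

lemma smooth_on_flat: "smooth_on UNIV (flat n)"
  by (simp add: smooth_on_def Ck_on_flat)

lemma flat_nonneg: "0 \<le> flat n t" and flat_pos_iff: "0 < flat n t \<longleftrightarrow> 0 < t"
  and flat_le_1: "flat 0 t \<le> 1"
  by (auto simp: flat_def)

section \<open>Square integrable functions\<close>

lemma norm_add_power2_le: "(norm (a + b :: 'a::real_normed_vector))\<^sup>2 \<le> 2 * (norm a)\<^sup>2 + 2 * (norm b)\<^sup>2"
proof -
  have "(norm (a + b))\<^sup>2 \<le> (norm a + norm b)\<^sup>2"
    by (intro power_mono norm_triangle_ineq) auto
  also have "\<dots> \<le> 2 * (norm a)\<^sup>2 + 2 * (norm b)\<^sup>2"
    using sum_squares_bound[of "norm a" "norm b"] by (simp add: power2_sum)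
  finally show ?thesis .
qed

lemma norm_diff_power2_le: "(norm (a - b :: 'a::real_normed_vector))\<^sup>2 \<le> 2 * (norm a)\<^sup>2 + 2 * (norm b)\<^sup>2"
  using norm_add_power2_le[of a "- b"] by simp

text \<open>Working with squares replaces Minkowski's inequality by |a + b|^2 \<le> 2 |a|^2 + 2
  |b|^2. The factors 2 are harmless in all limits below; the final energy estimate, where the
  constant matters, rests on \<open>norm_power2_le_weighted\<close> instead.\<close>

abbreviation L2sq :: "'a measure \<Rightarrow> ('a \<Rightarrow> complex) \<Rightarrow> real" where
  "L2sq M f \<equiv> LINT x|M. (cmod (f x))\<^sup>2"

lemma square_integrable_scaleR:
  "square_integrable M f \<Longrightarrow> square_integrable M (\<lambda>x. c *\<^sub>R f x)"
  by (auto simp: square_integrable_def power_mult_distrib)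

lemma square_integrable_add:
  assumes "square_integrable M f" "square_integrable M g"
  shows "square_integrable M (\<lambda>x. f x + g x)"
proof -
  have [measurable]: "f \<in> borel_measurable M" "g \<in> borel_measurable M"
    using assms by (auto simp: square_integrable_def)
  have "integrable M (\<lambda>x. 2 * (cmod (f x))\<^sup>2 + 2 * (cmod (g x))\<^sup>2)"
    using assms by (auto simp: square_integrable_def)
  then have "integrable M (\<lambda>x. (cmod (f x + g x))\<^sup>2)"
    by (rule Bochner_Integration.integrable_bound) (auto simp: norm_add_power2_le)
  then show ?thesis by (simp add: square_integrable_def)
qed

lemma square_integrable_diff:
  assumes "square_integrable M f" "square_integrable M g"
  shows "square_integrable M (\<lambda>x. f x - g x)"
  using square_integrable_add[OF assms(1) square_integrable_scaleR[OF assms(2), of "-1"]] by simp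

lemma (in finite_measure) square_integrable_bounded:
  assumes "f \<in> borel_measurable M" "AE x in M. cmod (f x) \<le> B"
  shows "square_integrable M f"
  unfolding square_integrable_def
proof
  show "integrable M (\<lambda>x. (cmod (f x))\<^sup>2)"
  proof (rule integrable_const_bound[of _ "B\<^sup>2"])
    show "AE x in M. norm ((cmod (f x))\<^sup>2) \<le> B\<^sup>2"
      using assms(2) by eventually_elim (simp add: power_mono)
  qed (use assms(1) in measurable)
qed (rule assms)

text \<open>Since |f| \<le> 1 + |f|^2, finiteness of the measure turns square integrability into
  integrability. This makes the pairing with test functions and their partial derivatives
  meaningful.\<close>

lemma (in finite_measure) square_integrable_mult_bounded:
  fixes c :: "'a \<Rightarrow> real"
  assumes "square_integrable M f" and [measurable]: "c \<in> borel_measurable M" and "\<And>x. \<bar>c x\<bar> \<le> B"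
  shows "integrable M (\<lambda>x. c x *\<^sub>R f x)"
proof -
  have [measurable]: "f \<in> borel_measurable M" and i: "integrable M (\<lambda>x. (cmod (f x))\<^sup>2)"
    using assms by (auto simp: square_integrable_def)
  have "integrable M (\<lambda>x. B * (1 + (cmod (f x))\<^sup>2))" using i by simp
  then show ?thesis
  proof (rule Bochner_Integration.integrable_bound)
    have "\<bar>c x\<bar> * cmod (f x) \<le> B * (1 + (cmod (f x))\<^sup>2)" for x
    proof (rule mult_mono)
      show "cmod (f x) \<le> 1 + (cmod (f x))\<^sup>2"
        using sum_squares_bound[of "cmod (f x)" 1] norm_ge_zero[of "f x"]
        unfolding power2_eq_square by linarith
    qed (use assms(3)[of x] in auto)
    moreover have "B * (1 + (cmod (f x))\<^sup>2) \<le> \<bar>B * (1 + (cmod (f x))\<^sup>2)\<bar>" for x by simp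
    ultimately show "AE x in M. norm (c x *\<^sub>R f x) \<le> norm (B * (1 + (cmod (f x))\<^sup>2))"
      by (intro AE_I2) (simp only: norm_scaleR real_norm_def, meson order_trans)
  qed measurable
qed

lemma (in finite_measure) square_integrable_imp_integrable:
  "square_integrable M f \<Longrightarrow> integrable M f"
  using square_integrable_mult_bounded[of f "\<lambda>_. 1" 1] by simp

text \<open>Along a fast subsequence the increments are summable almost everywhere,
  because \<open>2 \<bar>d\<bar> \<le> 2\<^sup>-\<^sup>m + 2\<^sup>m \<bar>d\<bar>\<^sup>2\<close>; the Cauchy estimate passes to the limit by Fatou's lemma.\<close>

lemma (in finite_measure) square_integrable_complete:
  fixes f :: "nat \<Rightarrow> 'a \<Rightarrow> complex"
  assumes f: "\<And>k. square_integrable M (f k)"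
    and cauchy: "\<And>e. e > 0 \<Longrightarrow> \<exists>N. \<forall>k\<ge>N. \<forall>l\<ge>N. L2sq M (\<lambda>x. f k x - f l x) < e"
  obtains g where "square_integrable M g" "(\<lambda>k. L2sq M (\<lambda>x. f k x - g x)) \<longlonglongrightarrow> 0"
proof -
  have [measurable]: "f k \<in> borel_measurable M" for k
    using f by (auto simp: square_integrable_def)
  have dint: "integrable M (\<lambda>x. (cmod (f k x - f l x))\<^sup>2)" for k l
    using square_integrable_diff[OF f f] by (auto simp: square_integrable_def)
  \<comment> \<open>The rate 4^(-m) for squared norms still leaves the summable 2^(-m) after
    multiplication by the weight 2^m of \<open>dle\<close>.\<close>
  have "\<exists>N. \<forall>m. (\<forall>k\<ge>N m. \<forall>l\<ge>N m. L2sq M (\<lambda>x. f k x - f l x) < (1/4)^m)"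
    by (intro choice allI cauchy) simp
  then obtain N where N: "\<And>m k l. k \<ge> N m \<Longrightarrow> l \<ge> N m \<Longrightarrow> L2sq M (\<lambda>x. f k x - f l x) < (1/4)^m"
    by blast
  \<comment> \<open>All summands are positive, so \<open>r\<close> increases and dominates both
    \<open>N\<close> and the identity; the latter is used in \<open>fatou\<close>.\<close>
  define r where "r m = (\<Sum>i\<le>m. N i + 1)" for m
  have rN: "r m \<ge> N m" for m
    unfolding r_def by (induction m) auto
  have rSuc: "r (Suc m) \<ge> r m" for m by (simp add: r_def)
  have rm: "r m \<ge> m" for m unfolding r_def by (induction m) auto
  define d where "d m x = f (r (Suc m)) x - f (r m) x" for m x
  have [measurable]: "d m \<in> borel_measurable M" for m unfolding d_def by measurable
  have dsq: "L2sq M (d m) \<le> (1/4)^m" for m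
    unfolding d_def using N[of m "r (Suc m)" "r m"] rN[of m] rSuc[of m] by simp
  have di: "integrable M (\<lambda>x. (cmod (d m x))\<^sup>2)" for m unfolding d_def by (rule dint)
  let ?\<mu> = "measure M (space M)"
  have dle: "cmod (d m x) \<le> ((1/2)^m + 2^m * (cmod (d m x))\<^sup>2) / 2" for m x
  proof -
    have "0 \<le> (2^m) * ((1/2)^m - cmod (d m x))\<^sup>2" by simp
    also have "\<dots> = (1/2)^m - 2 * cmod (d m x) + 2^m * (cmod (d m x))\<^sup>2"
      by (simp add: power2_diff algebra_simps power_divide power2_eq_square)
    finally show ?thesis by simp
  qed
  have dint1: "(LINT x|M. cmod (d m x)) \<le> (1/2)^m * ((?\<mu> + 1) / 2)" and dii: "integrable M (\<lambda>x. cmod (d m x))" for m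
  proof -
    have i: "integrable M (\<lambda>x. ((1/2)^m + 2^m * (cmod (d m x))\<^sup>2) / 2)" using di by auto
    then show ii: "integrable M (\<lambda>x. cmod (d m x))"
      using dle order_trans[OF dle abs_ge_self]
      by (intro Bochner_Integration.integrable_bound[OF i]) auto
    have "(LINT x|M. cmod (d m x)) \<le> (LINT x|M. ((1/2)^m + 2^m * (cmod (d m x))\<^sup>2) / 2)"
      by (rule integral_mono[OF ii i]) (rule dle)
    also have "\<dots> = ((1/2)^m * ?\<mu> + 2^m * L2sq M (d m)) / 2"
      using di by (simp add: field_simps)
    also have "\<dots> \<le> ((1/2)^m * ?\<mu> + 2^m * (1/4)^m) / 2"
      using dsq[of m] by simp
    also have "\<dots> = (1/2)^m * ((?\<mu> + 1) / 2)"
      by (simp add: field_simps power_mult_distrib[symmetric] flip: power_divide)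
    finally show "(LINT x|M. cmod (d m x)) \<le> (1/2)^m * ((?\<mu> + 1) / 2)" .
  qed
  have "(\<integral>\<^sup>+x. (\<Sum>m. ennreal (cmod (d m x))) \<partial>M) = (\<Sum>m. \<integral>\<^sup>+x. ennreal (cmod (d m x)) \<partial>M)"
    by (rule nn_integral_suminf) measurable
  also have "\<dots> = (\<Sum>m. ennreal (LINT x|M. cmod (d m x)))"
    by (intro suminf_cong nn_integral_eq_integral dii) auto
  also have "\<dots> \<le> (\<Sum>m. ennreal ((1/2)^m * ((?\<mu> + 1) / 2)))"
    by (intro suminf_le ennreal_leI dint1) auto
  also have "\<dots> < \<infinity>"
    by (subst suminf_ennreal2) (auto intro!: summable_mult2)
  finally have "(\<integral>\<^sup>+x. (\<Sum>m. ennreal (cmod (d m x))) \<partial>M) \<noteq> \<infinity>" by simp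
  then have "AE x in M. (\<Sum>m. ennreal (cmod (d m x))) \<noteq> \<infinity>"
    by (intro nn_integral_PInf_AE) measurable
  then have conv: "AE x in M. convergent (\<lambda>m. f (r m) x)"
  proof eventually_elim
    case (elim x)
    then have "summable (\<lambda>m. cmod (d m x))"
      by (intro summable_suminf_not_top) auto
    then have "summable (\<lambda>m. d m x)" by (rule summable_norm_cancel)
    then have "convergent (\<lambda>n. (\<Sum>m<n. d m x) + f (r 0) x)"
      by (intro convergent_add convergent_const) (simp add: summable_iff_convergent)
    also have "(\<lambda>n. (\<Sum>m<n. d m x) + f (r 0) x) = (\<lambda>n. f (r n) x)"
      unfolding d_def by (subst sum_lessThan_telescope) simp
    finally show ?case .
  qed
  define g where "g x = lim (\<lambda>m. f (r m) x)" for x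
  have [measurable]: "g \<in> borel_measurable M" unfolding g_def by measurable
  have lim: "AE x in M. (\<lambda>m. f (r m) x) \<longlonglongrightarrow> g x"
    using conv by eventually_elim (simp add: g_def convergent_LIMSEQ_iff)
  have fatou: "(\<integral>\<^sup>+x. ennreal ((cmod (f k x - g x))\<^sup>2) \<partial>M) \<le> ennreal e"
    if K: "\<And>l. l \<ge> K \<Longrightarrow> L2sq M (\<lambda>x. f k x - f l x) \<le> e" and "e \<ge> 0" for k K e
  proof -
    have "(\<integral>\<^sup>+x. ennreal ((cmod (f k x - g x))\<^sup>2) \<partial>M)
        = (\<integral>\<^sup>+x. liminf (\<lambda>m. ennreal ((cmod (f k x - f (r m) x))\<^sup>2)) \<partial>M)"
    proof (rule nn_integral_cong_AE)
      show "AE x in M. ennreal ((cmod (f k x - g x))\<^sup>2) = liminf (\<lambda>m. ennreal ((cmod (f k x - f (r m) x))\<^sup>2))"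
        using lim
      proof eventually_elim
        case (elim x)
        then have "(\<lambda>m. ennreal ((cmod (f k x - f (r m) x))\<^sup>2)) \<longlonglongrightarrow> ennreal ((cmod (f k x - g x))\<^sup>2)"
          by (intro tendsto_ennrealI tendsto_intros)
        then show ?case by (intro lim_imp_Liminf[symmetric]) auto
      qed
    qed
    also have "\<dots> \<le> liminf (\<lambda>m. \<integral>\<^sup>+x. ennreal ((cmod (f k x - f (r m) x))\<^sup>2) \<partial>M)"
      by (rule nn_integral_liminf) measurable
    also have "\<dots> \<le> ennreal e"
    proof (rule Liminf_le)
      show "\<forall>\<^sub>F m in sequentially. (\<integral>\<^sup>+x. ennreal ((cmod (f k x - f (r m) x))\<^sup>2) \<partial>M) \<le> ennreal e"
        unfolding eventually_sequentially
      proof (intro exI[of _ K] allI impI)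
        fix m assume "m \<ge> K"
        then have "r m \<ge> K" using rm[of m] by linarith
        then show "(\<integral>\<^sup>+x. ennreal ((cmod (f k x - f (r m) x))\<^sup>2) \<partial>M) \<le> ennreal e"
          by (subst nn_integral_eq_integral[OF dint]) (auto intro!: ennreal_leI K)
      qed
    qed simp
    finally show ?thesis .
  qed
  \<comment> \<open>The index \<open>N 0\<close> gives the crude bound (1/4)^0 = 1, which serves to
    show that \<open>g\<close>, as the difference of \<open>f (N 0)\<close> and
    \<open>f (N 0) - g\<close>, is square integrable.\<close>
  have fg: "integrable M (\<lambda>x. (cmod (f k x - g x))\<^sup>2)" if "k \<ge> N 0" for k
  proof (rule integrableI_bounded)
    have "(\<integral>\<^sup>+x. ennreal ((cmod (f k x - g x))\<^sup>2) \<partial>M) \<le> ennreal 1"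
      by (rule fatou[of "N 0"]) (use N[of 0 k] that in \<open>auto intro: less_imp_le\<close>)
    then show "(\<integral>\<^sup>+x. ennreal (norm ((cmod (f k x - g x))\<^sup>2)) \<partial>M) < \<infinity>"
      by (auto simp: less_top[symmetric] top_unique intro: le_less_trans)
  qed measurable
  have "square_integrable M (\<lambda>x. f (N 0) x - g x)"
    using fg by (auto simp: square_integrable_def)
  from square_integrable_diff[OF f[of "N 0"] this] have g: "square_integrable M g" by simp
  moreover have "(\<lambda>k. L2sq M (\<lambda>x. f k x - g x)) \<longlonglongrightarrow> 0"
  proof (rule LIMSEQ_I)
    fix e :: real assume "e > 0"
    then obtain K where K: "\<And>k l. k \<ge> K \<Longrightarrow> l \<ge> K \<Longrightarrow> L2sq M (\<lambda>x. f k x - f l x) < e / 2"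
      using cauchy[of "e/2"] by auto
    have "norm (L2sq M (\<lambda>x. f k x - g x) - 0) < e" if "k \<ge> K" for k
    proof -
      have i: "integrable M (\<lambda>x. (cmod (f k x - g x))\<^sup>2)"
        using square_integrable_diff[OF f[of k] g] by (simp add: square_integrable_def)
      have "(\<integral>\<^sup>+x. ennreal ((cmod (f k x - g x))\<^sup>2) \<partial>M) \<le> ennreal (e / 2)"
        by (rule fatou[of K]) (use K that \<open>e > 0\<close> in \<open>auto intro: less_imp_le\<close>)
      then have "L2sq M (\<lambda>x. f k x - g x) \<le> e / 2"
        using i \<open>e > 0\<close> by (simp add: nn_integral_eq_integral)
      then show ?thesis using \<open>e > 0\<close> by simp
    qed
    then show "\<exists>no. \<forall>n\<ge>no. norm (L2sq M (\<lambda>x. f n x - g x) - 0) < e" by blast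
  qed
  ultimately show ?thesis using that by blast
qed

section \<open>Weak derivatives\<close>

lemma lborel_integral_translation:
  fixes f :: "'a::euclidean_space \<Rightarrow> 'b::{banach, second_countable_topology}"
  assumes "f \<in> borel_measurable borel"
  shows "(LINT x|lborel. f (c + x)) = (LINT x|lborel. f x)"
    and "integrable lborel (\<lambda>x. f (c + x)) \<longleftrightarrow> integrable lborel f"
proof -
  have "(LINT x|lborel. f x) = (LINT x|distr lborel borel ((+) c). f x)"
    by (simp add: lborel_distr_plus)
  also have "\<dots> = (LINT x|lborel. f (c + x))"
    using assms by (intro integral_distr) auto
  finally show "(LINT x|lborel. f (c + x)) = (LINT x|lborel. f x)" by simp
  show "integrable lborel (\<lambda>x. f (c + x)) \<longleftrightarrow> integrable lborel f"
    using assms integrable_distr_eq[of "(+) c" lborel borel f] by (simp add: lborel_distr_plus)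
qed

lemma integrable_lborel_compact_support:
  fixes f :: "'a::euclidean_space \<Rightarrow> 'b::{banach, second_countable_topology}"
  assumes "compact K" "continuous_on UNIV f" "\<And>x. x \<notin> K \<Longrightarrow> f x = 0"
  shows "integrable lborel f"
proof -
  have "integrable lborel (\<lambda>x. indicator K x *\<^sub>R f x)"
    using assms by (intro borel_integrable_compact) (auto intro: continuous_on_subset)
  also have "(\<lambda>x. indicator K x *\<^sub>R f x) = f"
    using assms(3) by (auto simp: indicator_def)
  finally show ?thesis .
qed

lemma bounded_compact_support:
  fixes f :: "'a::topological_space \<Rightarrow> 'b::real_normed_vector"
  assumes "compact K" "continuous_on UNIV f" "\<And>x. x \<notin> K \<Longrightarrow> f x = 0"
  obtains B where "B > 0" "\<And>x. norm (f x) \<le> B"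
proof -
  have "bounded (f ` K)"
    using assms by (intro compact_imp_bounded compact_continuous_image) (auto intro: continuous_on_subset)
  then obtain B where B: "B > 0" "\<And>x. x \<in> K \<Longrightarrow> norm (f x) \<le> B"
    by (auto simp: bounded_pos)
  have "norm (f x) \<le> B" for x using B assms(3)[of x] by (cases "x \<in> K") auto
  with B(1) show ?thesis using that by blast
qed

lemma frechet_derivative_zero_outside:
  fixes f :: "'a::euclidean_space \<Rightarrow> 'b::real_normed_vector"
  assumes "closed K" "\<And>x. x \<notin> K \<Longrightarrow> f x = 0" "x \<notin> K"
  shows "frechet_derivative f (at x) b = 0"
proof -
  have "(f has_derivative (\<lambda>_. 0)) (at x)"
    by (rule has_derivative_transform_within_open[OF has_derivative_const, of "- K" x 0])
       (use assms in auto)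
  from frechet_derivative_at[OF this] show ?thesis by metis
qed

text \<open>By translation invariance the difference quotients have integral zero.\<close>

lemma integral_partial_compact_support:
  fixes f :: "'a::euclidean_space \<Rightarrow> 'b::euclidean_space"
  assumes f: "smooth_on UNIV f" and K: "compact K" "\<And>x. x \<notin> K \<Longrightarrow> f x = 0" and b: "b \<in> Basis"
  shows "(LINT x|lborel. frechet_derivative f (at x) b) = 0"
proof -
  let ?D = "\<lambda>x. frechet_derivative f (at x)"
  have fc: "continuous_on UNIV f" using f by (rule smooth_on_imp_continuous_on)
  have Dc: "continuous_on UNIV (\<lambda>x. ?D x b)"
    using f b by (intro smooth_on_imp_continuous_on smooth_on_frechet_derivative)
  have D0: "?D x b = 0" if "x \<notin> K" for x
    using K that by (intro frechet_derivative_zero_outside[of K]) (auto intro: compact_imp_closed)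
  obtain M where M: "M > 0" "\<And>x. norm (?D x b) \<le> M"
    using bounded_compact_support[OF K(1) Dc D0] by blast
  have [measurable]: "f \<in> borel_measurable borel" "(\<lambda>x. ?D x b) \<in> borel_measurable borel"
    using fc Dc by (auto intro: borel_measurable_continuous_onI)
  have line: "((\<lambda>t. f (x + t *\<^sub>R b)) has_derivative (\<lambda>h. h *\<^sub>R ?D (x + t *\<^sub>R b) b)) (at t)" for x t
  proof -
    have fd: "(f has_derivative ?D (x + t *\<^sub>R b)) (at (x + t *\<^sub>R b))"
      by (rule smooth_on_has_derivative[OF open_UNIV f UNIV_I])
    have "((\<lambda>t. x + t *\<^sub>R b) has_derivative (\<lambda>h. h *\<^sub>R b)) (at t)"
      by (auto intro!: derivative_eq_intros)
    from has_derivative_compose[OF this fd] show ?thesis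
      by (simp add: linear_simps(5)[OF has_derivative_bounded_linear[OF fd]])
  qed
  define q where "q k x = real (Suc k) *\<^sub>R (f (x + (1 / real (Suc k)) *\<^sub>R b) - f x)" for k x
  obtain R where R: "R > 0" "\<And>x. x \<in> K \<Longrightarrow> norm x \<le> R"
    using compact_imp_bounded[OF K(1)] by (auto simp: bounded_pos)
  \<comment> \<open>The mean value inequality gives the bound \<open>M\<close>. The points x and x +
    b/(k+1) are at distance at most 1, so both miss \<open>K\<close> as soon as x is outside the
    ball of radius \<open>R + 1\<close>.\<close>
  have bnd: "norm (q k x) \<le> M * indicator (cball 0 (R + 1)) x" for k x
  proof (cases "norm x \<le> R + 1")
    case True
    have "norm (f (x + (1 / real (Suc k)) *\<^sub>R b) - f (x + 0 *\<^sub>R b)) \<le> M * norm (1 / real (Suc k) - 0)"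
    proof (rule differentiable_bound[of UNIV "\<lambda>t. f (x + t *\<^sub>R b)" "\<lambda>t h. h *\<^sub>R ?D (x + t *\<^sub>R b) b"])
      show "onorm (\<lambda>h. h *\<^sub>R ?D (x + t *\<^sub>R b) b) \<le> M" for t
        using mult_right_mono[OF M(2) abs_ge_zero] by (intro onorm_le) (simp add: mult.commute)
    qed (use line in auto)
    then have "real (Suc k) * norm (f (x + (1 / real (Suc k)) *\<^sub>R b) - f x) \<le> real (Suc k) * (M * (1 / real (Suc k)))"
      by (intro mult_left_mono) auto
    then show ?thesis using True by (simp add: q_def)
  next
    case False
    have "norm ((1 / real (Suc k)) *\<^sub>R b) \<le> 1" using b by simp
    then have "norm (x + (1 / real (Suc k)) *\<^sub>R b) > R"
      using False norm_triangle_ineq4[of "x + (1 / real (Suc k)) *\<^sub>R b" "(1 / real (Suc k)) *\<^sub>R b"]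
      unfolding add_diff_cancel_right' by linarith
    then have "f (x + (1 / real (Suc k)) *\<^sub>R b) = 0" "f x = 0"
      using False R K(2) by force+
    then show ?thesis using M(1) by (simp add: q_def)
  qed
  have lim: "(\<lambda>k. q k x) \<longlonglongrightarrow> ?D x b" for x
  proof -
    have "((\<lambda>t. norm (f (x + t *\<^sub>R b) - f x - t *\<^sub>R ?D x b) / norm t) \<longlongrightarrow> 0) (at 0)"
      using line[of x 0] by (simp add: has_derivative_at)
    moreover have "filterlim (\<lambda>k. 1 / real (Suc k)) (at 0) sequentially"
      using LIMSEQ_inverse_real_of_nat by (auto simp: filterlim_at inverse_eq_divide)
    ultimately have "(\<lambda>k. norm (f (x + (1 / real (Suc k)) *\<^sub>R b) - f x - (1 / real (Suc k)) *\<^sub>R ?D x b)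
        / norm (1 / real (Suc k))) \<longlonglongrightarrow> 0"
      by (rule filterlim_compose)
    moreover have "norm (f (x + (1 / real (Suc k)) *\<^sub>R b) - f x - (1 / real (Suc k)) *\<^sub>R ?D x b)
        / norm (1 / real (Suc k)) = norm (q k x - ?D x b)" for k
    proof -
      have "q k x - ?D x b
          = real (Suc k) *\<^sub>R (f (x + (1 / real (Suc k)) *\<^sub>R b) - f x - (1 / real (Suc k)) *\<^sub>R ?D x b)"
        by (simp add: q_def scaleR_diff_right)
      then show ?thesis by (simp del: of_nat_Suc add: mult.commute)
    qed
    ultimately show ?thesis
      by (simp add: Lim_null[of _ "?D x b"] tendsto_norm_zero_iff)
  qed
  have "(\<lambda>k. LINT x|lborel. q k x) \<longlonglongrightarrow> (LINT x|lborel. ?D x b)"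
  proof (rule integral_dominated_convergence)
    show "integrable lborel (\<lambda>x. M * indicator (cball 0 (R + 1)) x :: real)"
      using emeasure_bounded_finite[OF bounded_cball, of 0 "R + 1"]
      by (intro integrable_mult_right integrable_real_indicator) auto
    show "\<And>k. AE x in lborel. norm (q k x) \<le> M * indicator (cball 0 (R + 1)) x" using bnd by simp
  qed (use lim in \<open>auto simp: q_def\<close>)
  moreover have "(LINT x|lborel. q k x) = 0" for k
  proof -
    let ?c = "(1 / real (Suc k)) *\<^sub>R b"
    have i: "integrable lborel f"
      by (rule integrable_lborel_compact_support[OF K(1) fc K(2)])
    then have "integrable lborel (\<lambda>x. f (?c + x))"
      by (subst lborel_integral_translation(2)) measurable
    then have "(LINT x|lborel. f (?c + x) - f x) = 0"
      using i by (simp only: Bochner_Integration.integral_diff lborel_integral_translation(1)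
          \<open>f \<in> borel_measurable borel\<close> diff_self)
    then show ?thesis by (simp only: q_def add.commute[of _ ?c] integral_scaleR_right scaleR_zero_right)
  qed
  ultimately show ?thesis by (simp add: LIMSEQ_const_iff)
qed


text \<open>Cauchy-Schwarz against the constant 1: the integral of (|f| - t)^2 is a nonnegative
  quadratic in t, evaluated at its minimum t = \<open>?I / ?\<mu>\<close>.\<close>

lemma (in finite_measure) norm_integral_power2_le:
  assumes "square_integrable M f"
  shows "(cmod (LINT x|M. f x))\<^sup>2 \<le> measure M (space M) * L2sq M f"
proof -
  let ?\<mu> = "measure M (space M)" and ?I = "LINT x|M. cmod (f x)" and ?Q = "L2sq M f"
  have i: "integrable M (\<lambda>x. cmod (f x))" "integrable M (\<lambda>x. (cmod (f x))\<^sup>2)"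
    using square_integrable_imp_integrable[OF assms] assms by (auto simp: square_integrable_def)
  have q: "0 \<le> ?Q - 2 * t * ?I + t\<^sup>2 * ?\<mu>" for t
  proof -
    have "0 \<le> (LINT x|M. (cmod (f x) - t)\<^sup>2)" by simp
    also have "\<dots> = (LINT x|M. (cmod (f x))\<^sup>2 - 2 * t * cmod (f x) + t\<^sup>2)"
      by (intro Bochner_Integration.integral_cong) (auto simp: power2_diff)
    also have "\<dots> = ?Q - 2 * t * ?I + t\<^sup>2 * ?\<mu>" using i by simp
    finally show ?thesis .
  qed
  have "?I\<^sup>2 \<le> ?\<mu> * ?Q"
  proof (cases "?\<mu> = 0")
    case True
    have "?I = 0"
    proof (rule ccontr)
      assume "?I \<noteq> 0"
      \<comment> \<open>For vanishing total mass the quadratic is affine in t, and at this t it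
        equals -1.\<close>
      then show False using q[of "(?Q + 1) / (2 * ?I)"] True by simp
    qed
    then show ?thesis using True by simp
  next
    case False
    then have \<mu>: "?\<mu> > 0" by (simp add: zero_less_measure_iff)
    then have "0 \<le> ?\<mu> * (?Q - 2 * (?I / ?\<mu>) * ?I + (?I / ?\<mu>)\<^sup>2 * ?\<mu>)"
      by (intro mult_nonneg_nonneg[OF _ q]) simp
    also have "\<dots> = ?\<mu> * ?Q - ?I\<^sup>2" using \<mu> by (simp add: field_simps power2_eq_square)
    finally show ?thesis by simp
  qed
  moreover have "(cmod (LINT x|M. f x))\<^sup>2 \<le> ?I\<^sup>2"
    by (intro power_mono integral_norm_bound) auto
  ultimately show ?thesis by linarith
qed

text \<open>Integration against a bounded function is continuous in L^2 on a finite measure space.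
  This is how the identity defining weak derivatives passes to limits.\<close>

lemma (in finite_measure) integral_mult_bounded_tendsto:
  fixes c :: "'a \<Rightarrow> real"
  assumes f: "\<And>k. square_integrable M (f k)" and g: "square_integrable M g"
    and lim: "(\<lambda>k. L2sq M (\<lambda>x. f k x - g x)) \<longlonglongrightarrow> 0"
    and [measurable]: "c \<in> borel_measurable M" and c: "\<And>x. \<bar>c x\<bar> \<le> B"
  shows "(\<lambda>k. LINT x|M. c x *\<^sub>R f k x) \<longlonglongrightarrow> (LINT x|M. c x *\<^sub>R g x)"
proof -
  let ?d = "\<lambda>k x. c x *\<^sub>R (f k x - g x)"
  have fg: "square_integrable M (\<lambda>x. f k x - g x)" for k using square_integrable_diff[OF f g] .
  have sq: "(cmod (?d k x))\<^sup>2 \<le> B\<^sup>2 * (cmod (f k x - g x))\<^sup>2" for k x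
    using power_mono[OF c[of x], of 2] by (simp add: power_mult_distrib mult_right_mono)
  have i: "integrable M (\<lambda>x. B\<^sup>2 * (cmod (f k x - g x))\<^sup>2)" for k
    using fg by (simp add: square_integrable_def)
  have [measurable]: "(\<lambda>x. f k x - g x) \<in> borel_measurable M" for k
    using fg by (simp add: square_integrable_def)
  have i2: "integrable M (\<lambda>x. (cmod (?d k x))\<^sup>2)" for k
  proof (rule Bochner_Integration.integrable_bound[OF i])
    show "AE x in M. norm ((cmod (?d k x))\<^sup>2) \<le> norm (B\<^sup>2 * (cmod (f k x - g x))\<^sup>2)"
      using sq by (intro AE_I2) simp
  qed measurable
  then have d: "square_integrable M (?d k)" for k
    by (simp add: square_integrable_def)
  have up: "(cmod (LINT x|M. ?d k x))\<^sup>2 \<le> measure M (space M) * (B\<^sup>2 * L2sq M (\<lambda>x. f k x - g x))" for k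
  proof -
    have "L2sq M (?d k) \<le> B\<^sup>2 * L2sq M (\<lambda>x. f k x - g x)"
      using integral_mono[OF i2 i sq] by simp
    then show ?thesis
      by (rule order_trans[OF norm_integral_power2_le[OF d] mult_left_mono[OF _ measure_nonneg]])
  qed
  have up0: "(\<lambda>k. measure M (space M) * (B\<^sup>2 * L2sq M (\<lambda>x. f k x - g x))) \<longlonglongrightarrow> 0"
    using tendsto_mult_left[OF tendsto_mult_left[OF lim]] by simp
  have "(\<lambda>k. (cmod (LINT x|M. ?d k x))\<^sup>2) \<longlonglongrightarrow> 0"
    by (rule tendsto_sandwich[OF _ _ tendsto_const up0]) (intro always_eventually allI up zero_le_power2)+
  then have "(\<lambda>k. sqrt ((cmod (LINT x|M. ?d k x))\<^sup>2)) \<longlonglongrightarrow> sqrt 0" by (rule tendsto_real_sqrt)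
  then have "(\<lambda>k. LINT x|M. ?d k x) \<longlonglongrightarrow> 0" by (simp add: tendsto_norm_zero_iff)
  moreover have "(LINT x|M. ?d k x) = (LINT x|M. c x *\<^sub>R f k x) - (LINT x|M. c x *\<^sub>R g x)" for k
    using square_integrable_mult_bounded[OF f, of c B] square_integrable_mult_bounded[OF g, of c B] c
    by (simp add: scaleR_diff_right)
  ultimately show ?thesis by (simp add: Lim_null[of _ "LINT x|M. c x *\<^sub>R g x"])
qed

section \<open>Integrals against test functions\<close>

lemma lebesgue_on_integral_eq_lborel:
  fixes g :: "'a::euclidean_space \<Rightarrow> 'b::{banach, second_countable_topology}"
  assumes "S \<in> sets lebesgue" "g \<in> borel_measurable borel" "\<And>x. x \<notin> S \<Longrightarrow> g x = 0"
  shows "(LINT x|lebesgue_on S. g x) = (LINT x|lborel. g x)"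
proof -
  have "(LINT x|lebesgue_on S. g x) = (LINT x|lebesgue. indicator S x *\<^sub>R g x)"
    using assms(1) by (intro integral_restrict_space) auto
  also have "(\<lambda>x. indicator S x *\<^sub>R g x) = g" using assms(3) by (auto simp: indicator_def)
  also have "(LINT x|lebesgue. g x) = (LINT x|lborel. g x)"
    using assms(2) by (intro integral_completion) auto
  finally show ?thesis .
qed

lemma test_functionE:
  assumes "\<phi> \<in> test_functions \<Omega>"
  obtains K where "smooth_on UNIV \<phi>" "compact K" "K \<subseteq> \<Omega>" "\<And>x. x \<notin> K \<Longrightarrow> \<phi> x = 0"
    "\<And>x b. x \<notin> K \<Longrightarrow> frechet_derivative \<phi> (at x) b = 0"
proof -
  obtain K where K: "smooth_on UNIV \<phi>" "compact K" "K \<subseteq> \<Omega>" "\<And>x. x \<notin> K \<Longrightarrow> \<phi> x = 0"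
    using assms by (auto simp: test_functions_def)
  moreover have "frechet_derivative \<phi> (at x) b = 0" if "x \<notin> K" for x b
    using K that by (intro frechet_derivative_zero_outside[of K]) (auto intro: compact_imp_closed)
  ultimately show ?thesis using that by blast
qed

lemma test_function_bounded:
  assumes "\<phi> \<in> test_functions \<Omega>" "b \<in> Basis"
  obtains B where "\<And>x. \<bar>\<phi> x\<bar> \<le> B" "\<And>x. \<bar>frechet_derivative \<phi> (at x) b\<bar> \<le> B"
    "\<phi> \<in> borel_measurable borel" "(\<lambda>x. frechet_derivative \<phi> (at x) b) \<in> borel_measurable borel"
proof -
  obtain K where K: "smooth_on UNIV \<phi>" "compact K" "K \<subseteq> \<Omega>" "\<And>x. x \<notin> K \<Longrightarrow> \<phi> x = 0"
    "\<And>x b. x \<notin> K \<Longrightarrow> frechet_derivative \<phi> (at x) b = 0"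
    using assms(1) by (rule test_functionE) blast
  have c: "continuous_on UNIV \<phi>" "continuous_on UNIV (\<lambda>x. frechet_derivative \<phi> (at x) b)"
    using K(1) assms(2) by (auto intro: smooth_on_imp_continuous_on smooth_on_frechet_derivative)
  obtain B1 where B1: "\<And>x. norm (\<phi> x) \<le> B1"
    using bounded_compact_support[OF K(2) c(1) K(4)] by blast
  obtain B2 where B2: "\<And>x. norm (frechet_derivative \<phi> (at x) b) \<le> B2"
    using bounded_compact_support[OF K(2) c(2) K(5)] by blast
  show ?thesis
    using that[of "max B1 B2"] B1 B2 c
    by (auto simp: le_max_iff_disj borel_measurable_continuous_onI)
qed

section \<open>Weak partial derivatives on a bounded open set\<close>

locale bounded_open =
  fixes \<Omega> :: "complex set"
  assumes open_\<Omega>: "open \<Omega>" and bounded_\<Omega>: "bounded \<Omega>"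
begin

lemma lmeasurable_\<Omega>: "\<Omega> \<in> lmeasurable" and sets_\<Omega>: "\<Omega> \<in> sets lebesgue"
  using open_\<Omega> bounded_\<Omega> by (auto intro: lmeasurable_open)

abbreviation \<mu> :: "complex measure" where
  "\<mu> \<equiv> lebesgue_on \<Omega>"

sublocale M: finite_measure "\<mu>"
  by (rule finite_measure_lebesgue_on[OF lmeasurable_\<Omega>])

lemma borel_measurable_lebesgue_on: "f \<in> borel_measurable borel \<Longrightarrow> f \<in> borel_measurable \<mu>"
  by (simp add: measurable_completion measurable_restrict_space1)

lemma square_integrable_continuous:
  assumes "continuous_on UNIV f"
  shows "square_integrable \<mu> f"
proof -
  have "compact (closure \<Omega>)" using bounded_\<Omega> by (simp add: compact_eq_bounded_closed bounded_closure)
  then have "bounded (f ` closure \<Omega>)"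
    using assms by (intro compact_imp_bounded compact_continuous_image) (auto intro: continuous_on_subset)
  then obtain B where "\<And>x. x \<in> closure \<Omega> \<Longrightarrow> cmod (f x) \<le> B"
    by (auto simp: bounded_iff)
  then have "AE x in \<mu>. cmod (f x) \<le> B"
    using closure_subset[of \<Omega>] by (intro AE_I2) auto
  then show ?thesis
    using assms by (intro M.square_integrable_bounded borel_measurable_lebesgue_on borel_measurable_continuous_onI)
qed

text \<open>The product of \<open>\<phi>\<close> and \<open>u\<close> is smooth with compact support
  in the domain, so its partial derivative has integral zero over the plane; the product rule splits
  this into the two sides.\<close>

lemma has_weak_partial_smooth:
  assumes u: "smooth_on UNIV u" and b: "b \<in> Basis"
  shows "has_weak_partial \<Omega> b u (\<lambda>x. frechet_derivative u (at x) b)"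
  unfolding has_weak_partial_def
proof
  fix \<phi> assume "\<phi> \<in> test_functions \<Omega>"
  then obtain K where K: "smooth_on UNIV \<phi>" "compact K" "K \<subseteq> \<Omega>" "\<And>x. x \<notin> K \<Longrightarrow> \<phi> x = 0"
    "\<And>x b. x \<notin> K \<Longrightarrow> frechet_derivative \<phi> (at x) b = 0"
    by (rule test_functionE) blast
  let ?D\<phi> = "\<lambda>x. frechet_derivative \<phi> (at x)" and ?Du = "\<lambda>x. frechet_derivative u (at x)"
  have D: "frechet_derivative (\<lambda>x. \<phi> x *\<^sub>R u x) (at x) = (\<lambda>h. \<phi> x *\<^sub>R ?Du x h + ?D\<phi> x h *\<^sub>R u x)" for x
    by (rule frechet_derivative_at[symmetric], intro has_derivative_scaleR smooth_on_has_derivative[OF open_UNIV] K u) auto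
  have c: "continuous_on UNIV (\<lambda>x. \<phi> x *\<^sub>R ?Du x b)" "continuous_on UNIV (\<lambda>x. ?D\<phi> x b *\<^sub>R u x)"
    by (intro continuous_on_scaleR smooth_on_imp_continuous_on smooth_on_frechet_derivative u b K(1))+
  have i: "integrable lborel (\<lambda>x. \<phi> x *\<^sub>R ?Du x b)" "integrable lborel (\<lambda>x. ?D\<phi> x b *\<^sub>R u x)"
    by (rule integrable_lborel_compact_support[OF K(2)]; use c K(4,5) in force)+
  have "0 = (LINT x|lborel. frechet_derivative (\<lambda>x. \<phi> x *\<^sub>R u x) (at x) b)"
    using K(1,4) u by (intro integral_partial_compact_support[symmetric, OF _ K(2) _ b] smooth_on_scaleR) auto
  also have "\<dots> = (LINT x|lborel. \<phi> x *\<^sub>R ?Du x b) + (LINT x|lborel. ?D\<phi> x b *\<^sub>R u x)"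
    unfolding D using i by simp
  also have "(LINT x|lborel. \<phi> x *\<^sub>R ?Du x b) = (LINT x|\<mu>. \<phi> x *\<^sub>R ?Du x b)"
    using K(3,4) sets_\<Omega> c by (intro lebesgue_on_integral_eq_lborel[symmetric] borel_measurable_continuous_onI) auto
  also have "(LINT x|lborel. ?D\<phi> x b *\<^sub>R u x) = (LINT x|\<mu>. ?D\<phi> x b *\<^sub>R u x)"
    using K(3,5) sets_\<Omega> c by (intro lebesgue_on_integral_eq_lborel[symmetric] borel_measurable_continuous_onI) auto
  finally show "(LINT x|\<mu>. ?D\<phi> x b *\<^sub>R u x) = - (LINT x|\<mu>. \<phi> x *\<^sub>R ?Du x b)"
    by (simp add: eq_neg_iff_add_eq_0 add.commute)
qed

lemma has_weak_partial_linear: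
  assumes "has_weak_partial \<Omega> b u v" "has_weak_partial \<Omega> b u' v'" "b \<in> Basis"
    and "square_integrable \<mu> u" "square_integrable \<mu> v"
    and "square_integrable \<mu> u'" "square_integrable \<mu> v'"
  shows "has_weak_partial \<Omega> b (\<lambda>x. s *\<^sub>R u x + t *\<^sub>R u' x) (\<lambda>x. s *\<^sub>R v x + t *\<^sub>R v' x)"
  unfolding has_weak_partial_def
proof
  fix \<phi> assume \<phi>: "\<phi> \<in> test_functions \<Omega>"
  obtain B where B: "\<And>x. \<bar>\<phi> x\<bar> \<le> B" "\<And>x. \<bar>frechet_derivative \<phi> (at x) b\<bar> \<le> B"
    "\<phi> \<in> borel_measurable borel" "(\<lambda>x. frechet_derivative \<phi> (at x) b) \<in> borel_measurable borel"
    using test_function_bounded[OF \<phi> assms(3)] by blast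
  note i = M.square_integrable_mult_bounded[OF _ borel_measurable_lebesgue_on[OF B(3)] B(1)]
    M.square_integrable_mult_bounded[OF _ borel_measurable_lebesgue_on[OF B(4)] B(2)]
  have eq: "(LINT x|\<mu>. c x *\<^sub>R (s *\<^sub>R f x + t *\<^sub>R g x))
     = s *\<^sub>R (LINT x|\<mu>. c x *\<^sub>R f x) + t *\<^sub>R (LINT x|\<mu>. c x *\<^sub>R g x)"
    if "integrable \<mu> (\<lambda>x. c x *\<^sub>R f x)" "integrable \<mu> (\<lambda>x. c x *\<^sub>R g x)"
    for f g :: "complex \<Rightarrow> complex" and c :: "complex \<Rightarrow> real"
  proof -
    have "(LINT x|\<mu>. c x *\<^sub>R (s *\<^sub>R f x + t *\<^sub>R g x))
        = (LINT x|\<mu>. s *\<^sub>R (c x *\<^sub>R f x) + t *\<^sub>R (c x *\<^sub>R g x))"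
      by (simp add: scaleR_add_right mult.commute)
    also have "\<dots> = (LINT x|\<mu>. s *\<^sub>R (c x *\<^sub>R f x)) + (LINT x|\<mu>. t *\<^sub>R (c x *\<^sub>R g x))"
      using that by (intro Bochner_Integration.integral_add integrable_scaleR_right)
    finally show ?thesis by (simp del: scaleR_scaleR)
  qed
  have "(LINT x|\<mu>. frechet_derivative \<phi> (at x) b *\<^sub>R u x) = - (LINT x|\<mu>. \<phi> x *\<^sub>R v x)"
    "(LINT x|\<mu>. frechet_derivative \<phi> (at x) b *\<^sub>R u' x) = - (LINT x|\<mu>. \<phi> x *\<^sub>R v' x)"
    using assms(1,2) \<phi> by (auto simp: has_weak_partial_def)
  then show "(LINT x|\<mu>. frechet_derivative \<phi> (at x) b *\<^sub>R (s *\<^sub>R u x + t *\<^sub>R u' x))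
    = - (LINT x|\<mu>. \<phi> x *\<^sub>R (s *\<^sub>R v x + t *\<^sub>R v' x))"
    using assms by (simp add: eq i)
qed

lemma has_weak_partial_limit:
  assumes w: "\<And>k. has_weak_partial \<Omega> b (u k) (v k)" and b: "b \<in> Basis"
    and "\<And>k. square_integrable \<mu> (u k)" "square_integrable \<mu> u'"
    and "\<And>k. square_integrable \<mu> (v k)" "square_integrable \<mu> v'"
    and "(\<lambda>k. L2sq \<mu> (\<lambda>x. u k x - u' x)) \<longlonglongrightarrow> 0"
    and "(\<lambda>k. L2sq \<mu> (\<lambda>x. v k x - v' x)) \<longlonglongrightarrow> 0"
  shows "has_weak_partial \<Omega> b u' v'"
  unfolding has_weak_partial_def
proof
  fix \<phi> assume \<phi>: "\<phi> \<in> test_functions \<Omega>"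
  obtain B where B: "\<And>x. \<bar>\<phi> x\<bar> \<le> B" "\<And>x. \<bar>frechet_derivative \<phi> (at x) b\<bar> \<le> B"
    "\<phi> \<in> borel_measurable borel" "(\<lambda>x. frechet_derivative \<phi> (at x) b) \<in> borel_measurable borel"
    using test_function_bounded[OF \<phi> b] by blast
  have "(\<lambda>k. LINT x|\<mu>. frechet_derivative \<phi> (at x) b *\<^sub>R u k x)
      \<longlonglongrightarrow> (LINT x|\<mu>. frechet_derivative \<phi> (at x) b *\<^sub>R u' x)"
    using assms B by (intro M.integral_mult_bounded_tendsto[of _ _ _ B] borel_measurable_lebesgue_on)
  moreover have "(\<lambda>k. - (LINT x|\<mu>. \<phi> x *\<^sub>R v k x)) \<longlonglongrightarrow> - (LINT x|\<mu>. \<phi> x *\<^sub>R v' x)"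
    using assms B by (intro tendsto_minus M.integral_mult_bounded_tendsto[of _ _ _ B] borel_measurable_lebesgue_on)
  moreover have "(LINT x|\<mu>. frechet_derivative \<phi> (at x) b *\<^sub>R u k x)
      = - (LINT x|\<mu>. \<phi> x *\<^sub>R v k x)" for k
    using w \<phi> by (simp add: has_weak_partial_def)
  ultimately show "(LINT x|\<mu>. frechet_derivative \<phi> (at x) b *\<^sub>R u' x)
      = - (LINT x|\<mu>. \<phi> x *\<^sub>R v' x)"
    using LIMSEQ_unique by simp
qed

text \<open>\<open>flat 0 (k * s)\<close> tends to 1 for s > 0 and vanishes for s \<le> 0. Products
  of such factors, one for each side of the box, are therefore test functions that converge
  pointwise to its indicator, and \<open>w\<close> dominates.\<close>

lemma integral_box_eq_0:
  assumes w: "integrable \<mu> w"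
    and test: "\<And>\<phi>. \<phi> \<in> test_functions \<Omega> \<Longrightarrow> (LINT x|\<mu>. \<phi> x *\<^sub>R w x) = (0 :: complex)"
    and cd: "cbox c d \<subseteq> \<Omega>"
  shows "(LINT x|\<mu>. indicator (box c d) x *\<^sub>R w x) = 0"
proof -
  define \<phi> where "\<phi> k x = (\<Prod>b\<in>Basis. flat 0 (real k * (x \<bullet> b - c \<bullet> b)) * flat 0 (real k * (d \<bullet> b - x \<bullet> b)))"
    for k and x :: complex
  have fac: "smooth_on UNIV (\<lambda>x::complex. flat 0 (real k * (x \<bullet> b - c \<bullet> b)) * flat 0 (real k * (d \<bullet> b - x \<bullet> b)))" for k b
    by (intro smooth_on_mult smooth_on_compose_real[OF _ open_UNIV _ smooth_on_flat] smooth_on_diff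
        smooth_on_const smooth_on_bounded_linear bounded_linear_inner_left) auto
  have sm: "smooth_on UNIV (\<phi> k)" for k
  proof -
    have "smooth_on UNIV (\<lambda>x::complex. \<Prod>b\<in>I. flat 0 (real k * (x \<bullet> b - c \<bullet> b)) * flat 0 (real k * (d \<bullet> b - x \<bullet> b)))"
      if "finite I" for I
      using that by induction (auto intro!: smooth_on_const smooth_on_mult[OF open_UNIV fac])
    then show ?thesis unfolding \<phi>_def by simp
  qed
  have zero: "\<phi> k x = 0" if "x \<notin> box c d" for k x
  proof -
    from that obtain b where "b \<in> Basis" "x \<bullet> b \<le> c \<bullet> b \<or> d \<bullet> b \<le> x \<bullet> b"
      by (auto simp: mem_box not_less)
    then have "flat 0 (real k * (x \<bullet> b - c \<bullet> b)) = 0 \<or> flat 0 (real k * (d \<bullet> b - x \<bullet> b)) = 0"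
      by (auto simp: flat_def mult_nonneg_nonpos zero_less_mult_iff)
    with \<open>b \<in> Basis\<close> show ?thesis unfolding \<phi>_def by (intro prod_zero) auto
  qed
  have t: "\<phi> k \<in> test_functions \<Omega>" for k
    unfolding test_functions_def using sm zero cd box_subset_cbox[of c d] compact_cbox[of c d] by blast
  have bnd: "\<bar>\<phi> k x\<bar> \<le> 1" for k x
    unfolding \<phi>_def abs_prod
    by (rule prod_le_1) (auto simp: abs_mult flat_nonneg flat_le_1 intro!: mult_le_one)
  have flim: "(\<lambda>k. flat 0 (real k * s)) \<longlonglongrightarrow> 1" if "s > 0" for s
  proof -
    have "(\<lambda>k. exp (- inverse (real k * s))) \<longlonglongrightarrow> exp (- 0)"
    proof (intro tendsto_intros)
      have "(\<lambda>k. inverse (real k) * inverse s) \<longlonglongrightarrow> 0 * inverse s"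
        by (intro tendsto_intros lim_inverse_n)
      then show "(\<lambda>k. inverse (real k * s)) \<longlonglongrightarrow> 0" by simp
    qed
    then have "(\<lambda>k. exp (- inverse (real k * s))) \<longlonglongrightarrow> 1" by simp
    then show ?thesis
      by (rule Lim_transform_eventually)
         (use that in \<open>auto simp: flat_def mult_le_0_iff intro!: eventually_sequentiallyI[of 1]\<close>)
  qed
  have lim: "(\<lambda>k. \<phi> k x) \<longlonglongrightarrow> indicator (box c d) x" for x
  proof (cases "x \<in> box c d")
    case True
    have "(\<lambda>k. \<phi> k x) \<longlonglongrightarrow> (\<Prod>b\<in>(Basis::complex set). 1 * 1)"
      unfolding \<phi>_def using True by (intro tendsto_intros flim) (auto simp: mem_box)
    then show ?thesis using True by simp
  qed (simp add: zero)
  have "(\<lambda>k. LINT x|\<mu>. \<phi> k x *\<^sub>R w x) \<longlonglongrightarrow> (LINT x|\<mu>. indicator (box c d) x *\<^sub>R w x)"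
  proof (rule integral_dominated_convergence)
    show "integrable \<mu> (\<lambda>x. cmod (w x))" using w by simp
    have [measurable]: "w \<in> borel_measurable \<mu>" using w by simp
    have [measurable]: "\<phi> k \<in> borel_measurable \<mu>" for k
      using sm by (intro borel_measurable_lebesgue_on borel_measurable_continuous_onI smooth_on_imp_continuous_on)
    show "(\<lambda>x. \<phi> k x *\<^sub>R w x) \<in> borel_measurable \<mu>" for k by measurable
    have [measurable]: "(indicator (box c d) :: complex \<Rightarrow> real) \<in> borel_measurable \<mu>"
      by (rule borel_measurable_lebesgue_on) simp
    show "(\<lambda>x. (indicator (box c d) x :: real) *\<^sub>R w x) \<in> borel_measurable \<mu>" by measurable
    show "AE x in \<mu>. (\<lambda>k. \<phi> k x *\<^sub>R w x) \<longlonglongrightarrow> indicator (box c d) x *\<^sub>R w x"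
      using lim by (intro AE_I2 tendsto_intros)
    show "AE x in \<mu>. norm (\<phi> k x *\<^sub>R w x) \<le> cmod (w x)" for k
      using bnd by (intro AE_I2) (simp add: mult_left_le_one_le)
  qed
  then show ?thesis using test[OF t] by (simp add: LIMSEQ_const_iff)
qed

text \<open>The fundamental lemma of the calculus of variations. At almost every point
  \<open>w\<close> is the limit of its averages over shrinking squares with lower left corner there
  (Lebesgue differentiation), and small squares lie in the domain, where
  \<open>integral_box_eq_0\<close> makes the averages vanish.\<close>

lemma AE_eq_0_of_test_functions:
  assumes w: "integrable \<mu> w"
    and test: "\<And>\<phi>. \<phi> \<in> test_functions \<Omega> \<Longrightarrow> (LINT x|\<mu>. \<phi> x *\<^sub>R w x) = (0 :: complex)"
  shows "AE x in \<mu>. w x = 0"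
proof -
  let ?f = "\<lambda>x. if x \<in> \<Omega> then w x else 0"
  have eq: "(\<lambda>x. indicator \<Omega> x *\<^sub>R w x) = ?f" by (auto simp: indicator_def)
  have fi: "integrable lebesgue ?f"
    using w integrable_restrict_space[of \<Omega> lebesgue w] sets_\<Omega>
    by (simp add: eq)
  then have "?f integrable_on cbox a b" for a b
    using integrable_on_lebesgue integrable_on_subcbox by blast
  then obtain N where N: "negligible N" "\<And>x e. \<lbrakk>x \<notin> N; 0 < e\<rbrakk> \<Longrightarrow>
      \<exists>d>0. \<forall>h. 0 < h \<and> h < d \<longrightarrow> norm (integral (cbox x (x + h *\<^sub>R One)) ?f /\<^sub>R h ^ DIM(complex) - ?f x) < e"
    using integrable_ccontinuous_explicit[of ?f] by blast
  have box0: "integral (cbox c d) ?f = 0" if "cbox c d \<subseteq> \<Omega>" for c d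
  proof -
    have "integral (cbox c d) ?f = integral (box c d) ?f" by (simp add: integral_open_interval)
    also have "\<dots> = integral UNIV (\<lambda>x. if x \<in> box c d then ?f x else 0)"
      by (simp only: Henstock_Kurzweil_Integration.integral_restrict_UNIV)
    also have "(\<lambda>x. if x \<in> box c d then ?f x else 0) = (\<lambda>x. indicator \<Omega> x *\<^sub>R (indicator (box c d) x *\<^sub>R w x))"
      by (auto simp: indicator_def)
    also have "integral UNIV \<dots> = (LINT x|lebesgue. indicator \<Omega> x *\<^sub>R (indicator (box c d) x *\<^sub>R w x))"
    proof (rule integral_lebesgue)
      have "integrable lebesgue (\<lambda>x. indicator (box c d) x *\<^sub>R ?f x)"
        using fi by (intro integrable_mult_indicator) auto
      also have "(\<lambda>x. indicator (box c d) x *\<^sub>R ?f x) = (\<lambda>x. indicator \<Omega> x *\<^sub>R (indicator (box c d) x *\<^sub>R w x))"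
        by (auto simp: indicator_def)
      finally show "integrable lebesgue (\<lambda>x. indicator \<Omega> x *\<^sub>R (indicator (box c d) x *\<^sub>R w x))" .
    qed
    also have "\<dots> = (LINT x|\<mu>. indicator (box c d) x *\<^sub>R w x)"
      using sets_\<Omega> by (subst integral_restrict_space) auto
    also have "\<dots> = 0" using w test that by (rule integral_box_eq_0)
    finally show ?thesis .
  qed
  have zero: "w x = 0" if x: "x \<in> \<Omega>" "x \<notin> N" for x
  proof (rule ccontr)
    assume "w x \<noteq> 0"
    then obtain d where d: "d > 0" "\<And>h. 0 < h \<Longrightarrow> h < d \<Longrightarrow>
        norm (integral (cbox x (x + h *\<^sub>R One)) ?f /\<^sub>R h ^ DIM(complex) - ?f x) < cmod (w x)"
      using N(2)[of x "cmod (w x)"] x by auto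
    obtain r where r: "r > 0" "ball x r \<subseteq> \<Omega>" using open_\<Omega> x(1) openE by blast
    \<comment> \<open>Small enough for the differentiation estimate, and such that all points of the
      square, which are within 2h of x, stay in the ball of radius r.\<close>
    define h where "h = min (d / 2) (r / 3)"
    have h: "0 < h" "h < d" "2 * h < r" using d(1) r(1) by (auto simp: h_def)
    have "cbox x (x + h *\<^sub>R One) \<subseteq> ball x r"
    proof
      fix y assume y: "y \<in> cbox x (x + h *\<^sub>R One)"
      have "cmod (y - x) \<le> \<bar>Re (y - x)\<bar> + \<bar>Im (y - x)\<bar>" by (rule cmod_le)
      also have "\<dots> \<le> h + h"
        using y by (intro add_mono) (auto simp: in_cbox_complex_iff Basis_complex_def)
      finally show "y \<in> ball x r" using h by (simp add: dist_norm norm_minus_commute)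
    qed
    then show False using d(2)[OF h(1,2)] box0[of x "x + h *\<^sub>R One"] r(2) x(1) by simp
  qed
  have "AE x in lebesgue. x \<notin> N"
    using N(1) by (simp add: AE_not_in negligible_iff_null_sets)
  then show ?thesis
    using zero sets_\<Omega> by (auto simp: AE_restrict_space_iff)
qed

lemma weak_partial_unique:
  assumes "has_weak_partial \<Omega> b u v" "has_weak_partial \<Omega> b u v'"
    and v: "square_integrable \<mu> v" "square_integrable \<mu> v'" and b: "b \<in> Basis"
  shows "AE x in \<mu>. v x = v' x"
proof -
  have "AE x in \<mu>. v x - v' x = 0"
  proof (rule AE_eq_0_of_test_functions)
    show "integrable \<mu> (\<lambda>x. v x - v' x)"
      using v by (intro Bochner_Integration.integrable_diff M.square_integrable_imp_integrable)
    fix \<phi> assume \<phi>: "\<phi> \<in> test_functions \<Omega>"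
    obtain B where B: "\<And>x. \<bar>\<phi> x\<bar> \<le> B" "\<phi> \<in> borel_measurable borel"
      using test_function_bounded[OF \<phi> b] by metis
    note i = M.square_integrable_mult_bounded[OF _ borel_measurable_lebesgue_on[OF B(2)] B(1)]
    show "(LINT x|\<mu>. \<phi> x *\<^sub>R (v x - v' x)) = 0"
      using assms(1,2) \<phi> i[OF v(1)] i[OF v(2)] by (simp add: scaleR_diff_right has_weak_partial_def)
  qed
  then show ?thesis by simp
qed

end

text \<open>Carries the partials as an explicit argument. The chosen \<open>weak_partial\<close>
  respects sums only almost everywhere, whereas explicit gradients can be combined
  pointwise.\<close>

definition has_weak_gradient ::
  "complex set \<Rightarrow> (complex \<Rightarrow> complex) \<Rightarrow> (complex \<Rightarrow> complex \<Rightarrow> complex) \<Rightarrow> bool" where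
  "has_weak_gradient \<Omega> u v \<longleftrightarrow> square_integrable (lebesgue_on \<Omega>) u \<and>
     (\<forall>b\<in>Basis. square_integrable (lebesgue_on \<Omega>) (v b) \<and> has_weak_partial \<Omega> b u (v b))"

lemma H1_iff_weak_gradient: "u \<in> H1 \<Omega> \<longleftrightarrow> (\<exists>v. has_weak_gradient \<Omega> u v)"
  unfolding H1_def has_weak_gradient_def mem_Collect_eq bchoice_iff by blast

lemma weak_gradient_weak_partial:
  assumes "u \<in> H1 \<Omega>"
  shows "has_weak_gradient \<Omega> u (\<lambda>b. weak_partial \<Omega> b u)"
  unfolding has_weak_gradient_def
proof (intro conjI ballI)
  show "square_integrable (lebesgue_on \<Omega>) u" using assms by (simp add: H1_def)
  fix b :: complex assume "b \<in> Basis"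
  then have "\<exists>v. square_integrable (lebesgue_on \<Omega>) v \<and> has_weak_partial \<Omega> b u v"
    using assms by (auto simp: H1_def)
  from someI_ex[OF this] show "square_integrable (lebesgue_on \<Omega>) (weak_partial \<Omega> b u)"
    "has_weak_partial \<Omega> b u (weak_partial \<Omega> b u)"
    unfolding weak_partial_def by blast+
qed

lemma square_integrable_integrable: "square_integrable M f \<Longrightarrow> integrable M (\<lambda>x. (cmod (f x))\<^sup>2)"
  by (simp add: square_integrable_def)

lemma dirichlet_energy_nonneg: "0 \<le> dirichlet_energy \<Omega> u"
  unfolding dirichlet_energy_def by (intro integral_nonneg_AE AE_I2 sum_nonneg) simp

lemma H1_norm_power2: "(H1_norm \<Omega> u)\<^sup>2 = L2sq (lebesgue_on \<Omega>) u + dirichlet_energy \<Omega> u"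
  unfolding H1_norm_def by (simp add: dirichlet_energy_nonneg)

text \<open>Traces are defined with the norm, all estimates are made for its square; this is the
  passage between them.\<close>

lemma H1_norm_tendsto_0_iff:
  "(\<lambda>k. H1_norm \<Omega> (f k)) \<longlonglongrightarrow> 0 \<longleftrightarrow> (\<lambda>k. (H1_norm \<Omega> (f k))\<^sup>2) \<longlonglongrightarrow> 0"
proof
  assume "(\<lambda>k. (H1_norm \<Omega> (f k))\<^sup>2) \<longlonglongrightarrow> 0"
  then have "(\<lambda>k. sqrt ((H1_norm \<Omega> (f k))\<^sup>2)) \<longlonglongrightarrow> sqrt 0" by (rule tendsto_real_sqrt)
  then show "(\<lambda>k. H1_norm \<Omega> (f k)) \<longlonglongrightarrow> 0"
    by (simp add: tendsto_rabs_zero_iff)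
qed (use tendsto_power[of _ 0 _ 2] in fastforce)

section \<open>Linear combinations of weak gradients and the Dirichlet energy\<close>

context bounded_open
begin

lemma weak_gradient_linear:
  assumes "has_weak_gradient \<Omega> u v" "has_weak_gradient \<Omega> u' v'"
  shows "has_weak_gradient \<Omega> (\<lambda>x. s *\<^sub>R u x + t *\<^sub>R u' x) (\<lambda>b x. s *\<^sub>R v b x + t *\<^sub>R v' b x)"
  using assms unfolding has_weak_gradient_def
  by (auto intro!: has_weak_partial_linear square_integrable_add square_integrable_scaleR)

lemma weak_gradient_smooth:
  assumes "smooth_on UNIV u"
  shows "has_weak_gradient \<Omega> u (\<lambda>b x. frechet_derivative u (at x) b)"
  using assms unfolding has_weak_gradient_def
  by (auto intro!: has_weak_partial_smooth square_integrable_continuous smooth_on_imp_continuous_on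
      smooth_on_frechet_derivative)

text \<open>The energy is defined through a choice of weak partials; uniqueness almost everywhere
  lets any weak gradient compute it.\<close>

lemma dirichlet_energy_eq:
  assumes "has_weak_gradient \<Omega> u v"
  shows "dirichlet_energy \<Omega> u = (\<Sum>b\<in>Basis. L2sq \<mu> (v b))"
proof -
  have w: "has_weak_gradient \<Omega> u (\<lambda>b. weak_partial \<Omega> b u)"
    using assms H1_iff_weak_gradient weak_gradient_weak_partial by blast
  have "dirichlet_energy \<Omega> u = (\<Sum>b\<in>Basis. L2sq \<mu> (weak_partial \<Omega> b u))"
    unfolding dirichlet_energy_def
    using w by (intro Bochner_Integration.integral_sum)
      (auto simp: has_weak_gradient_def intro: square_integrable_integrable)
  also have "\<dots> = (\<Sum>b\<in>Basis. L2sq \<mu> (v b))"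
  proof (intro sum.cong refl integral_cong_AE)
    fix b :: complex assume b: "b \<in> Basis"
    have sq: "square_integrable \<mu> (weak_partial \<Omega> b u)" "square_integrable \<mu> (v b)"
      using w assms b by (auto simp: has_weak_gradient_def)
    have "AE x in \<mu>. weak_partial \<Omega> b u x = v b x"
      using w assms b by (intro weak_partial_unique[of b u]) (auto simp: has_weak_gradient_def)
    then show "AE x in \<mu>. (cmod (weak_partial \<Omega> b u x))\<^sup>2 = (cmod (v b x))\<^sup>2"
      by eventually_elim simp
    show "(\<lambda>x. (cmod (weak_partial \<Omega> b u x))\<^sup>2) \<in> borel_measurable \<mu>"
      "(\<lambda>x. (cmod (v b x))\<^sup>2) \<in> borel_measurable \<mu>"
      using sq by (auto simp: square_integrable_def)
  qed
  finally show ?thesis .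
qed

lemma H1_linear:
  assumes "u \<in> H1 \<Omega>" "u' \<in> H1 \<Omega>"
  shows "(\<lambda>x. s *\<^sub>R u x + t *\<^sub>R u' x) \<in> H1 \<Omega>"
  using assms weak_gradient_linear unfolding H1_iff_weak_gradient by blast

lemma H1_diff: "u \<in> H1 \<Omega> \<Longrightarrow> u' \<in> H1 \<Omega> \<Longrightarrow> (\<lambda>x. u x - u' x) \<in> H1 \<Omega>"
  using H1_linear[of u u' 1 "-1"] by simp

lemma smooth_H1: "smooth_on UNIV u \<Longrightarrow> u \<in> H1 \<Omega>"
  unfolding H1_iff_weak_gradient using weak_gradient_smooth by blast

text \<open>Normalized for midpoints: the midpoint lies below the average energy by a quarter of the
  energy of the difference. Two near-minimizers whose midpoint gains little must therefore have
  close gradients.\<close>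

lemma dirichlet_energy_parallelogram:
  assumes "u \<in> H1 \<Omega>" "w \<in> H1 \<Omega>"
  shows "dirichlet_energy \<Omega> (\<lambda>x. (u x + w x) / 2) + dirichlet_energy \<Omega> (\<lambda>x. u x - w x) / 4
    = (dirichlet_energy \<Omega> u + dirichlet_energy \<Omega> w) / 2"
proof -
  obtain p q where p: "has_weak_gradient \<Omega> u p" and q: "has_weak_gradient \<Omega> w q"
    using assms by (auto simp: H1_iff_weak_gradient)
  have m: "has_weak_gradient \<Omega> (\<lambda>x. (u x + w x) / 2) (\<lambda>b x. (1/2) *\<^sub>R p b x + (1/2) *\<^sub>R q b x)"
    using weak_gradient_linear[OF p q, of "1/2" "1/2"]
    by (simp add: scaleR_conv_of_real add_divide_distrib)
  have d: "has_weak_gradient \<Omega> (\<lambda>x. u x - w x) (\<lambda>b x. p b x - q b x)"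
    using weak_gradient_linear[OF p q, of 1 "-1"] by simp
  have "L2sq \<mu> (\<lambda>x. (1/2) *\<^sub>R p b x + (1/2) *\<^sub>R q b x) + L2sq \<mu> (\<lambda>x. p b x - q b x) / 4
     = (L2sq \<mu> (p b) + L2sq \<mu> (q b)) / 2" if b: "b \<in> Basis" for b
  proof -
    have i: "integrable \<mu> (\<lambda>x. (cmod (p b x))\<^sup>2)" "integrable \<mu> (\<lambda>x. (cmod (q b x))\<^sup>2)"
      "integrable \<mu> (\<lambda>x. (cmod ((1/2) *\<^sub>R p b x + (1/2) *\<^sub>R q b x))\<^sup>2)"
      "integrable \<mu> (\<lambda>x. (cmod (p b x - q b x))\<^sup>2)"
      using p q m d b by (auto simp: has_weak_gradient_def intro: square_integrable_integrable)
    have pt: "(cmod ((1/2) *\<^sub>R y + (1/2) *\<^sub>R z))\<^sup>2 + (cmod (y - z))\<^sup>2 / 4 = ((cmod y)\<^sup>2 + (cmod z)\<^sup>2) / 2" for y z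
      unfolding cmod_power2 by (simp add: field_simps power2_eq_square)
    have "L2sq \<mu> (\<lambda>x. (1/2) *\<^sub>R p b x + (1/2) *\<^sub>R q b x) + L2sq \<mu> (\<lambda>x. p b x - q b x) / 4
      = (LINT x|\<mu>. (cmod ((1/2) *\<^sub>R p b x + (1/2) *\<^sub>R q b x))\<^sup>2 + (cmod (p b x - q b x))\<^sup>2 / 4)"
      using i(3,4) by simp
    also have "\<dots> = (L2sq \<mu> (p b) + L2sq \<mu> (q b)) / 2"
      unfolding pt using i(1,2) by simp
    finally show ?thesis .
  qed
  then show ?thesis
    unfolding dirichlet_energy_eq[OF p] dirichlet_energy_eq[OF q] dirichlet_energy_eq[OF m] dirichlet_energy_eq[OF d]
    unfolding sum_divide_distrib sum.distrib[symmetric] by (rule sum.cong[OF refl])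
qed

lemma dirichlet_energy_diff_le:
  assumes "u \<in> H1 \<Omega>" "w \<in> H1 \<Omega>"
  shows "dirichlet_energy \<Omega> (\<lambda>x. u x - w x) \<le> 2 * dirichlet_energy \<Omega> u + 2 * dirichlet_energy \<Omega> w"
  using dirichlet_energy_parallelogram[OF assms] dirichlet_energy_nonneg[of \<Omega> "\<lambda>x. (u x + w x) / 2"]
  by simp

lemma H1_norm_diff_le:
  assumes "u \<in> H1 \<Omega>" "w \<in> H1 \<Omega>"
  shows "(H1_norm \<Omega> (\<lambda>x. u x - w x))\<^sup>2 \<le> 2 * (H1_norm \<Omega> u)\<^sup>2 + 2 * (H1_norm \<Omega> w)\<^sup>2"
proof -
  have sq: "square_integrable \<mu> u" "square_integrable \<mu> w"
    using assms by (auto simp: H1_def)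
  then have i: "integrable \<mu> (\<lambda>x. (cmod (u x))\<^sup>2)" "integrable \<mu> (\<lambda>x. (cmod (w x))\<^sup>2)"
    "integrable \<mu> (\<lambda>x. (cmod (u x - w x))\<^sup>2)"
    using square_integrable_diff[OF sq] by (auto simp: square_integrable_def)
  have "L2sq \<mu> (\<lambda>x. u x - w x) \<le> (LINT x|\<mu>. 2 * (cmod (u x))\<^sup>2 + 2 * (cmod (w x))\<^sup>2)"
    using i by (intro integral_mono norm_diff_power2_le) auto
  also have "\<dots> = 2 * L2sq \<mu> u + 2 * L2sq \<mu> w"
    using i by simp
  finally show ?thesis
    using dirichlet_energy_diff_le[OF assms] by (simp add: H1_norm_power2)
qed

lemma H1_norm_triangle:
  assumes "u \<in> H1 \<Omega>" "v \<in> H1 \<Omega>" "w \<in> H1 \<Omega>"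
  shows "(H1_norm \<Omega> (\<lambda>x. u x - w x))\<^sup>2
    \<le> 2 * (H1_norm \<Omega> (\<lambda>x. u x - v x))\<^sup>2 + 2 * (H1_norm \<Omega> (\<lambda>x. w x - v x))\<^sup>2"
  using H1_norm_diff_le[OF H1_diff[OF assms(1,2)] H1_diff[OF assms(3,2)]] by simp

lemma H1_norm_zero: "H1_norm \<Omega> (\<lambda>x. 0) = 0"
proof -
  have "has_weak_gradient \<Omega> (\<lambda>x. 0) (\<lambda>b x. frechet_derivative (\<lambda>x. 0) (at x) b)"
    by (intro weak_gradient_smooth smooth_on_const) simp
  from dirichlet_energy_eq[OF this] show ?thesis by (simp add: H1_norm_def frechet_derivative_const)
qed

end

section \<open>Boundary data\<close>

text \<open>A bump that is positive exactly on the ball of radius \<open>r\<close> about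
  \<open>p\<close> when \<open>r\<close> is positive. Radii are compared through their squares
  because the norm itself is not smooth at the centre.\<close>

lemma smooth_on_flat_ball: "smooth_on UNIV (\<lambda>x::complex. flat 0 (r\<^sup>2 - (norm (x - p))\<^sup>2))"
  by (intro smooth_on_compose_real[OF _ open_UNIV _ smooth_on_flat] smooth_on_diff smooth_on_const
      smooth_on_norm_power2 smooth_on_bounded_linear bounded_linear_ident) auto

text \<open>The sum \<open>\<eta>\<close> of the bumps need not be a partition of unity: it is bounded below on \<open>\<partial>\<Omega>\<close> by some
  \<open>m > 0\<close>, and the denominator \<open>\<eta> + flat 0 (m - \<eta>)\<close> is positive everywhere and equals \<open>\<eta>\<close> on \<open>\<partial>\<Omega>\<close>.\<close>

lemma smooth_boundary_map_extension:
  assumes g: "smooth_boundary_map \<Omega> g" and bnd: "bounded \<Omega>"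
  obtains G where "smooth_on UNIV G" "\<And>x. x \<in> frontier \<Omega> \<Longrightarrow> G x = g x"
proof (cases "frontier \<Omega> = {}")
  case True
  then show ?thesis using that[of "\<lambda>_. 0"] by (simp add: smooth_on_const)
next
  case ne: False
  have cF: "compact (frontier \<Omega>)" using bnd by (rule compact_frontier_bounded)
  have "\<exists>U G r. open U \<and> smooth_on U G \<and> (\<forall>x\<in>U \<inter> frontier \<Omega>. G x = g x) \<and> r > 0 \<and> cball p r \<subseteq> U"
    if p: "p \<in> frontier \<Omega>" for p
  proof -
    obtain U G where U: "open U" "p \<in> U" "smooth_on U G" "\<forall>x\<in>U \<inter> frontier \<Omega>. G x = g x"
      using g p unfolding smooth_boundary_map_def by meson
    moreover obtain r where "r > 0" "cball p r \<subseteq> U" using U open_contains_cball by blast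
    ultimately show ?thesis by blast
  qed
  then obtain U H r where UHr: "\<And>p. p \<in> frontier \<Omega> \<Longrightarrow> open (U p) \<and> smooth_on (U p) (H p) \<and>
      (\<forall>x\<in>U p \<inter> frontier \<Omega>. H p x = g x) \<and> r p > 0 \<and> cball p (r p) \<subseteq> U p"
    by metis
  then have U: "\<And>p. p \<in> frontier \<Omega> \<Longrightarrow> open (U p)" "\<And>p. p \<in> frontier \<Omega> \<Longrightarrow> smooth_on (U p) (H p)"
    "\<And>p x. p \<in> frontier \<Omega> \<Longrightarrow> x \<in> U p \<Longrightarrow> x \<in> frontier \<Omega> \<Longrightarrow> H p x = g x"
    "\<And>p. p \<in> frontier \<Omega> \<Longrightarrow> r p > 0" "\<And>p. p \<in> frontier \<Omega> \<Longrightarrow> cball p (r p) \<subseteq> U p"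
    by blast+
  have "frontier \<Omega> \<subseteq> (\<Union>p\<in>frontier \<Omega>. ball p (r p))" using U(4) by force
  from compactE_image[OF cF open_ball this]
  obtain T where T: "T \<subseteq> frontier \<Omega>" "finite T" "frontier \<Omega> \<subseteq> (\<Union>p\<in>T. ball p (r p))"
    by blast
  define \<eta> where "\<eta> p x = flat 0 ((r p)\<^sup>2 - (norm (x - p))\<^sup>2)" for p x :: complex
  have \<eta>s: "smooth_on UNIV (\<eta> p)" for p unfolding \<eta>_def by (rule smooth_on_flat_ball)
  have \<eta>0: "\<eta> p x = 0" if "x \<notin> ball p (r p)" "r p > 0" for p x
    using that power_mono[of "r p" "norm (x - p)" 2]
    by (simp add: \<eta>_def flat_def dist_norm norm_minus_commute)
  have \<eta>pos: "\<eta> p x > 0" if "x \<in> ball p (r p)" for p x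
    using that power_strict_mono[of "norm (x - p)" "r p" 2]
    by (simp add: \<eta>_def flat_pos_iff dist_norm norm_minus_commute)
  have \<eta>nn: "\<eta> p x \<ge> 0" for p x by (simp add: \<eta>_def flat_nonneg)
  define E where "E x = (\<Sum>p\<in>T. \<eta> p x)" for x
  have Es: "smooth_on UNIV E" unfolding E_def by (intro smooth_on_sum \<eta>s) simp
  have Enn: "E x \<ge> 0" for x unfolding E_def by (intro sum_nonneg \<eta>nn)
  have Epos: "E x > 0" if "x \<in> frontier \<Omega>" for x
  proof -
    obtain p where "p \<in> T" "x \<in> ball p (r p)" using T(3) \<open>x \<in> frontier \<Omega>\<close> by blast
    then show ?thesis unfolding E_def using \<eta>pos T(2) by (intro sum_pos2[of T p] \<eta>nn) auto
  qed
  obtain x0 where x0: "x0 \<in> frontier \<Omega>" "\<And>x. x \<in> frontier \<Omega> \<Longrightarrow> E x0 \<le> E x"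
    using continuous_attains_inf[OF cF ne, of E] smooth_on_imp_continuous_on[OF Es] continuous_on_subset
    by blast
  \<comment> \<open>\<open>H p\<close> is smooth on \<open>U p\<close> only. The bump vanishes off a
    ball whose closure lies in \<open>U p\<close>, so the extension by zero is smooth on
    \<open>U p\<close> and on the complement of the closed ball, and these two open sets cover the
    plane.\<close>
  define N where "N p x = (if x \<in> U p then \<eta> p x *\<^sub>R H p x else 0)" for p x
  have Ns: "smooth_on UNIV (N p)" if "p \<in> T" for p
  proof (rule smooth_on_local)
    have pF: "p \<in> frontier \<Omega>" using T(1) that by blast
    fix x show "\<exists>V. open V \<and> x \<in> V \<and> V \<subseteq> UNIV \<and> smooth_on V (N p)"
    proof (cases "x \<in> U p")
      case True
      have "smooth_on (U p) (\<lambda>x. \<eta> p x *\<^sub>R H p x)"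
        using U(1,2)[OF pF] smooth_on_subset[OF \<eta>s] by (intro smooth_on_scaleR) auto
      then have "smooth_on (U p) (N p)"
        using smooth_on_cong[OF U(1)[OF pF], of "N p" "\<lambda>x. \<eta> p x *\<^sub>R H p x"] by (simp add: N_def)
      then show ?thesis using True U(1)[OF pF] by blast
    next
      case False
      have z: "N p y = 0" if "y \<in> - cball p (r p)" for y
        using that \<eta>0[of y p] U(4)[OF pF] by (auto simp: N_def)
      then have "smooth_on (- cball p (r p)) (N p)"
        using smooth_on_cong[of "- cball p (r p)" "N p" "\<lambda>_. 0"]
          smooth_on_const[OF open_Compl[OF closed_cball]] by blast
      then show ?thesis using False U(5)[OF pF] by (intro exI[of _ "- cball p (r p)"]) auto
    qed
  qed simp
  define D where "D x = E x + flat 0 (E x0 - E x)" for x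
  have Ds: "smooth_on UNIV D"
    unfolding D_def
    by (intro smooth_on_add smooth_on_compose_real[OF _ open_UNIV _ smooth_on_flat] smooth_on_diff
        smooth_on_const Es) auto
  have Dpos: "D x > 0" for x
    using Enn[of x] flat_nonneg[of 0 "E x0 - E x"] flat_pos_iff[of 0 "E x0 - E x"] Epos[OF x0(1)]
    unfolding D_def by (cases "E x > 0") linarith+
  define G where "G x = (D x powr -1) *\<^sub>R (\<Sum>p\<in>T. N p x)" for x
  have "smooth_on UNIV (\<lambda>x. D x powr -1)"
    by (rule smooth_on_compose_real[OF _ _ _ smooth_on_powr Ds]) (use Dpos in auto)
  then have "smooth_on UNIV G"
    unfolding G_def by (intro smooth_on_scaleR smooth_on_sum Ns) auto
  moreover have "G x = g x" if x: "x \<in> frontier \<Omega>" for x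
  proof -
    have "N p x = \<eta> p x *\<^sub>R g x" if "p \<in> T" for p
    proof (cases "x \<in> U p")
      case True
      then show ?thesis using U(3)[of p x] that T(1) x by (auto simp: N_def)
    next
      case False
      have pF: "p \<in> frontier \<Omega>" using T(1) that by blast
      then have "x \<notin> ball p (r p)" using False U(5) ball_subset_cball by blast
      then show ?thesis using False \<eta>0 U(4)[OF pF] by (simp add: N_def)
    qed
    then have "(\<Sum>p\<in>T. N p x) = E x *\<^sub>R g x" by (simp add: E_def scaleR_left.sum)
    moreover have "D x = E x" using x0(2)[OF x] by (simp add: D_def flat_def)
    ultimately show ?thesis using Epos[OF x] by (simp add: G_def powr_minus)
  qed
  ultimately show ?thesis using that by blast
qed

text \<open>The function \<open>\<zeta>\<close> vanishes on \<open>S\<close> and is positive where \<open>G\<close> vanishes. Since two of the components,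
  divided by \<open>\<zeta>\<close>, map a plane domain into a null set of \<open>\<complex>\<^sup>2\<close>, some \<open>(c, d)\<close> is avoided, and subtracting
  \<open>\<zeta> (c, d)\<close> leaves a map without zeros, which can be projected to the sphere.\<close>

lemma smooth_sphere_valued_extension:
  fixes G :: "nat \<Rightarrow> complex \<Rightarrow> complex"
  assumes n: "n \<ge> 2" and G: "\<And>j. j \<in> {1..n} \<Longrightarrow> smooth_on UNIV (G j)"
    and S: "\<And>x. x \<in> S \<Longrightarrow> (\<Sum>j=1..n. (cmod (G j x))\<^sup>2) = real n"
  obtains u where "\<And>j. j \<in> {1..n} \<Longrightarrow> smooth_on UNIV (u j)"
    "\<And>j x. x \<in> S \<Longrightarrow> u j x = G j x" "\<And>x. (\<Sum>j=1..n. (cmod (u j x))\<^sup>2) = real n"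
proof -
  define Q where "Q x = (\<Sum>j=1..n. (cmod (G j x))\<^sup>2)" for x
  have Qs: "smooth_on UNIV Q" unfolding Q_def by (intro smooth_on_sum smooth_on_norm_power2 G) auto
  define \<zeta> where "\<zeta> x = flat 0 (real n - Q x)" for x
  have \<zeta>s: "smooth_on UNIV \<zeta>"
    unfolding \<zeta>_def by (intro smooth_on_compose_real[OF _ open_UNIV _ smooth_on_flat] smooth_on_diff
        smooth_on_const Qs) auto
  define D where "D = {x. Q x < real n}"
  have D: "open D" unfolding D_def
    using smooth_on_imp_continuous_on[OF Qs] by (intro open_Collect_less) (auto intro: continuous_intros)
  have \<zeta>D: "\<zeta> x > 0" if "x \<in> D" for x using that by (simp add: \<zeta>_def D_def flat_pos_iff)
  have \<zeta>0: "\<zeta> x = 0" if "x \<notin> D" for x using that by (simp add: \<zeta>_def D_def flat_def)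
  \<comment> \<open>At a point of \<open>D\<close> the first two perturbed components vanish
    together exactly if \<open>\<psi>\<close> takes the value (c, d) there. The two components exist
    because n \<ge> 2.\<close>
  define \<psi> where "\<psi> x = ((\<zeta> x powr -1) *\<^sub>R G 1 x, (\<zeta> x powr -1) *\<^sub>R G 2 x)" for x
  have "smooth_on D (\<lambda>x. \<zeta> x powr -1)"
    by (rule smooth_on_compose_real[OF D _ _ smooth_on_powr smooth_on_subset[OF \<zeta>s open_UNIV D]])
       (use \<zeta>D in auto)
  then have "smooth_on D (\<lambda>x. (\<zeta> x powr -1) *\<^sub>R G j x)" if "j \<in> {1..n}" for j
    using smooth_on_subset[OF G[OF that] open_UNIV D] by (intro smooth_on_scaleR D) auto
  then have "(\<lambda>x. (\<zeta> x powr -1) *\<^sub>R G j x) differentiable_on D" if "j \<in> {1..n}" for j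
    using smooth_on_has_derivative[OF D] that
    by (metis D differentiableI differentiable_at_imp_differentiable_on)
  then have "\<psi> differentiable_on D"
    unfolding \<psi>_def differentiable_on_def using n by (intro ballI differentiable_Pair) auto
  \<comment> \<open>A differentiable map from real dimension 2 to real dimension 4 has a negligible
    image.\<close>
  then have "negligible (\<psi> ` D)"
    by (intro negligible_differentiable_image_lowdim) simp_all
  then have "\<psi> ` D \<noteq> UNIV" using non_negligible_UNIV by metis
  then obtain c d where cd: "(c, d) \<notin> \<psi> ` D" by auto
  define F where "F j x = G j x - \<zeta> x *\<^sub>R (if j = 1 then c else if j = 2 then d else 0)" for j x
  have Fs: "smooth_on UNIV (F j)" if "j \<in> {1..n}" for j
    unfolding F_def by (intro smooth_on_diff smooth_on_scaleR smooth_on_const G that \<zeta>s) auto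
  define P where "P x = (\<Sum>j=1..n. (cmod (F j x))\<^sup>2)" for x
  have Ps: "smooth_on UNIV P" unfolding P_def by (intro smooth_on_sum smooth_on_norm_power2 Fs) auto
  have Ppos: "P x > 0" for x
  proof (rule ccontr)
    assume "\<not> P x > 0"
    moreover have "P x \<ge> 0" unfolding P_def by (intro sum_nonneg) simp
    ultimately have "P x = 0" by simp
    then have F0: "F j x = 0" if "j \<in> {1..n}" for j
      using that unfolding P_def by (subst (asm) sum_nonneg_eq_0_iff) auto
    show False
    proof (cases "x \<in> D")
      case True
      then have "\<psi> x = (c, d)"
        using F0[of 1] F0[of 2] n \<zeta>D[OF True] by (simp add: F_def \<psi>_def powr_minus)
      then show False using cd True by (metis image_eqI)
    next
      \<comment> \<open>Outside \<open>D\<close> the perturbation vanishes and \<open>Q\<close> is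
        at least n, hence nonzero.\<close>
      case False
      then have "Q x = P x" by (simp add: Q_def P_def F_def \<zeta>0)
      then show False using \<open>P x = 0\<close> False n by (simp add: D_def)
    qed
  qed
  define u where "u j x = ((P x / real n) powr (-1/2)) *\<^sub>R F j x" for j x
  have "smooth_on UNIV (\<lambda>x. (P x / real n) powr (-1/2))"
  proof (rule smooth_on_compose_real[OF _ _ _ smooth_on_powr])
    show "smooth_on UNIV (\<lambda>x. P x / real n)"
      using smooth_on_scaleR[OF open_UNIV smooth_on_const[of UNIV "1 / real n"] Ps] by simp
  qed (use Ppos n in auto)
  then have us: "smooth_on UNIV (u j)" if "j \<in> {1..n}" for j
    unfolding u_def using Fs[OF that] by (intro smooth_on_scaleR) auto
  have "u j x = G j x" if x: "x \<in> S" for j x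
  proof -
    have "x \<notin> D" using S[OF x] by (simp add: D_def Q_def)
    then have "F j x = G j x" "P x = real n" for j
      using S[OF x] by (auto simp: F_def P_def \<zeta>0)
    then show ?thesis using n by (simp add: u_def)
  qed
  moreover have "(\<Sum>j=1..n. (cmod (u j x))\<^sup>2) = real n" for x
  proof -
    have "((P x / real n) powr (-1/2))\<^sup>2 = (P x / real n) powr (- 1)"
      by (simp add: power2_eq_square flip: powr_add)
    then have "(\<Sum>j=1..n. (cmod (u j x))\<^sup>2) = (P x / real n) powr (- 1) * P x"
      by (simp add: u_def P_def power_mult_distrib sum_distrib_left)
    then show ?thesis using Ppos[of x] n by (simp add: powr_minus)
  qed
  ultimately show ?thesis using that us by blast
qed

section \<open>The boundary has finite length\<close>

text \<open>Cut the interval into N pieces of length h. Their images have diameter at most L h,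
  which is below \<delta> for large N, while the sum N L h = L (b - a) does not depend on
  \<delta>.\<close>

lemma hausdorff1_outer_lipschitz_image:
  fixes f :: "real \<Rightarrow> 'a::real_normed_vector"
  assumes "a \<le> b" "L > 0" and L: "\<And>s t. s \<in> {a..b} \<Longrightarrow> t \<in> {a..b} \<Longrightarrow> dist (f s) (f t) \<le> L * \<bar>s - t\<bar>"
  shows "hausdorff1_outer (f ` {a..b}) \<le> ennreal (L * (b - a))"
  unfolding hausdorff1_outer_def
proof (rule SUP_least)
  fix \<delta> :: real assume "\<delta> \<in> {0<..}"
  then have \<delta>: "\<delta> > 0" by simp
  obtain N0 :: nat where N0: "L * (b - a) / \<delta> < real N0" using reals_Archimedean2 by blast
  define N where "N = Suc N0"
  define h where "h = (b - a) / real N"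
  have N: "real N > 0" by (simp add: N_def)
  have hN: "real N * h = b - a" using N by (simp add: h_def)
  have h0: "h \<ge> 0" using assms(1) by (simp add: h_def)
  have Lh: "L * h \<le> \<delta>"
  proof -
    have "L * (b - a) < real N * \<delta>" using N0 \<delta> by (simp add: N_def field_simps)
    then have "real N * (L * h) \<le> real N * \<delta>" by (metis hN less_imp_le mult.left_commute)
    then show ?thesis using N by simp
  qed
  define C where "C i = (if i < N then f ` {a + real i * h .. a + real (Suc i) * h} else {})" for i
  have sub: "{a + real i * h .. a + real (Suc i) * h} \<subseteq> {a..b}" if "i < N" for i
  proof -
    have "real (Suc i) * h \<le> real N * h" using that h0 by (intro mult_right_mono) auto
    moreover have "0 \<le> real i * h" using h0 by simp
    ultimately show ?thesis using hN by auto
  qed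
  have dC: "dist x y \<le> L * h" if "x \<in> C i" "y \<in> C i" for x y i
  proof -
    have i: "i < N" using that by (auto simp: C_def split: if_splits)
    then have "x \<in> f ` {a + real i * h .. a + real (Suc i) * h}" "y \<in> f ` {a + real i * h .. a + real (Suc i) * h}"
      using that by (simp_all only: C_def if_True)
    then obtain s t where st: "x = f s" "y = f t" "s \<in> {a + real i * h .. a + real (Suc i) * h}"
      "t \<in> {a + real i * h .. a + real (Suc i) * h}"
      by blast
    then have "dist x y \<le> L * \<bar>s - t\<bar>" using sub[OF i] L by blast
    also have "\<dots> \<le> L * h" using st assms(2) by (intro mult_left_mono) (auto simp: algebra_simps)
    finally show ?thesis .
  qed
  have Lh0: "0 \<le> L * h" using assms(2) h0 by simp
  have bC: "bounded (C i)" for i unfolding bounded_two_points using dC by meson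
  have diam: "diameter (C i) \<le> L * h" for i
    using dC Lh0 by (intro diameter_le) (auto simp: dist_norm)
  have cover: "f ` {a..b} \<subseteq> (\<Union>i. C i)"
  proof
    fix y assume "y \<in> f ` {a..b}"
    then obtain s where s: "s \<in> {a..b}" "y = f s" by blast
    show "y \<in> (\<Union>i. C i)"
    \<comment> \<open>The quotient and floor used below require a nonzero \<open>h\<close> and would
      give the right end point the index \<open>N\<close>, one too large. Both exceptions are placed
      in the last piece, of index \<open>N0\<close>.\<close>
    proof (cases "h = 0 \<or> s = b")
      case True
      then have "s \<in> {a + real N0 * h .. a + real (Suc N0) * h}"
        using hN s h0 by (auto simp: N_def algebra_simps)
      then show ?thesis using s by (auto simp: C_def N_def)
    next
      case False
      then have h: "h > 0" using h0 by simp
      define i where "i = nat \<lfloor>(s - a) / h\<rfloor>"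
      have q: "0 \<le> (s - a) / h" using s h by simp
      then have i: "real i \<le> (s - a) / h" "(s - a) / h < real i + 1" unfolding i_def by linarith+
      have "(s - a) / h < real N" using False s h hN by (simp add: field_simps)
      then have "i < N" using i(1) by linarith
      moreover have "s \<in> {a + real i * h .. a + real (Suc i) * h}"
        using i h by (auto simp: field_simps)
      ultimately show ?thesis using s by (auto simp: C_def)
    qed
  qed
  have "C \<in> small_covers \<delta> (f ` {a..b})"
    using cover bC order_trans[OF diam Lh] by (auto simp: small_covers_def)
  then have "hausdorff1_pre \<delta> (f ` {a..b}) \<le> (\<Sum>i. ennreal (diameter (C i)))"
    unfolding hausdorff1_pre_def by (rule INF_lower)
  also have "\<dots> = (\<Sum>i<N. ennreal (diameter (C i)))"
    by (rule suminf_finite) (auto simp: C_def)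
  also have "\<dots> \<le> (\<Sum>i<N. ennreal (L * h))"
    by (intro sum_mono ennreal_leI diam)
  also have "\<dots> = ennreal (real N * (L * h))"
    using Lh0 by (simp add: ennreal_mult' ennreal_of_nat_eq_real_of_nat)
  also have "real N * (L * h) = L * (b - a)" by (metis hN mult.left_commute)
  finally show "hausdorff1_pre \<delta> (f ` {a..b}) \<le> ennreal (L * (b - a))" .
qed

text \<open>Points above the graph belong to the open set itself, and points strictly below it have
  a neighbourhood disjoint from the set. Neither can be frontier points.\<close>

lemma frontier_locally_graph:
  fixes \<Omega> :: "complex set"
  assumes "open \<Omega>" "continuous_on UNIV h" "cmod e = 1"
    and loc: "\<Omega> \<inter> ball p r = {z \<in> ball p r. Im (z / e) > h (Re (z / e))}"
    and z: "z \<in> frontier \<Omega>" "z \<in> ball p r"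
  shows "Im (z / e) = h (Re (z / e))"
proof -
  have znot: "z \<notin> \<Omega>" using z(1) assms(1) by (simp add: frontier_def interior_open)
  have le: "Im (z / e) \<le> h (Re (z / e))"
  proof (rule ccontr)
    assume "\<not> Im (z / e) \<le> h (Re (z / e))"
    then have "z \<in> \<Omega> \<inter> ball p r" unfolding loc using z(2) by simp
    with znot show False by blast
  qed
  have "\<not> Im (z / e) < h (Re (z / e))"
  proof
    assume lt: "Im (z / e) < h (Re (z / e))"
    let ?V = "ball p r \<inter> {w. Im (w / e) < h (Re (w / e))}"
    have "open {w. Im (w / e) < h (Re (w / e))}"
      using assms(3) by (intro open_Collect_less continuous_on_compose2[OF assms(2)] continuous_intros) auto
    then have "open ?V" by auto
    moreover have "z \<in> ?V" using lt z(2) by auto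
    moreover have "z \<in> closure \<Omega>" using z(1) by (simp add: frontier_def)
    ultimately obtain w where "w \<in> \<Omega>" "w \<in> ?V"
      using open_Int_closure_eq_empty[of ?V \<Omega>] by blast
    then have "w \<in> \<Omega> \<inter> ball p r" by blast
    then show False unfolding loc using \<open>w \<in> ?V\<close> by simp
  qed
  with le show ?thesis by simp
qed

text \<open>By compactness finitely many charts suffice, and in each the boundary lies in a
  Lipschitz graph over a bounded interval. Finite length makes continuous functions square
  integrable on the boundary.\<close>

lemma hausdorff1_outer_frontier_finite:
  assumes "smooth_bounded_domain \<Omega>"
  shows "hausdorff1_outer (frontier \<Omega>) < \<infinity>"
proof -
  have \<Omega>: "open \<Omega>" "bounded \<Omega>" "smooth_boundary \<Omega>"
    using assms by (auto simp: smooth_bounded_domain_def)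
  have cF: "compact (frontier \<Omega>)" using \<Omega>(2) by (rule compact_frontier_bounded)
  have "\<exists>r>0. hausdorff1_outer (frontier \<Omega> \<inter> ball p r) < \<infinity>" if p: "p \<in> frontier \<Omega>" for p
  proof -
    obtain r e h where r: "r > 0" "cmod e = 1" "smooth_on UNIV (h :: real \<Rightarrow> real)"
      "\<Omega> \<inter> ball p r = {z \<in> ball p r. Im (z / e) > h (Re (z / e))}"
      using \<Omega>(3) p unfolding smooth_boundary_def by meson
    have hc: "continuous_on UNIV h" using r(3) by (rule smooth_on_imp_continuous_on)
    let ?h' = "\<lambda>x. frechet_derivative h (at x)"
    have hd: "(h has_derivative ?h' x) (at x)" for x
      using smooth_on_has_derivative[OF open_UNIV r(3)] by simp
    \<comment> \<open>Since e has modulus 1, the coordinate \<open>Re (z / e)\<close> of a point of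
      the ball is at most |z| < |p| + r; \<open>f\<close> below undoes the rotation and parametrizes
      the graph.\<close>
    define R where "R = cmod p + r"
    define f where "f s = e * Complex s (h s)" for s
    have "continuous_on {-R..R} (\<lambda>x. ?h' x 1)"
      using smooth_on_imp_continuous_on[OF smooth_on_frechet_derivative[OF r(3), of 1]]
      by (auto intro: continuous_on_subset)
    then have "bounded ((\<lambda>x. ?h' x 1) ` {-R..R})"
      by (intro compact_imp_bounded compact_continuous_image) auto
    then obtain B where B: "B > 0" "\<And>x. x \<in> {-R..R} \<Longrightarrow> \<bar>?h' x 1\<bar> \<le> B"
      unfolding bounded_pos by auto
    have hL: "\<bar>h s - h t\<bar> \<le> B * \<bar>s - t\<bar>" if "s \<in> {-R..R}" "t \<in> {-R..R}" for s t
    proof -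
      have "norm (h s - h t) \<le> B * norm (s - t)"
      proof (rule differentiable_bound[of "{-R..R}" h ?h'])
        fix x assume x: "x \<in> {-R..R}"
        show "onorm (?h' x) \<le> B"
        proof (rule onorm_le)
          fix y :: real
          have "?h' x y = y * ?h' x 1"
            using linear_simps(5)[OF has_derivative_bounded_linear[OF hd], of x y 1] by simp
          then show "norm (?h' x y) \<le> B * norm y"
            using mult_right_mono[OF B(2)[OF x], of "\<bar>y\<bar>"] by (simp add: abs_mult mult.commute)
        qed
      qed (use that has_derivative_at_withinI[OF hd] in auto)
      then show ?thesis by simp
    qed
    have L: "dist (f s) (f t) \<le> (1 + B) * \<bar>s - t\<bar>" if "s \<in> {-R..R}" "t \<in> {-R..R}" for s t
    proof -
      have "dist (f s) (f t) = cmod (Complex (s - t) (h s - h t))"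
        using r(2) by (simp add: f_def dist_norm norm_mult complex_diff flip: right_diff_distrib)
      also have "\<dots> \<le> \<bar>s - t\<bar> + \<bar>h s - h t\<bar>" using cmod_le[of "Complex (s - t) (h s - h t)"] by simp
      also have "\<dots> \<le> (1 + B) * \<bar>s - t\<bar>" using hL[OF that] by (simp add: algebra_simps)
      finally show ?thesis .
    qed
    have "frontier \<Omega> \<inter> ball p r \<subseteq> f ` {-R..R}"
    proof
      fix z assume z: "z \<in> frontier \<Omega> \<inter> ball p r"
      have e: "e \<noteq> 0" using r(2) by auto
      have "Im (z / e) = h (Re (z / e))"
        using frontier_locally_graph[OF \<Omega>(1) hc r(2,4)] z by blast
      then have "z = f (Re (z / e))"
        unfolding f_def using e by (metis complex_surj nonzero_eq_divide_eq mult.commute)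
      moreover have "\<bar>Re (z / e)\<bar> \<le> R"
      proof -
        have "\<bar>Re (z / e)\<bar> \<le> cmod (z / e)" by (rule abs_Re_le_cmod)
        also have "\<dots> = cmod z" using r(2) by (simp add: norm_divide)
        also have "\<dots> \<le> R" using z norm_triangle_ineq2[of z p] by (simp add: R_def dist_norm norm_minus_commute)
        finally show ?thesis .
      qed
      ultimately show "z \<in> f ` {-R..R}" by (intro image_eqI[of z f "Re (z / e)"]) auto
    qed
    then have "hausdorff1_outer (frontier \<Omega> \<inter> ball p r) \<le> hausdorff1_outer (f ` {-R..R})"
      by (rule hausdorff1_outer_mono)
    also have "\<dots> \<le> ennreal ((1 + B) * (R - (- R)))"
      using B(1) r(1) L by (intro hausdorff1_outer_lipschitz_image) (auto simp: R_def)
    also have "\<dots> < \<infinity>" by simp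
    finally show ?thesis using r(1) by blast
  qed
  then obtain r where r: "\<And>p. p \<in> frontier \<Omega> \<Longrightarrow> r p > 0"
    "\<And>p. p \<in> frontier \<Omega> \<Longrightarrow> hausdorff1_outer (frontier \<Omega> \<inter> ball p (r p)) < \<infinity>" by metis
  then have "frontier \<Omega> \<subseteq> (\<Union>p\<in>frontier \<Omega>. ball p (r p))" by force
  from compactE_image[OF cF open_ball this]
  obtain T where T: "T \<subseteq> frontier \<Omega>" "finite T" "frontier \<Omega> \<subseteq> (\<Union>p\<in>T. ball p (r p))"
    by blast
  have "hausdorff1_outer (\<Union>p\<in>I. frontier \<Omega> \<inter> ball p (r p)) < \<infinity>" if "I \<subseteq> T" for I
    using finite_subset[OF that T(2)] that
  proof (induction I rule: finite_induct)
    case (insert p I)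
    have "hausdorff1_outer (\<Union>p\<in>insert p I. frontier \<Omega> \<inter> ball p (r p))
      \<le> hausdorff1_outer (frontier \<Omega> \<inter> ball p (r p)) + hausdorff1_outer (\<Union>p\<in>I. frontier \<Omega> \<inter> ball p (r p))"
      by (simp add: hausdorff1_outer_subadditive2)
    also have "\<dots> < \<infinity>" using insert r(2)[of p] T(1) by auto
    finally show ?case .
  qed (simp add: hausdorff1_outer_empty)
  from this[of T] have "hausdorff1_outer (\<Union>p\<in>T. frontier \<Omega> \<inter> ball p (r p)) < \<infinity>" by simp
  moreover have "frontier \<Omega> \<subseteq> (\<Union>p\<in>T. frontier \<Omega> \<inter> ball p (r p))" using T(3) by blast
  ultimately show ?thesis using hausdorff1_outer_mono order_le_less_trans by blast
qed

section \<open>The boundary measure and traces of smooth functions\<close>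

lemma sets_hausdorff1: "sets hausdorff1 = sets borel"
  using sets.sigma_sets_eq[of borel] by (simp add: hausdorff1_def sets_measure_of_conv)

lemma space_hausdorff1: "space hausdorff1 = UNIV"
  by (simp add: hausdorff1_def space_measure_of_conv)

lemma space_boundary_measure: "space (boundary_measure \<Omega>) = frontier \<Omega>"
  by (simp add: boundary_measure_def space_restrict_space space_hausdorff1)

lemma finite_measure_boundary_measure:
  assumes "smooth_bounded_domain \<Omega>"
  shows "finite_measure (boundary_measure \<Omega>)"
proof (rule finite_measureI)
  have "emeasure (boundary_measure \<Omega>) (frontier \<Omega>) = emeasure hausdorff1 (frontier \<Omega>)"
    unfolding boundary_measure_def
    by (rule emeasure_restrict_space) (auto simp: sets_hausdorff1 frontier_closed)
  also have "\<dots> = hausdorff1_outer (frontier \<Omega>)"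
    by (rule emeasure_hausdorff1) (simp add: frontier_closed)
  finally show "emeasure (boundary_measure \<Omega>) (space (boundary_measure \<Omega>)) \<noteq> \<infinity>"
    using hausdorff1_outer_frontier_finite[OF assms] by (simp add: space_boundary_measure)
qed

lemma square_integrable_boundary:
  assumes "smooth_bounded_domain \<Omega>" "continuous_on UNIV f"
  shows "square_integrable (boundary_measure \<Omega>) f"
proof -
  interpret finite_measure "boundary_measure \<Omega>" by (rule finite_measure_boundary_measure[OF assms(1)])
  have "compact (frontier \<Omega>)"
    using assms(1) by (auto simp: smooth_bounded_domain_def intro: compact_frontier_bounded)
  then have "bounded (f ` frontier \<Omega>)"
    using assms(2) by (intro compact_imp_bounded compact_continuous_image) (auto intro: continuous_on_subset)
  then obtain B where B: "\<And>x. x \<in> frontier \<Omega> \<Longrightarrow> cmod (f x) \<le> B"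
    by (auto simp: bounded_iff)
  have "f \<in> borel_measurable borel" using assms(2) by (rule borel_measurable_continuous_onI)
  then have "f \<in> borel_measurable hausdorff1" by (simp cong: measurable_cong_sets add: sets_hausdorff1)
  then have "f \<in> borel_measurable (boundary_measure \<Omega>)"
    unfolding boundary_measure_def by (rule measurable_restrict_space1)
  then show ?thesis
    using B by (intro square_integrable_bounded[of _ B] AE_I2) (simp_all add: space_boundary_measure)
qed

text \<open>The constant sequence \<open>u\<close> serves as approximation. As
  \<open>boundary_measure\<close> has the frontier as its space, equality there carries
  measurability and integrability over to \<open>g\<close>.\<close>

lemma has_trace_smooth:
  assumes "smooth_bounded_domain \<Omega>" "smooth_on UNIV u" "\<And>x. x \<in> frontier \<Omega> \<Longrightarrow> u x = g x"
  shows "has_trace \<Omega> u g"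
  unfolding has_trace_def
proof
  interpret bounded_open \<Omega> using assms(1) by unfold_locales (auto simp: smooth_bounded_domain_def)
  have "square_integrable (boundary_measure \<Omega>) u"
    using assms(1,2) by (intro square_integrable_boundary smooth_on_imp_continuous_on)
  moreover have "g \<in> borel_measurable (boundary_measure \<Omega>) \<longleftrightarrow> u \<in> borel_measurable (boundary_measure \<Omega>)"
    using assms(3) by (intro measurable_cong) (simp add: space_boundary_measure)
  moreover have "integrable (boundary_measure \<Omega>) (\<lambda>x. (cmod (g x))\<^sup>2) \<longleftrightarrow>
      integrable (boundary_measure \<Omega>) (\<lambda>x. (cmod (u x))\<^sup>2)"
    using assms(3) by (intro Bochner_Integration.integrable_cong) (simp_all add: space_boundary_measure)
  ultimately show "square_integrable (boundary_measure \<Omega>) g" by (simp add: square_integrable_def)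
  have "L2sq (boundary_measure \<Omega>) (\<lambda>x. u x - g x) = (LINT x|boundary_measure \<Omega>. 0)"
    using assms(3) by (intro Bochner_Integration.integral_cong) (simp_all add: space_boundary_measure)
  then show "\<exists>\<phi>. (\<forall>k. smooth_on UNIV (\<phi> k)) \<and> (\<lambda>k. H1_norm \<Omega> (\<lambda>x. \<phi> k x - u x)) \<longlonglongrightarrow> 0 \<and>
      (\<lambda>k. L2sq (boundary_measure \<Omega>) (\<lambda>x. \<phi> k x - g x)) \<longlonglongrightarrow> 0"
    using assms(2) by (intro exI[of _ "\<lambda>_::nat. u"]) (simp add: H1_norm_zero)
qed

lemma admissible_nonempty:
  assumes "n \<ge> 2" "smooth_bounded_domain \<Omega>" and g: "\<And>j. j \<in> {1..n} \<Longrightarrow> smooth_boundary_map \<Omega> (g j)"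
  shows "admissible \<Omega> n g \<noteq> {}"
proof -
  interpret bounded_open \<Omega> using assms(2) by unfold_locales (auto simp: smooth_bounded_domain_def)
  have "\<exists>G. smooth_on UNIV G \<and> (\<forall>x\<in>frontier \<Omega>. G x = g j x)" if "j \<in> {1..n}" for j
    using smooth_boundary_map_extension[OF g[OF that] bounded_\<Omega>] by metis
  then obtain G where G: "\<And>j. j \<in> {1..n} \<Longrightarrow> smooth_on UNIV (G j)"
    "\<And>j x. j \<in> {1..n} \<Longrightarrow> x \<in> frontier \<Omega> \<Longrightarrow> G j x = g j x" by metis
  have "(\<Sum>j=1..n. (cmod (G j x))\<^sup>2) = real n" if "x \<in> frontier \<Omega>" for x
  proof -
    have "cmod (G j x) = 1" if "j \<in> {1..n}" for j
      using G(2)[OF that \<open>x \<in> frontier \<Omega>\<close>] g[OF that] \<open>x \<in> frontier \<Omega>\<close>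
      by (auto simp: smooth_boundary_map_def)
    then show ?thesis by simp
  qed
  then obtain u where u: "\<And>j. j \<in> {1..n} \<Longrightarrow> smooth_on UNIV (u j)"
    "\<And>j x. x \<in> frontier \<Omega> \<Longrightarrow> u j x = G j x" "\<And>x. (\<Sum>j=1..n. (cmod (u j x))\<^sup>2) = real n"
    using smooth_sphere_valued_extension[where G=G and S="frontier \<Omega>" and n=n] assms(1) G(1) by blast
  \<comment> \<open>\<open>admissible\<close> is a set of extensional families, so values at other
    indices have to be reset.\<close>
  have "restrict u {1..n} \<in> admissible \<Omega> n g"
    unfolding admissible_def H1_bc_def
    using u G(2) by (auto intro!: smooth_H1 has_trace_smooth[OF assms(2)])
  then show ?thesis by blast
qed

section \<open>A Poincare inequality on squares\<close>

text \<open>The integral of the squared deviation of \<open>g\<close> from its mean \<open>c\<close>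
  is nonnegative; expanding it gives the claim.\<close>

lemma integral_Cauchy_Schwarz:
  fixes g :: "real \<Rightarrow> real"
  assumes "a < b" "continuous_on {a..b} g"
  shows "(integral {a..b} g)\<^sup>2 \<le> (b - a) * integral {a..b} (\<lambda>x. (g x)\<^sup>2)"
proof -
  let ?I = "integral {a..b} g" and ?Q = "integral {a..b} (\<lambda>x. (g x)\<^sup>2)"
  define c where "c = ?I / (b - a)"
  have i: "g integrable_on {a..b}" "(\<lambda>x. (g x)\<^sup>2) integrable_on {a..b}"
    using assms(2) by (auto intro!: integrable_continuous_real continuous_intros)
  have "0 \<le> integral {a..b} (\<lambda>x. (g x - c)\<^sup>2)"
    using assms(2) by (intro integral_nonneg integrable_continuous_real continuous_intros) auto
  also have "(\<lambda>x. (g x - c)\<^sup>2) = (\<lambda>x. ((g x)\<^sup>2 - 2 * c * g x) + c\<^sup>2)"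
    by (auto simp: power2_diff)
  also have "integral {a..b} \<dots> = ?Q - 2 * c * ?I + c\<^sup>2 * (b - a)"
  proof -
    have "integral {a..b} (\<lambda>x. (g x)\<^sup>2 - 2 * c * g x) = ?Q - integral {a..b} (\<lambda>x. 2 * c * g x)"
      by (intro Henstock_Kurzweil_Integration.integral_diff i(2) integrable_on_mult_right i(1))
    moreover have "integral {a..b} (\<lambda>x. (g x)\<^sup>2 - 2 * c * g x + c\<^sup>2)
        = integral {a..b} (\<lambda>x. (g x)\<^sup>2 - 2 * c * g x) + integral {a..b} (\<lambda>x. c\<^sup>2)"
      by (intro Henstock_Kurzweil_Integration.integral_add integrable_diff i(2) integrable_on_mult_right i(1)
          integrable_const_ivl)
    ultimately show ?thesis using assms(1) by simp
  qed
  also have "\<dots> = ?Q - ?I\<^sup>2 / (b - a)"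
  proof -
    have "c * (b - a) = ?I" using assms(1) by (simp add: c_def)
    then have "c\<^sup>2 * (b - a) = c * ?I" by (simp add: power2_eq_square)
    moreover have "c * ?I = ?I\<^sup>2 / (b - a)" by (simp add: c_def power2_eq_square)
    ultimately show ?thesis by simp
  qed
  finally show ?thesis using assms(1) by (simp add: field_simps)
qed

lemma norm_integral_Cauchy_Schwarz:
  fixes g :: "real \<Rightarrow> 'a::euclidean_space"
  assumes "a < b" "continuous_on {a..b} g"
  shows "(norm (integral {a..b} g))\<^sup>2 \<le> (b - a) * integral {a..b} (\<lambda>x. (norm (g x))\<^sup>2)"
proof -
  have "norm (integral {a..b} g) \<le> integral {a..b} (\<lambda>x. norm (g x))"
    using assms(2) by (intro integral_norm_bound_integral integrable_continuous_real continuous_intros) auto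
  then have "(norm (integral {a..b} g))\<^sup>2 \<le> (integral {a..b} (\<lambda>x. norm (g x)))\<^sup>2"
    by (intro power_mono) auto
  also have "\<dots> \<le> (b - a) * integral {a..b} (\<lambda>x. (norm (g x))\<^sup>2)"
    using assms by (intro integral_Cauchy_Schwarz continuous_intros)
  finally show ?thesis .
qed

text \<open>The fundamental theorem of calculus and Cauchy-Schwarz between s and t; enlarging to the
  whole interval makes the bound uniform in both points.\<close>

lemma oscillation_le_integral_derivative:
  fixes f :: "real \<Rightarrow> 'a::euclidean_space"
  assumes "\<And>x. (f has_vector_derivative f' x) (at x)" "continuous_on UNIV f'"
    and "s \<in> {a..b}" "t \<in> {a..b}"
  shows "(norm (f s - f t))\<^sup>2 \<le> (b - a) * integral {a..b} (\<lambda>x. (norm (f' x))\<^sup>2)"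
  using assms(3,4)
proof (induction s t rule: linorder_wlog)
  case (sym s t)
  then show ?case by (simp add: norm_minus_commute)
next
  case (le s t)
  have nn: "0 \<le> integral {a..b} (\<lambda>x. (norm (f' x))\<^sup>2)"
    by (intro integral_nonneg integrable_continuous_real continuous_intros
        continuous_on_subset[OF assms(2)]) auto
  show ?case
  proof (cases "s = t")
    case True
    then show ?thesis using nn le by simp
  next
    case False
    then have st: "s < t" using le by simp
    have "(f' has_integral (f t - f s)) {s..t}"
      using st assms(1) by (intro fundamental_theorem_of_calculus) (auto intro: has_vector_derivative_at_within)
    then have "(norm (f s - f t))\<^sup>2 = (norm (integral {s..t} f'))\<^sup>2"
      by (simp add: integral_unique norm_minus_commute)
    also have "\<dots> \<le> (t - s) * integral {s..t} (\<lambda>x. (norm (f' x))\<^sup>2)"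
      using st continuous_on_subset[OF assms(2)] by (intro norm_integral_Cauchy_Schwarz) auto
    also have "\<dots> \<le> (b - a) * integral {a..b} (\<lambda>x. (norm (f' x))\<^sup>2)"
    proof (intro mult_mono integral_subset_le)
      show "(\<lambda>x. (norm (f' x))\<^sup>2) integrable_on {s..t}" "(\<lambda>x. (norm (f' x))\<^sup>2) integrable_on {a..b}"
        by (intro integrable_continuous_real continuous_intros continuous_on_subset[OF assms(2)]; simp)+
      show "0 \<le> integral {s..t} (\<lambda>x. (norm (f' x))\<^sup>2)"
        by (intro integral_nonneg integrable_continuous_real continuous_intros
            continuous_on_subset[OF assms(2)]) auto
    qed (use le st in auto)
    finally show ?thesis .
  qed
qed

text \<open>The mean \<open>m\<close> and the deviation from it are orthogonal in L^2. The former
  contributes the squared integral, the latter is bounded pointwise by the oscillation.\<close>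

lemma integral_power2_le_oscillation:
  fixes f :: "real \<Rightarrow> 'a::euclidean_space"
  assumes ab: "a < b" and f: "continuous_on {a..b} f"
    and osc: "\<And>s t. s \<in> {a..b} \<Longrightarrow> t \<in> {a..b} \<Longrightarrow> (norm (f s - f t))\<^sup>2 \<le> D"
  shows "integral {a..b} (\<lambda>x. (norm (f x))\<^sup>2) \<le> (norm (integral {a..b} f))\<^sup>2 / (b - a) + (b - a) * D"
proof -
  define m where "m = (1 / (b - a)) *\<^sub>R integral {a..b} f"
  have fi: "f integrable_on {a..b}" using f by (rule integrable_continuous_real)
  \<comment> \<open>The deviation at s is the average of \<open>f s - f t\<close> over t, hence no
    larger than the oscillation.\<close>
  have dev: "(norm (f s - m))\<^sup>2 \<le> D" if s: "s \<in> {a..b}" for s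
  proof -
    have D: "D \<ge> 0" using osc[OF s s] by simp
    have "norm (integral {a..b} (\<lambda>t. f s - f t)) \<le> sqrt D * (b - a)"
    proof -
      have "((\<lambda>t. f s - f t) has_integral (integral {a..b} (\<lambda>t. f s - f t))) (cbox a b)"
        using f by (auto intro!: integrable_integral integrable_continuous_real continuous_intros)
      from has_integral_bound[OF _ this, of "sqrt D"] show ?thesis
        using osc[OF s] ab D by (auto simp: real_le_rsqrt)
    qed
    also have "integral {a..b} (\<lambda>t. f s - f t) = (b - a) *\<^sub>R (f s - m)"
      using fi ab by (subst Henstock_Kurzweil_Integration.integral_diff) (auto simp: m_def scaleR_diff_right)
    finally have "norm (f s - m) \<le> sqrt D" using ab by (simp add: mult.commute)
    then have "(norm (f s - m))\<^sup>2 \<le> (sqrt D)\<^sup>2" by (intro power_mono) auto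
    then show ?thesis using D by simp
  qed
  have ci: "(\<lambda>x. (norm (f x - m))\<^sup>2) integrable_on {a..b}"
    using f by (intro integrable_continuous_real continuous_intros)
  have di: "(\<lambda>x. f x - m) integrable_on {a..b}"
    using f by (intro integrable_continuous_real continuous_intros)
  have zero: "integral {a..b} (\<lambda>x. (f x - m) \<bullet> m) = 0"
  proof -
    have "integral {a..b} (\<lambda>x. f x - m) = 0"
      using fi ab by (subst Henstock_Kurzweil_Integration.integral_diff) (auto simp: m_def)
    then show ?thesis
      using integral_linear[OF di bounded_linear_inner_left[of m]] by (simp add: o_def)
  qed
  have nm: "(b - a) * (norm m)\<^sup>2 = (norm (integral {a..b} f))\<^sup>2 / (b - a)"
    using ab by (simp add: m_def power_divide power2_eq_square)
  have "integral {a..b} (\<lambda>x. (norm (f x))\<^sup>2)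
     = integral {a..b} (\<lambda>x. (norm (f x - m))\<^sup>2 + (2 * ((f x - m) \<bullet> m) + (norm m)\<^sup>2))"
    by (intro Henstock_Kurzweil_Integration.integral_cong)
       (simp add: power2_norm_eq_inner inner_diff_left inner_diff_right inner_commute)
  also have "\<dots> = integral {a..b} (\<lambda>x. (norm (f x - m))\<^sup>2)
      + integral {a..b} (\<lambda>x. 2 * ((f x - m) \<bullet> m) + (norm m)\<^sup>2)"
    using f by (intro Henstock_Kurzweil_Integration.integral_add ci integrable_continuous_real continuous_intros)
  also have "integral {a..b} (\<lambda>x. 2 * ((f x - m) \<bullet> m) + (norm m)\<^sup>2)
      = integral {a..b} (\<lambda>x. 2 * ((f x - m) \<bullet> m)) + integral {a..b} (\<lambda>x. (norm m)\<^sup>2)"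
    using f by (intro Henstock_Kurzweil_Integration.integral_add integrable_continuous_real continuous_intros)
  also have "\<dots> = (norm (integral {a..b} f))\<^sup>2 / (b - a)"
    using ab zero nm by simp
  also have "integral {a..b} (\<lambda>x. (norm (f x - m))\<^sup>2) \<le> integral {a..b} (\<lambda>x. D)"
    using dev by (intro integral_le ci) auto
  also have "\<dots> = (b - a) * D" using ab by simp
  finally show ?thesis by simp
qed

text \<open>The one-dimensional estimate is used twice: in x on each horizontal slice, then in y for
  the slice integrals \<open>A\<close>. The first use produces the x-derivative, and the oscillation
  of \<open>A\<close> is controlled by the y-derivative.\<close>

lemma poincare_square_iterated:
  fixes p px py :: "real \<Rightarrow> real \<Rightarrow> complex"
  assumes h: "h > 0"
    and px: "\<And>x y. ((\<lambda>x. p x y) has_vector_derivative px x y) (at x)"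
    and py: "\<And>x y. ((\<lambda>y. p x y) has_vector_derivative py x y) (at y)"
    and c: "continuous_on UNIV (\<lambda>z. p (fst z) (snd z))" "continuous_on UNIV (\<lambda>z. px (fst z) (snd z))"
      "continuous_on UNIV (\<lambda>z. py (fst z) (snd z))"
  shows "integral {a'..a'+h} (\<lambda>y. integral {a..a+h} (\<lambda>x. (cmod (p x y))\<^sup>2))
    \<le> (cmod (integral {a'..a'+h} (\<lambda>y. integral {a..a+h} (\<lambda>x. p x y))))\<^sup>2 / h\<^sup>2
      + h\<^sup>2 * (integral {a'..a'+h} (\<lambda>y. integral {a..a+h} (\<lambda>x. (cmod (px x y))\<^sup>2))
          + integral {a'..a'+h} (\<lambda>y. integral {a..a+h} (\<lambda>x. (cmod (py x y))\<^sup>2)))"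
proof -
  have c2: "continuous_on UNIV (\<lambda>x. f (g x) (k x))"
    if "continuous_on UNIV (\<lambda>z. f (fst z) (snd z))" "continuous_on UNIV g" "continuous_on UNIV k"
    for f :: "real \<Rightarrow> real \<Rightarrow> complex" and g k :: "'c::topological_space \<Rightarrow> real"
    using continuous_on_compose2[OF that(1), of UNIV "\<lambda>x. (g x, k x)"] that(2,3)
    by (auto intro: continuous_intros)
  have int_c: "continuous_on UNIV (\<lambda>y. integral {a..a+h} (\<lambda>x. F (f x y)))"
    if "continuous_on UNIV (\<lambda>z. f (fst z) (snd z))" "continuous_on UNIV F"
    for f :: "real \<Rightarrow> real \<Rightarrow> complex" and F :: "complex \<Rightarrow> 'c::euclidean_space"
  proof -
    have "continuous_on (UNIV \<times> cbox a (a+h)) (\<lambda>(y, x). F (f x y))"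
      unfolding case_prod_unfold
      by (rule continuous_on_subset[OF continuous_on_compose2[OF that(2) c2[OF that(1)]]])
        (auto intro: continuous_intros)
    from integral_continuous_on_param[OF this] show ?thesis by simp
  qed
  have sqc: "continuous_on UNIV (\<lambda>z::complex. (cmod z)\<^sup>2)" by (intro continuous_intros)
  define A where "A y = integral {a..a+h} (\<lambda>x. p x y)" for y
  have Ac: "continuous_on UNIV A" unfolding A_def using int_c[OF c(1), of "\<lambda>z. z"] by auto
  define Ex where "Ex y = integral {a..a+h} (\<lambda>x. (cmod (px x y))\<^sup>2)" for y
  have Exc: "continuous_on UNIV Ex" unfolding Ex_def by (rule int_c[OF c(2) sqc])
  define E2 where "E2 = integral {a'..a'+h} (\<lambda>y. integral {a..a+h} (\<lambda>x. (cmod (py x y))\<^sup>2))"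
  \<comment> \<open>The oscillation estimate in y is made at fixed x and so yields the y integral
    inside; the order is exchanged to match the claim.\<close>
  have E2: "E2 = integral {a..a+h} (\<lambda>x. integral {a'..a'+h} (\<lambda>y. (cmod (py x y))\<^sup>2))"
  proof -
    have "continuous_on (cbox (a', a) (a'+h, a+h)) (\<lambda>(y, x). (cmod (py x y))\<^sup>2)"
      unfolding case_prod_unfold
      by (rule continuous_on_subset[OF continuous_on_compose2[OF sqc c2[OF c(3)]]])
        (auto intro: continuous_intros)
    from integral_swap_continuous[OF this] show ?thesis by (simp add: E2_def)
  qed
  have slice: "integral {a..a+h} (\<lambda>x. (cmod (p x y))\<^sup>2) \<le> (cmod (A y))\<^sup>2 / h + h\<^sup>2 * Ex y" for y
  proof -
    have "integral {a..a+h} (\<lambda>x. (cmod (p x y))\<^sup>2)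
       \<le> (cmod (integral {a..a+h} (\<lambda>x. p x y)))\<^sup>2 / (a+h-a) + (a+h-a) * ((a+h-a) * Ex y)"
    proof (rule integral_power2_le_oscillation)
      show "continuous_on {a..a+h} (\<lambda>x. p x y)"
        by (rule continuous_on_subset[OF c2[OF c(1)]]) (auto intro: continuous_intros)
      show "(cmod (p s y - p t y))\<^sup>2 \<le> (a+h-a) * Ex y" if "s \<in> {a..a+h}" "t \<in> {a..a+h}" for s t
        unfolding Ex_def
        by (rule oscillation_le_integral_derivative[OF px c2[OF c(2)] that]) (auto intro: continuous_intros)
    qed (use h in auto)
    then show ?thesis by (simp add: A_def power2_eq_square)
  qed
  have Aosc: "(cmod (A s - A t))\<^sup>2 \<le> h * (h * E2)" if st: "s \<in> {a'..a'+h}" "t \<in> {a'..a'+h}" for s t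
  proof -
    have pc: "continuous_on {a..a+h} (\<lambda>x. p x y)" for y
      by (rule continuous_on_subset[OF c2[OF c(1)]]) (auto intro: continuous_intros)
    have "A s - A t = integral {a..a+h} (\<lambda>x. p x s - p x t)"
      unfolding A_def
      by (rule Henstock_Kurzweil_Integration.integral_diff[symmetric]) (intro integrable_continuous_real pc)+
    then have "(cmod (A s - A t))\<^sup>2 \<le> (a+h-a) * integral {a..a+h} (\<lambda>x. (cmod (p x s - p x t))\<^sup>2)"
      using h by (simp only:) (intro norm_integral_Cauchy_Schwarz continuous_on_diff pc, simp)
    also have "\<dots> \<le> (a+h-a) * integral {a..a+h} (\<lambda>x. h * integral {a'..a'+h} (\<lambda>y. (cmod (py x y))\<^sup>2))"
    proof (intro mult_left_mono integral_le)
      show "(\<lambda>x. (cmod (p x s - p x t))\<^sup>2) integrable_on {a..a+h}"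
        by (intro integrable_continuous_real continuous_intros pc)
      have "continuous_on (UNIV \<times> cbox a' (a'+h)) (\<lambda>(x, y). (cmod (py x y))\<^sup>2)"
        unfolding case_prod_unfold
        by (rule continuous_on_subset[OF continuous_on_compose2[OF sqc c(3)]]) auto
      from integral_continuous_on_param[OF this]
      show "(\<lambda>x. h * integral {a'..a'+h} (\<lambda>y. (cmod (py x y))\<^sup>2)) integrable_on {a..a+h}"
        by (intro integrable_continuous_real continuous_intros) (auto intro: continuous_on_subset)
      show "(cmod (p x s - p x t))\<^sup>2 \<le> h * integral {a'..a'+h} (\<lambda>y. (cmod (py x y))\<^sup>2)" for x
        using oscillation_le_integral_derivative[OF py c2[OF c(3) continuous_on_const continuous_on_id] st]
        by simp
    qed (use h in auto)
    also have "\<dots> = h * (h * E2)" by (simp add: E2)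
    finally show ?thesis .
  qed
  have "integral {a'..a'+h} (\<lambda>y. (cmod (A y))\<^sup>2)
      \<le> (cmod (integral {a'..a'+h} A))\<^sup>2 / (a'+h-a') + (a'+h-a') * (h * (h * E2))"
    using h Aosc by (intro integral_power2_le_oscillation continuous_on_subset[OF Ac]) auto
  then have A2: "integral {a'..a'+h} (\<lambda>y. (cmod (A y))\<^sup>2) \<le> (cmod (integral {a'..a'+h} A))\<^sup>2 / h + h * (h * (h * E2))"
    by simp
  have iA: "(\<lambda>y. (cmod (A y))\<^sup>2 / h) integrable_on {a'..a'+h}" "(\<lambda>y. h\<^sup>2 * Ex y) integrable_on {a'..a'+h}"
    using h by (auto intro!: integrable_continuous_real continuous_intros continuous_on_subset[OF Ac]
        continuous_on_subset[OF Exc])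
  have "integral {a'..a'+h} (\<lambda>y. integral {a..a+h} (\<lambda>x. (cmod (p x y))\<^sup>2))
      \<le> integral {a'..a'+h} (\<lambda>y. (cmod (A y))\<^sup>2 / h + h\<^sup>2 * Ex y)"
    using slice iA int_c[OF c(1) sqc]
    by (intro integral_le integrable_add) (auto intro: integrable_continuous_real continuous_on_subset)
  also have "\<dots> = integral {a'..a'+h} (\<lambda>y. (cmod (A y))\<^sup>2) / h + h\<^sup>2 * integral {a'..a'+h} Ex"
    using iA by (simp add: Henstock_Kurzweil_Integration.integral_add)
  also have "\<dots> \<le> ((cmod (integral {a'..a'+h} A))\<^sup>2 / h + h * (h * (h * E2))) / h + h\<^sup>2 * integral {a'..a'+h} Ex"
    using A2 h by (intro add_right_mono divide_right_mono) auto
  also have "\<dots> = (cmod (integral {a'..a'+h} A))\<^sup>2 / h\<^sup>2 + h\<^sup>2 * (integral {a'..a'+h} Ex + E2)"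
    using h by (simp add: field_simps power2_eq_square)
  finally show ?thesis by (simp add: A_def[abs_def] Ex_def[abs_def] E2_def)
qed

text \<open>Lebesgue measure is determined by its values on boxes, and boxes correspond under the
  identification of the plane with pairs. This opens the way to iterated integrals.\<close>

lemma lborel_complex_eq_distr:
  "(lborel :: complex measure) = distr lborel borel (\<lambda>z::real \<times> real. Complex (fst z) (snd z))"
proof (rule lborel_eqI)
  have m: "(\<lambda>z::real \<times> real. Complex (fst z) (snd z)) \<in> borel_measurable lborel"
    by (auto simp: Complex_eq intro!: borel_measurable_continuous_onI continuous_intros)
  fix l u :: complex assume lu: "\<And>b. b \<in> Basis \<Longrightarrow> l \<bullet> b \<le> u \<bullet> b"
  have "(\<lambda>z::real \<times> real. Complex (fst z) (snd z)) -` box l u = box (Re l, Im l) (Re u, Im u)"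
    by (auto simp: box_def Basis_prod_def Basis_complex_def)
  then have "emeasure (distr lborel borel (\<lambda>z::real \<times> real. Complex (fst z) (snd z))) (box l u)
      = emeasure lborel (box (Re l, Im l) (Re u, Im u))"
    using m by (simp add: emeasure_distr)
  also have "\<dots> = ennreal (\<Prod>b\<in>Basis. (u - l) \<bullet> b)"
    using lu[of 1] lu[of \<i>]
    by (subst emeasure_lborel_box) (auto simp: Basis_prod_def Basis_complex_def prod.union_disjoint)
  finally show "emeasure (distr lborel borel (\<lambda>z::real \<times> real. Complex (fst z) (snd z))) (box l u)
      = ennreal (\<Prod>b\<in>Basis. (u - l) \<bullet> b)" .
qed simp

text \<open>The bridge from Lebesgue integrals over squares to iterated gauge integrals of
  continuous functions. The x integral stands inside, as in
  \<open>poincare_square_iterated\<close>.\<close>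

lemma lebesgue_on_square_eq_iterated:
  fixes F :: "complex \<Rightarrow> 'a::euclidean_space"
  assumes F: "continuous_on UNIV F"
  shows "(LINT z|lebesgue_on (cbox c (c + Complex h h)). F z)
    = integral {Im c..Im c + h} (\<lambda>y. integral {Re c..Re c + h} (\<lambda>x. F (Complex x y)))"
proof -
  let ?Q = "cbox c (c + Complex h h)" and ?R = "cbox (Re c, Im c) (Re c + h, Im c + h)"
  have Cc: "continuous_on UNIV (\<lambda>z::real \<times> real. Complex (fst z) (snd z))"
    by (auto simp: Complex_eq intro!: continuous_intros)
  have FC: "continuous_on UNIV (\<lambda>z. F (Complex (fst z) (snd z)))"
    by (rule continuous_on_compose2[OF F Cc]) auto
  have [measurable]: "F \<in> borel_measurable borel" using F by (rule borel_measurable_continuous_onI)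
  have [measurable]: "(\<lambda>z::real \<times> real. Complex (fst z) (snd z)) \<in> borel_measurable borel"
    using Cc by (rule borel_measurable_continuous_onI)
  have "(LINT z|lebesgue_on ?Q. F z) = (LINT z|lebesgue. indicator ?Q z *\<^sub>R F z)"
    by (intro integral_restrict_space) auto
  also have "\<dots> = (LINT z|lborel. indicator ?Q z *\<^sub>R F z)"
    by (intro integral_completion) measurable
  also have "\<dots> = (LINT z|lborel. indicator ?Q (Complex (fst z) (snd z)) *\<^sub>R F (Complex (fst z) (snd z)))"
    by (subst lborel_complex_eq_distr, subst integral_distr) (measurable, auto)
  also have "\<dots> = (LINT z|lborel. indicator ?R z *\<^sub>R F (Complex (fst z) (snd z)))"
    by (intro Bochner_Integration.integral_cong) (auto simp: indicator_def in_cbox_complex_iff cbox_Pair_eq mem_Times_iff)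
  also have "\<dots> = integral ?R (\<lambda>z. F (Complex (fst z) (snd z)))"
  proof -
    have "set_integrable lborel ?R (\<lambda>z. F (Complex (fst z) (snd z)))"
      unfolding set_integrable_def
      by (rule borel_integrable_compact) (auto intro: continuous_on_subset[OF FC])
    from set_borel_integral_eq_integral(2)[OF this] show ?thesis
      by (simp add: set_lebesgue_integral_def)
  qed
  also have "\<dots> = integral (cbox (Re c) (Re c + h)) (\<lambda>x. integral (cbox (Im c) (Im c + h)) (\<lambda>y. F (Complex x y)))"
    using integral_prod_continuous[OF continuous_on_subset[OF FC]] by simp
  also have "\<dots> = integral (cbox (Im c) (Im c + h)) (\<lambda>y. integral (cbox (Re c) (Re c + h)) (\<lambda>x. F (Complex x y)))"
    by (rule integral_swap_continuous)
      (use continuous_on_subset[OF FC] in \<open>simp add: case_prod_unfold\<close>)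
  finally show ?thesis by simp
qed

lemma poincare_square_smooth:
  fixes v :: "complex \<Rightarrow> complex"
  assumes v: "smooth_on UNIV v" and h: "h > 0"
  shows "(LINT z|lebesgue_on (cbox c (c + Complex h h)). (cmod (v z))\<^sup>2)
    \<le> (cmod (LINT z|lebesgue_on (cbox c (c + Complex h h)). v z))\<^sup>2 / h\<^sup>2
      + h\<^sup>2 * (\<Sum>b\<in>Basis. LINT z|lebesgue_on (cbox c (c + Complex h h)). (cmod (frechet_derivative v (at z) b))\<^sup>2)"
proof -
  let ?D = "\<lambda>z. frechet_derivative v (at z)"
  have vc: "continuous_on UNIV v" using v by (rule smooth_on_imp_continuous_on)
  have Dc: "continuous_on UNIV (\<lambda>z. ?D z b)" if "b \<in> Basis" for b
    using smooth_on_imp_continuous_on[OF smooth_on_frechet_derivative[OF v that]] .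
  have vd: "(v has_derivative ?D z) (at z)" for z using smooth_on_has_derivative[OF open_UNIV v] by simp
  have lin: "?D z (t *\<^sub>R b) = t *\<^sub>R ?D z b" for z b t
    using linear_simps(5)[OF has_derivative_bounded_linear[OF vd]] .
  have dx: "((\<lambda>x. v (Complex x y)) has_vector_derivative ?D (Complex x y) 1) (at x)" for x y
  proof -
    have "((\<lambda>x. Complex x y) has_derivative (\<lambda>t. t *\<^sub>R 1)) (at x)"
      unfolding Complex_eq by (auto intro!: derivative_eq_intros simp: scaleR_conv_of_real)
    from has_derivative_compose[OF this vd] show ?thesis
      unfolding lin has_vector_derivative_def .
  qed
  have dy: "((\<lambda>y. v (Complex x y)) has_vector_derivative ?D (Complex x y) \<i>) (at y)" for x y
  proof -
    have "((\<lambda>y. Complex x y) has_derivative (\<lambda>t. t *\<^sub>R \<i>)) (at y)"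
      unfolding Complex_eq by (auto intro!: derivative_eq_intros simp: scaleR_conv_of_real)
    from has_derivative_compose[OF this vd] show ?thesis
      unfolding lin has_vector_derivative_def .
  qed
  have Cc: "continuous_on UNIV (\<lambda>z. F (Complex (fst z) (snd z)))" if "continuous_on UNIV F"
    for F :: "complex \<Rightarrow> complex"
    by (rule continuous_on_compose2[OF that]) (auto simp: Complex_eq intro!: continuous_intros)
  have Ic: "continuous_on UNIV (\<lambda>z. (cmod (F z))\<^sup>2)" if "continuous_on UNIV F" for F :: "complex \<Rightarrow> complex"
    using that by (intro continuous_intros)
  show ?thesis
    using poincare_square_iterated[OF h, of "\<lambda>x y. v (Complex x y)" "\<lambda>x y. ?D (Complex x y) 1"
        "\<lambda>x y. ?D (Complex x y) \<i>" "Im c" "Re c", OF dx dy Cc[OF vc] Cc[OF Dc] Cc[OF Dc]]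
    by (simp add: lebesgue_on_square_eq_iterated vc Dc Ic Basis_complex_def)
qed

section \<open>Compactness\<close>

lemma lebesgue_on_subset_integrable:
  fixes f :: "'a::euclidean_space \<Rightarrow> 'b::{banach, second_countable_topology}"
  assumes "integrable (lebesgue_on S) f" "T \<subseteq> S" "S \<in> sets lebesgue" "T \<in> sets lebesgue"
  shows "integrable (lebesgue_on T) f"
proof -
  have "integrable lebesgue (\<lambda>x. indicator S x *\<^sub>R f x)"
    using assms(1,3) by (simp add: integrable_restrict_space)
  then have "integrable lebesgue (\<lambda>x. indicator T x *\<^sub>R (indicator S x *\<^sub>R f x))"
    by (rule integrable_mult_indicator[OF assms(4)])
  also have "(\<lambda>x. indicator T x *\<^sub>R (indicator S x *\<^sub>R f x)) = (\<lambda>x. indicator T x *\<^sub>R f x)"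
    using assms(2) by (auto simp: fun_eq_iff split: split_indicator)
  finally show ?thesis using assms(4) by (simp add: integrable_restrict_space)
qed

lemma square_integrable_lebesgue_on_subset:
  assumes "square_integrable (lebesgue_on S) f" "T \<subseteq> S" "S \<in> sets lebesgue" "T \<in> sets lebesgue"
  shows "square_integrable (lebesgue_on T) f"
  using assms lebesgue_on_subset_integrable[of S "\<lambda>x. (cmod (f x))\<^sup>2" T]
  by (auto simp: square_integrable_def intro: measurable_restrict_mono)

lemma lebesgue_on_integral_subset_le:
  fixes f :: "'a::euclidean_space \<Rightarrow> real"
  assumes "integrable (lebesgue_on S) f" "T \<subseteq> S" "S \<in> sets lebesgue" "T \<in> sets lebesgue" "\<And>x. 0 \<le> f x"
  shows "(LINT x|lebesgue_on T. f x) \<le> (LINT x|lebesgue_on S. f x)"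
  using assms lebesgue_on_subset_integrable[OF assms(1-4)]
  by (auto simp: integral_restrict_space integrable_restrict_space indicator_def intro!: integral_mono)

lemma lebesgue_on_integral_split:
  fixes f :: "'a::euclidean_space \<Rightarrow> real"
  assumes "integrable (lebesgue_on S) f" "T \<subseteq> S" "S \<in> sets lebesgue" "T \<in> sets lebesgue"
  shows "(LINT x|lebesgue_on S. f x) = (LINT x|lebesgue_on T. f x) + (LINT x|lebesgue_on (S - T). f x)"
proof -
  have i: "integrable lebesgue (\<lambda>x. indicator T x *\<^sub>R f x)" "integrable lebesgue (\<lambda>x. indicator (S - T) x *\<^sub>R f x)"
    using lebesgue_on_subset_integrable[OF assms] lebesgue_on_subset_integrable[OF assms(1), of "S - T"] assms
    by (auto simp: integrable_restrict_space)
  have "(LINT x|lebesgue_on S. f x) = (LINT x|lebesgue. indicator T x *\<^sub>R f x + indicator (S - T) x *\<^sub>R f x)"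
    using assms by (subst integral_restrict_space) (auto simp: indicator_def intro!: Bochner_Integration.integral_cong)
  also have "\<dots> = (LINT x|lebesgue. indicator T x *\<^sub>R f x) + (LINT x|lebesgue. indicator (S - T) x *\<^sub>R f x)"
    using i by (rule Bochner_Integration.integral_add)
  finally show ?thesis using assms by (simp add: integral_restrict_space)
qed

lemma integral_norm_power2_triangle:
  assumes "square_integrable M f" "square_integrable M g"
  shows "L2sq M f \<le> 2 * L2sq M g + 2 * L2sq M (\<lambda>x. f x - g x)"
proof -
  have i: "integrable M (\<lambda>x. (cmod (f x))\<^sup>2)" "integrable M (\<lambda>x. (cmod (g x))\<^sup>2)"
    "integrable M (\<lambda>x. (cmod (f x - g x))\<^sup>2)"
    using assms square_integrable_diff[OF assms] by (auto simp: square_integrable_def)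
  have "L2sq M f \<le> (LINT x|M. 2 * (cmod (g x))\<^sup>2 + 2 * (cmod (f x - g x))\<^sup>2)"
  proof (rule integral_mono)
    show "(cmod (f x))\<^sup>2 \<le> 2 * (cmod (g x))\<^sup>2 + 2 * (cmod (f x - g x))\<^sup>2" for x
      using norm_add_power2_le[of "g x" "f x - g x"] by simp
  qed (use i in auto)
  also have "\<dots> = 2 * L2sq M g + 2 * L2sq M (\<lambda>x. f x - g x)"
    using i by simp
  finally show ?thesis .
qed

lemma measure_square: "h \<ge> 0 \<Longrightarrow> measure lebesgue (cbox c (c + Complex h h)) = h\<^sup>2"
  by (simp add: content_cbox Basis_complex_def power2_eq_square)

text \<open>The part of having a trace that survives in differences: elements of
  \<open>H1_bc\<close> have it by the definition of a trace, and it is what transfers the Poincare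
  inequality from smooth functions.\<close>

definition smoothly_approximable :: "complex set \<Rightarrow> (complex \<Rightarrow> complex) \<Rightarrow> bool" where
  "smoothly_approximable \<Omega> u \<longleftrightarrow> u \<in> H1 \<Omega> \<and>
     (\<forall>e>0. \<exists>\<phi>. smooth_on UNIV \<phi> \<and> (H1_norm \<Omega> (\<lambda>x. \<phi> x - u x))\<^sup>2 < e)"

lemma H1_bc_smoothly_approximable:
  assumes "u \<in> H1_bc \<Omega> g"
  shows "smoothly_approximable \<Omega> u"
  unfolding smoothly_approximable_def
proof (intro conjI allI impI)
  show "u \<in> H1 \<Omega>" using assms by (simp add: H1_bc_def)
  fix e :: real assume "e > 0"
  obtain \<phi> where \<phi>: "\<And>k. smooth_on UNIV (\<phi> k)" "(\<lambda>k. H1_norm \<Omega> (\<lambda>x. \<phi> k x - u x)) \<longlonglongrightarrow> 0"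
    using assms unfolding H1_bc_def has_trace_def by blast
  from order_tendstoD(2)[OF iffD1[OF H1_norm_tendsto_0_iff \<phi>(2)] \<open>e > 0\<close>]
  obtain k where "(H1_norm \<Omega> (\<lambda>x. \<phi> k x - u x))\<^sup>2 < e"
    by (auto simp: eventually_sequentially)
  then show "\<exists>\<phi>. smooth_on UNIV \<phi> \<and> (H1_norm \<Omega> (\<lambda>x. \<phi> x - u x))\<^sup>2 < e" using \<phi>(1) by blast
qed

section \<open>Rellich compactness by local averages\<close>

context bounded_open
begin

lemma smoothly_approximable_diff:
  assumes "smoothly_approximable \<Omega> u" "smoothly_approximable \<Omega> w"
  shows "smoothly_approximable \<Omega> (\<lambda>x. u x - w x)"
  unfolding smoothly_approximable_def
proof (intro conjI allI impI)
  have H: "u \<in> H1 \<Omega>" "w \<in> H1 \<Omega>" using assms by (auto simp: smoothly_approximable_def)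
  then show "(\<lambda>x. u x - w x) \<in> H1 \<Omega>" by (rule H1_diff)
  fix e :: real assume "e > 0"
  then have "e / 4 > 0" by simp
  then obtain \<phi> \<psi> where \<phi>: "smooth_on UNIV \<phi>" "(H1_norm \<Omega> (\<lambda>x. \<phi> x - u x))\<^sup>2 < e / 4"
    and \<psi>: "smooth_on UNIV \<psi>" "(H1_norm \<Omega> (\<lambda>x. \<psi> x - w x))\<^sup>2 < e / 4"
    using assms unfolding smoothly_approximable_def by meson
  have "(H1_norm \<Omega> (\<lambda>x. (\<phi> x - u x) - (\<psi> x - w x)))\<^sup>2 < e"
    using H1_norm_diff_le[OF H1_diff[OF smooth_H1[OF \<phi>(1)] H(1)] H1_diff[OF smooth_H1[OF \<psi>(1)] H(2)]] \<phi>(2) \<psi>(2)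
    by simp
  moreover have "(\<lambda>x. (\<phi> x - u x) - (\<psi> x - w x)) = (\<lambda>x. (\<phi> x - \<psi> x) - (u x - w x))"
    by (simp add: algebra_simps)
  ultimately have "(H1_norm \<Omega> (\<lambda>x. (\<phi> x - \<psi> x) - (u x - w x)))\<^sup>2 < e" by simp
  then show "\<exists>\<phi>. smooth_on UNIV \<phi> \<and> (H1_norm \<Omega> (\<lambda>x. \<phi> x - (u x - w x)))\<^sup>2 < e"
    by (intro exI[of _ "\<lambda>x. \<phi> x - \<psi> x"] conjI smooth_on_diff[OF open_UNIV \<phi>(1) \<psi>(1)])
qed

text \<open>Replace \<open>u\<close> by a smooth \<open>\<phi>\<close>, apply the smooth inequality
  and return to \<open>u\<close>; each of the two passages costs a factor 2, hence the constants
  4.\<close>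

lemma poincare_square:
  assumes u: "smoothly_approximable \<Omega> u" and V: "has_weak_gradient \<Omega> u V"
    and h: "h > 0" and K: "K = cbox c (c + Complex h h)" "K \<subseteq> \<Omega>"
  shows "L2sq (lebesgue_on K) u \<le> 4 * ((cmod (LINT x|lebesgue_on K. u x))\<^sup>2 / h\<^sup>2)
    + 4 * h\<^sup>2 * (\<Sum>b\<in>Basis. L2sq (lebesgue_on K) (V b))"
proof (rule field_le_epsilon)
  fix \<epsilon> :: real assume "\<epsilon> > 0"
  \<comment> \<open>The accumulated errors are 2e from returning to \<open>u\<close>, 4e from the
    mean and 4 h^2 e from the gradient.\<close>
  define e where "e = \<epsilon> / (6 + 4 * h\<^sup>2)"
  have den: "6 + 4 * h\<^sup>2 > 0" using zero_le_power2[of h] by linarith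
  then have e: "e > 0" "(6 + 4 * h\<^sup>2) * e = \<epsilon>" using \<open>\<epsilon> > 0\<close> by (simp_all add: e_def)
  obtain \<phi> where \<phi>: "smooth_on UNIV \<phi>" "(H1_norm \<Omega> (\<lambda>x. \<phi> x - u x))\<^sup>2 < e"
    using u e(1) unfolding smoothly_approximable_def by meson
  let ?D = "\<lambda>b x. frechet_derivative \<phi> (at x) b"
  have K_sets: "K \<in> sets lebesgue" by (simp add: K(1))
  interpret MK: finite_measure "lebesgue_on K"
    by (rule finite_measure_lebesgue_on) (simp add: K(1))
  note sub = square_integrable_lebesgue_on_subset[OF _ K(2) sets_\<Omega> K_sets]
  note le = lebesgue_on_integral_subset_le[OF square_integrable_integrable K(2) sets_\<Omega> K_sets zero_le_power2]
  have D: "has_weak_gradient \<Omega> \<phi> ?D" using \<phi>(1) by (rule weak_gradient_smooth)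
  have sq: "square_integrable \<mu> u" "square_integrable \<mu> \<phi>"
    "\<And>b. b \<in> Basis \<Longrightarrow> square_integrable \<mu> (V b)"
    "\<And>b. b \<in> Basis \<Longrightarrow> square_integrable \<mu> (?D b)"
    using V D by (auto simp: has_weak_gradient_def)
  have dg: "has_weak_gradient \<Omega> (\<lambda>x. \<phi> x - u x) (\<lambda>b x. ?D b x - V b x)"
    using weak_gradient_linear[OF D V, of 1 "-1"] by simp
  have small: "L2sq \<mu> (\<lambda>x. \<phi> x - u x)
      + (\<Sum>b\<in>Basis. L2sq \<mu> (\<lambda>x. ?D b x - V b x)) < e"
    using \<phi>(2) by (simp add: H1_norm_power2 dirichlet_energy_eq[OF dg])
  have nn: "0 \<le> L2sq \<mu> (\<lambda>x. \<phi> x - u x)"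
    "0 \<le> (\<Sum>b\<in>Basis. L2sq \<mu> (\<lambda>x. ?D b x - V b x))"
    by (auto intro!: sum_nonneg integral_nonneg_AE)
  have dK: "L2sq (lebesgue_on K) (\<lambda>x. \<phi> x - u x) \<le> e"
    using le[OF square_integrable_diff[OF sq(2,1)]] small nn by linarith
  have "(\<Sum>b\<in>Basis. L2sq (lebesgue_on K) (\<lambda>x. ?D b x - V b x))
      \<le> (\<Sum>b\<in>Basis. L2sq \<mu> (\<lambda>x. ?D b x - V b x))"
    by (intro sum_mono le square_integrable_diff sq)
  then have DK: "(\<Sum>b\<in>Basis. L2sq (lebesgue_on K) (\<lambda>x. ?D b x - V b x)) \<le> e"
    using small nn by linarith
  have 1: "L2sq (lebesgue_on K) u \<le> 2 * L2sq (lebesgue_on K) \<phi> + 2 * e"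
    using integral_norm_power2_triangle[OF sub[OF sq(1)] sub[OF sq(2)]] dK by (simp add: norm_minus_commute)
  have 2: "(cmod (LINT x|lebesgue_on K. \<phi> x))\<^sup>2 / h\<^sup>2 \<le> 2 * ((cmod (LINT x|lebesgue_on K. u x))\<^sup>2 / h\<^sup>2) + 2 * e"
  proof -
    have "(cmod (LINT x|lebesgue_on K. \<phi> x - u x))\<^sup>2 \<le> h\<^sup>2 * L2sq (lebesgue_on K) (\<lambda>x. \<phi> x - u x)"
      using MK.norm_integral_power2_le[OF sub[OF square_integrable_diff[OF sq(2,1)]]] h
      by (simp add: measure_restrict_space space_restrict_space K(1) measure_square del: measure_completion)
    also have "\<dots> \<le> h\<^sup>2 * e" using dK by (intro mult_left_mono) auto
    finally have "(cmod (LINT x|lebesgue_on K. \<phi> x - u x))\<^sup>2 \<le> h\<^sup>2 * e" .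
    moreover have "(LINT x|lebesgue_on K. \<phi> x)
        = (LINT x|lebesgue_on K. u x) + (LINT x|lebesgue_on K. \<phi> x - u x)"
      using MK.square_integrable_imp_integrable[OF sub[OF sq(1)]]
        MK.square_integrable_imp_integrable[OF sub[OF sq(2)]] by simp
    ultimately have "(cmod (LINT x|lebesgue_on K. \<phi> x))\<^sup>2 \<le> 2 * (cmod (LINT x|lebesgue_on K. u x))\<^sup>2 + 2 * (h\<^sup>2 * e)"
      using norm_add_power2_le[of "LINT x|lebesgue_on K. u x" "LINT x|lebesgue_on K. \<phi> x - u x"] by simp
    then have "(cmod (LINT x|lebesgue_on K. \<phi> x))\<^sup>2 / h\<^sup>2
        \<le> (2 * (cmod (LINT x|lebesgue_on K. u x))\<^sup>2 + 2 * (h\<^sup>2 * e)) / h\<^sup>2"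
      by (intro divide_right_mono) auto
    then show ?thesis using h by (simp add: add_divide_distrib)
  qed
  have "(\<Sum>b\<in>Basis. L2sq (lebesgue_on K) (?D b))
     \<le> (\<Sum>b\<in>Basis. 2 * L2sq (lebesgue_on K) (V b) + 2 * L2sq (lebesgue_on K) (\<lambda>x. ?D b x - V b x))"
    by (intro sum_mono integral_norm_power2_triangle sub sq)
  also have "\<dots> \<le> 2 * (\<Sum>b\<in>Basis. L2sq (lebesgue_on K) (V b)) + 2 * e"
    using DK by (simp add: sum.distrib flip: sum_distrib_left)
  finally have 3: "h\<^sup>2 * (\<Sum>b\<in>Basis. L2sq (lebesgue_on K) (?D b))
      \<le> h\<^sup>2 * (2 * (\<Sum>b\<in>Basis. L2sq (lebesgue_on K) (V b)) + 2 * e)"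
    by (intro mult_left_mono) auto
  have 4: "L2sq (lebesgue_on K) \<phi> \<le> (cmod (LINT x|lebesgue_on K. \<phi> x))\<^sup>2 / h\<^sup>2
      + h\<^sup>2 * (\<Sum>b\<in>Basis. L2sq (lebesgue_on K) (?D b))"
    unfolding K(1) by (rule poincare_square_smooth[OF \<phi>(1) h])
  define X where "X = (cmod (LINT x|lebesgue_on K. u x))\<^sup>2 / h\<^sup>2"
  define Y where "Y = (\<Sum>b\<in>Basis. L2sq (lebesgue_on K) (V b))"
  have "L2sq (lebesgue_on K) u \<le> 2 * ((2 * X + 2 * e) + h\<^sup>2 * (2 * Y + 2 * e)) + 2 * e"
    unfolding X_def Y_def
    by (intro order_trans[OF 1] add_right_mono mult_left_mono order_trans[OF 4 add_mono[OF 2 3]]) simp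
  also have "\<dots> = 4 * X + 4 * h\<^sup>2 * Y + (6 + 4 * h\<^sup>2) * e"
    by (simp add: algebra_simps)
  finally show "L2sq (lebesgue_on K) u \<le> 4 * ((cmod (LINT x|lebesgue_on K. u x))\<^sup>2 / h\<^sup>2)
      + 4 * h\<^sup>2 * (\<Sum>b\<in>Basis. L2sq (lebesgue_on K) (V b)) + \<epsilon>"
    unfolding e(2) X_def Y_def .
qed

text \<open>\<open>covering_lemma\<close> fills the domain with countably many dyadic squares with
  disjoint interiors, and a gauge keeps them small and inside. By continuity of measure, finitely
  many of them miss less than \<epsilon>.\<close>

lemma exists_square_cover:
  assumes "\<delta> > 0" "\<epsilon> > 0"
  obtains F where "finite F" "\<And>K. K \<in> F \<Longrightarrow> K \<subseteq> \<Omega> \<and> (\<exists>c h. 0 < h \<and> h \<le> \<delta> \<and> K = cbox c (c + Complex h h))"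
    "pairwise (\<lambda>K K'. negligible (K \<inter> K')) F" "measure lebesgue (\<Omega> - \<Union>F) < \<epsilon>"
proof (cases "\<Omega> = {}")
  case True
  then show ?thesis using that[of "{}"] assms(2) by simp
next
  case False
  obtain R where R: "R > 0" "\<And>x. x \<in> \<Omega> \<Longrightarrow> cmod x \<le> R"
    using bounded_\<Omega> by (auto simp: bounded_pos)
  \<comment> \<open>The bounding box is itself a square, so its dyadic subdivisions are squares as
    well.\<close>
  define a b where "a = Complex (-R) (-R)" and "b = Complex R R"
  have sub: "\<Omega> \<subseteq> cbox a b"
  proof
    fix x assume "x \<in> \<Omega>"
    then have "\<bar>Re x\<bar> \<le> R" "\<bar>Im x\<bar> \<le> R"
      using R(2) abs_Re_le_cmod[of x] abs_Im_le_cmod[of x] by (meson order_trans)+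
    then show "x \<in> cbox a b" by (auto simp: a_def b_def in_cbox_complex_iff)
  qed
  have ne: "box a b \<noteq> {}" using R(1) by (auto simp: a_def b_def box_ne_empty Basis_complex_def)
  have "\<exists>r>0. ball x r \<subseteq> \<Omega>" if "x \<in> \<Omega>" for x using that open_\<Omega> by (meson openE)
  then obtain r where r: "\<And>x. x \<in> \<Omega> \<Longrightarrow> r x > 0" "\<And>x. x \<in> \<Omega> \<Longrightarrow> ball x (r x) \<subseteq> \<Omega>" by metis
  \<comment> \<open>The radius r keeps the pieces inside the domain, the radius \<delta>/2 bounds
    their size. The value 1 off the domain only completes the gauge.\<close>
  define g where "g x = ball x (if x \<in> \<Omega> then min (r x) (\<delta> / 2) else 1)" for x
  have "gauge g" unfolding gauge_def g_def using r(1) assms(1) by auto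
  from covering_lemma[OF sub ne this]
  obtain D where D: "countable D" "\<And>K. K \<in> D \<Longrightarrow> interior K \<noteq> {} \<and> (\<exists>c d. K = cbox c d)"
    "pairwise (\<lambda>A B. interior A \<inter> interior B = {}) D"
    "\<And>K. K \<in> D \<Longrightarrow> \<exists>x \<in> \<Omega> \<inter> K. K \<subseteq> g x"
    "\<And>u v. cbox u v \<in> D \<Longrightarrow> \<exists>n. \<forall>i \<in> Basis. v \<bullet> i - u \<bullet> i = (b \<bullet> i - a \<bullet> i) / 2^n"
    "\<Omega> \<subseteq> \<Union>D" by metis
  have sq: "K \<subseteq> \<Omega> \<and> (\<exists>c h. 0 < h \<and> h \<le> \<delta> \<and> K = cbox c (c + Complex h h))" if K: "K \<in> D" for K
  proof -
    obtain x where x: "x \<in> \<Omega>" "K \<subseteq> g x" using D(4)[OF K] by blast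
    have "g x \<subseteq> ball x (r x)" "g x \<subseteq> ball x (\<delta> / 2)" using x(1) by (auto simp: g_def)
    then have KO: "K \<subseteq> \<Omega>" and K\<delta>: "K \<subseteq> ball x (\<delta> / 2)" using x r(2) by blast+
    obtain c d where cd: "K = cbox c d" using D(2)[OF K] by blast
    obtain n :: nat where n: "\<forall>i \<in> Basis. d \<bullet> i - c \<bullet> i = (b \<bullet> i - a \<bullet> i) / 2^n"
      using D(5)[of c d] K cd by blast
    define h where "h = 2 * R / 2 ^ n"
    have h: "h > 0" using R(1) by (simp add: h_def)
    have d: "d = c + Complex h h"
      using n by (auto simp: complex_eq_iff Basis_complex_def a_def b_def h_def algebra_simps)
    \<comment> \<open>Two adjacent corners lie in a common ball of radius \<delta>/2, so the side h
      is at most \<delta>.\<close>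
    have "c \<in> K" "c + Complex h 0 \<in> K" using h by (auto simp: cd d in_cbox_complex_iff)
    then have "dist x c < \<delta> / 2" "dist x (c + Complex h 0) < \<delta> / 2" using K\<delta> by auto
    moreover have "dist c (c + Complex h 0) \<le> dist x c + dist x (c + Complex h 0)"
      by (rule dist_triangle3)
    moreover have "dist c (c + Complex h 0) = h" using h by (simp add: dist_norm cmod_def)
    ultimately have "h \<le> \<delta>" by simp
    then show ?thesis using KO h cd d by blast
  qed
  have U: "\<Union>D = \<Omega>" using sq D(6) by blast
  have Dne: "D \<noteq> {}" using U False by auto
  \<comment> \<open>If \<open>D\<close> is finite this enumeration repeats squares, which is
    harmless since only the image and unions of initial segments are used.\<close>
  define e where "e = from_nat_into D"
  have eD: "range e = D" unfolding e_def by (rule range_from_nat_into[OF Dne D(1)])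
  define A where "A i = (\<Union>k<i. e k)" for i :: nat
  have e_sets: "e k \<in> lmeasurable" for k
    using sq[of "e k"] eD by (metis lmeasurable_cbox rangeI)
  have A_meas: "A i \<in> lmeasurable" for i unfolding A_def by (intro fmeasurable.finite_UN) (auto simp: e_sets)
  have UA: "(\<Union>i. A i) = \<Omega>"
  proof -
    have "(\<Union>i. A i) = (\<Union>k. e k)" unfolding A_def by (auto intro: lessI)
    then show ?thesis using eD U by simp
  qed
  have "(\<lambda>i. measure lebesgue (A i)) \<longlonglongrightarrow> measure lebesgue (\<Union>i. A i)"
  proof (rule Lim_measure_incseq)
    show "range A \<subseteq> sets lebesgue" using A_meas by (auto intro: fmeasurableD)
    show "incseq A" unfolding A_def by (rule monoI) (auto intro: less_le_trans)
    show "emeasure lebesgue (\<Union>i. A i) \<noteq> \<infinity>"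
      unfolding UA using fmeasurableD2[OF lmeasurable_\<Omega>] by simp
  qed
  from order_tendstoD(1)[OF this, of "measure lebesgue \<Omega> - \<epsilon>"]
  obtain i where i: "measure lebesgue \<Omega> - \<epsilon> < measure lebesgue (A i)"
    using assms(2) unfolding UA by (auto simp: eventually_sequentially)
  show ?thesis
  proof (rule that[of "e ` {..<i}"])
    show "K \<subseteq> \<Omega> \<and> (\<exists>c h. 0 < h \<and> h \<le> \<delta> \<and> K = cbox c (c + Complex h h))" if "K \<in> e ` {..<i}" for K
      using that eD by (intro sq) auto
    show "pairwise (\<lambda>K K'. negligible (K \<inter> K')) (e ` {..<i})"
    proof (rule pairwiseI)
      fix K K' assume "K \<in> e ` {..<i}" "K' \<in> e ` {..<i}" "K \<noteq> K'"
      then have KK: "K \<in> D" "K' \<in> D" "K \<noteq> K'" using eD by auto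
      then have "interior (K \<inter> K') = {}" using D(3) by (auto simp: pairwise_def)
      moreover have "convex (K \<inter> K')" using D(2)[OF KK(1)] D(2)[OF KK(2)] by (auto intro: convex_Int)
      ultimately show "negligible (K \<inter> K')" by (simp add: negligible_convex_interior)
    qed
    have "A i \<subseteq> \<Omega>" using UA by blast
    then have "measure lebesgue (\<Omega> - A i) = measure lebesgue \<Omega> - measure lebesgue (A i)"
      by (rule measurable_measure_Diff[OF lmeasurable_\<Omega> fmeasurableD[OF A_meas]])
    then show "measure lebesgue (\<Omega> - \<Union> (e ` {..<i})) < \<epsilon>"
      using i by (simp add: A_def)
  qed auto
qed

text \<open>Poincare on every square and the bound \<open>B\<close> on the remainder. Apart from
  finitely many integrals over squares, the right-hand side is small for fine covers; finitely many
  integrals can be made to converge.\<close>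

lemma square_cover_estimate:
  assumes u: "smoothly_approximable \<Omega> u" and B: "AE x in \<mu>. cmod (u x) \<le> B"
    and F: "finite F" "\<And>K. K \<in> F \<Longrightarrow> K \<subseteq> \<Omega> \<and> (\<exists>c h. 0 < h \<and> h \<le> \<delta> \<and> K = cbox c (c + Complex h h))"
      "pairwise (\<lambda>K K'. negligible (K \<inter> K')) F"
  shows "L2sq \<mu> u
    \<le> (\<Sum>K\<in>F. 4 / measure lebesgue K * (cmod (LINT x|lebesgue_on K. u x))\<^sup>2)
      + 4 * \<delta>\<^sup>2 * dirichlet_energy \<Omega> u + B\<^sup>2 * measure lebesgue (\<Omega> - \<Union>F)"
proof -
  have uH: "u \<in> H1 \<Omega>" using u by (simp add: smoothly_approximable_def)
  then obtain V where V: "has_weak_gradient \<Omega> u V" by (auto simp: H1_iff_weak_gradient)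
  have sq: "square_integrable \<mu> u" "\<And>b. b \<in> Basis \<Longrightarrow> square_integrable \<mu> (V b)"
    using V by (auto simp: has_weak_gradient_def)
  have K_sets: "K \<in> sets lebesgue" if "K \<in> F" for K using F(2)[OF that] by auto
  have UF: "\<Union>F \<in> sets lebesgue" "\<Union>F \<subseteq> \<Omega>" using F(1,2) K_sets by (blast intro: sets.finite_Union)+
  \<comment> \<open>Overlaps of different squares are negligible, so the integrals add up.\<close>
  have union: "(\<Sum>K\<in>F. LINT x|lebesgue_on K. f x) = (LINT x|lebesgue_on (\<Union>F). f x)"
    if f: "integrable \<mu> f" for f :: "complex \<Rightarrow> real"
  proof -
    have "(f has_integral (\<Sum>K\<in>F. LINT x|lebesgue_on K. f x)) (\<Union>F)"
      using F K_sets lebesgue_on_subset_integrable[OF f _ sets_\<Omega>]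
      by (intro has_integral_Union has_integral_integral_lebesgue_on) auto
    moreover have "(f has_integral (LINT x|lebesgue_on (\<Union>F). f x)) (\<Union>F)"
      using UF by (intro has_integral_integral_lebesgue_on lebesgue_on_subset_integrable[OF f _ sets_\<Omega>]) auto
    ultimately show ?thesis by (rule has_integral_unique)
  qed
  have Kest: "L2sq (lebesgue_on K) u
     \<le> 4 / measure lebesgue K * (cmod (LINT x|lebesgue_on K. u x))\<^sup>2
       + 4 * \<delta>\<^sup>2 * (\<Sum>b\<in>Basis. L2sq (lebesgue_on K) (V b))" if K: "K \<in> F" for K
  proof -
    obtain c h where ch: "K \<subseteq> \<Omega>" "0 < h" "h \<le> \<delta>" "K = cbox c (c + Complex h h)"
      using F(2)[OF K] by blast
    have "measure lebesgue K = h\<^sup>2" unfolding ch(4) using ch(2) by (intro measure_square) simp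
    moreover have "4 * h\<^sup>2 * (\<Sum>b\<in>Basis. L2sq (lebesgue_on K) (V b))
        \<le> 4 * \<delta>\<^sup>2 * (\<Sum>b\<in>Basis. L2sq (lebesgue_on K) (V b))"
      using ch(2,3) by (intro mult_right_mono sum_nonneg integral_nonneg_AE) (auto intro: power_mono)
    ultimately show ?thesis using poincare_square[OF u V ch(2,4,1)] by simp
  qed
  have "L2sq (lebesgue_on (\<Union>F)) u = (\<Sum>K\<in>F. L2sq (lebesgue_on K) u)"
    using sq(1) by (intro union[symmetric] square_integrable_integrable)
  also have "\<dots> \<le> (\<Sum>K\<in>F. 4 / measure lebesgue K * (cmod (LINT x|lebesgue_on K. u x))\<^sup>2
       + 4 * \<delta>\<^sup>2 * (\<Sum>b\<in>Basis. L2sq (lebesgue_on K) (V b)))"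
    by (intro sum_mono Kest)
  also have "\<dots> = (\<Sum>K\<in>F. 4 / measure lebesgue K * (cmod (LINT x|lebesgue_on K. u x))\<^sup>2)
       + 4 * \<delta>\<^sup>2 * (\<Sum>b\<in>Basis. \<Sum>K\<in>F. L2sq (lebesgue_on K) (V b))"
    by (simp add: sum.distrib sum_distrib_left sum.swap[of _ F])
  also have "(\<Sum>b\<in>Basis. \<Sum>K\<in>F. L2sq (lebesgue_on K) (V b))
      = (\<Sum>b\<in>Basis. L2sq (lebesgue_on (\<Union>F)) (V b))"
    using sq(2) by (intro sum.cong refl union square_integrable_integrable)
  also have "\<dots> \<le> dirichlet_energy \<Omega> u"
    unfolding dirichlet_energy_eq[OF V] using UF sq(2)
    by (intro sum_mono lebesgue_on_integral_subset_le square_integrable_integrable sets_\<Omega>) auto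
  finally have 1: "L2sq (lebesgue_on (\<Union>F)) u
      \<le> (\<Sum>K\<in>F. 4 / measure lebesgue K * (cmod (LINT x|lebesgue_on K. u x))\<^sup>2) + 4 * \<delta>\<^sup>2 * dirichlet_energy \<Omega> u"
    by (simp add: mult_left_mono)
  have 2: "L2sq (lebesgue_on (\<Omega> - \<Union>F)) u \<le> B\<^sup>2 * measure lebesgue (\<Omega> - \<Union>F)"
  proof -
    have L: "\<Omega> - \<Union>F \<in> lmeasurable" using lmeasurable_\<Omega> UF(1) by (rule fmeasurable_Diff)
    interpret MD: finite_measure "lebesgue_on (\<Omega> - \<Union>F)" by (rule finite_measure_lebesgue_on[OF L])
    have "AE x in lebesgue_on (\<Omega> - \<Union>F). (cmod (u x))\<^sup>2 \<le> B\<^sup>2"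
      using B sets_\<Omega> L by (auto simp: AE_restrict_space_iff fmeasurableD power_mono)
    then have "L2sq (lebesgue_on (\<Omega> - \<Union>F)) u \<le> (LINT x|lebesgue_on (\<Omega> - \<Union>F). B\<^sup>2)"
      using square_integrable_integrable[OF square_integrable_lebesgue_on_subset[OF sq(1) _ sets_\<Omega> fmeasurableD[OF L]]]
      by (intro integral_mono_AE) auto
    also have "\<dots> = B\<^sup>2 * measure lebesgue (\<Omega> - \<Union>F)"
      using fmeasurableD[OF L] by (simp add: measure_restrict_space space_restrict_space del: measure_completion)
    finally show ?thesis .
  qed
  have "L2sq \<mu> u
      = L2sq (lebesgue_on (\<Union>F)) u + L2sq (lebesgue_on (\<Omega> - \<Union>F)) u"
    by (rule lebesgue_on_integral_split[OF square_integrable_integrable[OF sq(1)] UF(2) sets_\<Omega> UF(1)])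
  with 1 2 show ?thesis by linarith
qed

definition L2_Cauchy :: "(nat \<Rightarrow> complex \<Rightarrow> complex) \<Rightarrow> bool" where
  "L2_Cauchy f \<longleftrightarrow> (\<forall>e>0. \<exists>N. \<forall>k\<ge>N. \<forall>l\<ge>N. L2sq \<mu> (\<lambda>x. f k x - f l x) < e)"

lemma L2_Cauchy_subseq:
  assumes "L2_Cauchy f" "strict_mono r"
  shows "L2_Cauchy (\<lambda>k. f (r k))"
  using assms unfolding L2_Cauchy_def by (meson seq_suble le_trans)

text \<open>The squares of all covers form a countable family, so one subsequence makes the
  integrals over every one of them converge. Then \<open>square_cover_estimate\<close>, applied to
  differences, gives the Cauchy property.\<close>

lemma bounded_H1_subseq_L2_Cauchy:
  assumes u: "\<And>k. smoothly_approximable \<Omega> (u k)"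
    and B: "\<And>k. AE x in \<mu>. cmod (u k x) \<le> B"
    and E: "\<And>k. dirichlet_energy \<Omega> (u k) \<le> E"
  obtains r :: "nat \<Rightarrow> nat" where "strict_mono r" "L2_Cauchy (\<lambda>k. u (r k))"
proof -
  have "\<exists>F. finite F \<and> (\<forall>K\<in>F. K \<subseteq> \<Omega> \<and> (\<exists>c h. 0 < h \<and> h \<le> 1 / real (Suc m) \<and> K = cbox c (c + Complex h h))) \<and>
    pairwise (\<lambda>K K'. negligible (K \<inter> K')) F \<and> measure lebesgue (\<Omega> - \<Union>F) < 1 / real (Suc m)" for m
    by (rule exists_square_cover[of "1 / real (Suc m)" "1 / real (Suc m)"]) auto
  then obtain F where F: "\<And>m. finite (F m)"
    "\<And>m K. K \<in> F m \<Longrightarrow> K \<subseteq> \<Omega> \<and> (\<exists>c h. 0 < h \<and> h \<le> 1 / real (Suc m) \<and> K = cbox c (c + Complex h h))"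
    "\<And>m. pairwise (\<lambda>K K'. negligible (K \<inter> K')) (F m)"
    "\<And>m. measure lebesgue (\<Omega> - \<Union>(F m)) < 1 / real (Suc m)" by metis
  have usq: "square_integrable \<mu> (u k)" for k
    using u by (auto simp: smoothly_approximable_def H1_def)
  define S where "S = (\<Union>m. F m)"
  have S: "countable S" unfolding S_def using F(1) by (auto intro: countable_finite)
  have K_sets: "K \<in> sets lebesgue" "K \<subseteq> \<Omega>" "K \<in> lmeasurable" if "K \<in> S" for K
    using that F(2) unfolding S_def by (blast intro: lmeasurable_cbox fmeasurableD)+
  have "cmod (LINT x|lebesgue_on K. u k x) \<le> B * measure lebesgue \<Omega>" if K: "K \<in> S" for k K
  proof -
    interpret MK: finite_measure "lebesgue_on K" by (rule finite_measure_lebesgue_on[OF K_sets(3)[OF K]])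
    have i: "integrable (lebesgue_on K) (u k)"
      by (rule MK.square_integrable_imp_integrable[OF square_integrable_lebesgue_on_subset[OF usq K_sets(2)[OF K] sets_\<Omega> K_sets(1)[OF K]]])
    have i\<Omega>: "integrable \<mu> (\<lambda>x. cmod (u k x))"
      using M.square_integrable_imp_integrable[OF usq] by simp
    have "cmod (LINT x|lebesgue_on K. u k x) \<le> (LINT x|lebesgue_on K. cmod (u k x))"
      by (rule integral_norm_bound)
    also have "\<dots> \<le> (LINT x|\<mu>. cmod (u k x))"
      using K_sets[OF K] i\<Omega> sets_\<Omega> by (intro lebesgue_on_integral_subset_le) auto
    also have "\<dots> \<le> (LINT x|\<mu>. B)"
      using i\<Omega> B by (intro integral_mono_AE) auto
    also have "\<dots> = B * measure lebesgue \<Omega>"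
      using sets_\<Omega> by (simp add: measure_restrict_space space_restrict_space del: measure_completion)
    finally show ?thesis .
  qed
  then obtain r :: "nat \<Rightarrow> nat" where r: "strict_mono r"
    "\<And>K. K \<in> S \<Longrightarrow> \<exists>l. (\<lambda>k. LINT x|lebesgue_on K. u (r k) x) \<longlonglongrightarrow> l"
    using function_convergent_subsequence[OF S, of "\<lambda>k K. LINT x|lebesgue_on K. u k x"] by blast
  then obtain L where L: "\<And>K. K \<in> S \<Longrightarrow> (\<lambda>k. LINT x|lebesgue_on K. u (r k) x) \<longlonglongrightarrow> L K" by metis
  have "L2_Cauchy (\<lambda>k. u (r k))"
    unfolding L2_Cauchy_def
  proof (intro allI impI)
    fix e :: real assume e: "e > 0"
    have E0: "E \<ge> 0" using dirichlet_energy_nonneg[of \<Omega> "u 0"] E[of 0] by linarith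
    \<comment> \<open>Differences have energy at most 4 E and are bounded by 2 B. Since \<delta>
      \<le> 1, the gradient term is at most 16 E \<delta>, and the uncovered measure is below
      \<delta>.\<close>
    define C where "C = 16 * E + (2 * B)\<^sup>2"
    have C0: "C \<ge> 0" using E0 by (simp add: C_def)
    obtain m :: nat where m: "C / (e / 2) < real m" using reals_Archimedean2 by blast
    define \<delta> where "\<delta> = 1 / real (Suc m)"
    have \<delta>: "0 < \<delta>" "\<delta> \<le> 1" by (auto simp: \<delta>_def)
    have C\<delta>: "C * \<delta> < e / 2"
    proof -
      have "C < real (Suc m) * (e / 2)" using m e by (simp add: field_simps)
      then show ?thesis by (simp add: \<delta>_def field_simps)
    qed
    \<comment> \<open>Comparing both integrals with their limit \<open>L K\<close> doubles the
      factor 4 of the estimate. Two such sums below e/4, together with \<open>C * \<delta>\<close>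
      below e/2, add up to less than e.\<close>
    define t where "t k = (\<Sum>K\<in>F m. 8 / measure lebesgue K * (cmod ((LINT x|lebesgue_on K. u (r k) x) - L K))\<^sup>2)" for k
    have FS: "F m \<subseteq> S" by (auto simp: S_def)
    have "t \<longlonglongrightarrow> (\<Sum>K\<in>F m. 8 / measure lebesgue K * (cmod (L K - L K))\<^sup>2)"
      unfolding t_def using L FS by (intro tendsto_intros) auto
    then have "t \<longlonglongrightarrow> 0" by simp
    from order_tendstoD(2)[OF this, of "e / 4"] obtain N where N: "\<And>k. k \<ge> N \<Longrightarrow> t k < e / 4"
      using e by (auto simp: eventually_sequentially)
    have "L2sq \<mu> (\<lambda>x. u (r k) x - u (r l) x) < e" if kl: "k \<ge> N" "l \<ge> N" for k l
    proof -
      let ?w = "\<lambda>x. u (r k) x - u (r l) x"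
      have w: "smoothly_approximable \<Omega> ?w" by (intro smoothly_approximable_diff u)
      have wB: "AE x in \<mu>. cmod (?w x) \<le> 2 * B"
        using B[of "r k"] B[of "r l"]
      proof eventually_elim
        case (elim x)
        then show ?case using norm_triangle_ineq4[of "u (r k) x" "u (r l) x"] by linarith
      qed
      have wE: "dirichlet_energy \<Omega> ?w \<le> 4 * E"
        using dirichlet_energy_diff_le[of "u (r k)" "u (r l)"] u E[of "r k"] E[of "r l"]
        by (force simp: smoothly_approximable_def)
      have "(\<Sum>K\<in>F m. 4 / measure lebesgue K * (cmod (LINT x|lebesgue_on K. ?w x))\<^sup>2) \<le> t k + t l"
        unfolding t_def sum.distrib[symmetric]
      proof (rule sum_mono)
        fix K assume "K \<in> F m"
        then have K: "K \<in> S" using FS by blast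
        interpret MK: finite_measure "lebesgue_on K" by (rule finite_measure_lebesgue_on[OF K_sets(3)[OF K]])
        have i: "integrable (lebesgue_on K) (u j)" for j
          by (rule MK.square_integrable_imp_integrable[OF square_integrable_lebesgue_on_subset[OF usq K_sets(2)[OF K] sets_\<Omega> K_sets(1)[OF K]]])
        let ?a = "\<lambda>k. LINT x|lebesgue_on K. u (r k) x"
        have "(LINT x|lebesgue_on K. ?w x) = (?a k - L K) - (?a l - L K)" using i by simp
        then have "(cmod (LINT x|lebesgue_on K. ?w x))\<^sup>2 \<le> 2 * (cmod (?a k - L K))\<^sup>2 + 2 * (cmod (?a l - L K))\<^sup>2"
          using norm_diff_power2_le[of "?a k - L K" "?a l - L K"] by simp
        then have "4 / measure lebesgue K * (cmod (LINT x|lebesgue_on K. ?w x))\<^sup>2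
          \<le> 4 / measure lebesgue K * (2 * (cmod (?a k - L K))\<^sup>2 + 2 * (cmod (?a l - L K))\<^sup>2)"
          by (intro mult_left_mono) auto
        then show "4 / measure lebesgue K * (cmod (LINT x|lebesgue_on K. ?w x))\<^sup>2
          \<le> 8 / measure lebesgue K * (cmod (?a k - L K))\<^sup>2 + 8 / measure lebesgue K * (cmod (?a l - L K))\<^sup>2"
          by (simp add: algebra_simps)
      qed
      moreover have "L2sq \<mu> ?w
        \<le> (\<Sum>K\<in>F m. 4 / measure lebesgue K * (cmod (LINT x|lebesgue_on K. ?w x))\<^sup>2)
          + 4 * \<delta>\<^sup>2 * dirichlet_energy \<Omega> ?w + (2 * B)\<^sup>2 * measure lebesgue (\<Omega> - \<Union>(F m))"
        using F(1)[of m] F(2)[of _ m] F(3)[of m] by (intro square_cover_estimate[OF w wB]) (auto simp: \<delta>_def)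
      moreover have "4 * \<delta>\<^sup>2 * dirichlet_energy \<Omega> ?w \<le> 16 * E * \<delta>"
      proof -
        have "\<delta>\<^sup>2 \<le> \<delta>" using \<delta> by (simp add: power2_eq_square mult_left_le_one_le)
        then have "4 * \<delta>\<^sup>2 * dirichlet_energy \<Omega> ?w \<le> 4 * \<delta> * (4 * E)"
          using wE \<delta> dirichlet_energy_nonneg by (intro mult_mono) auto
        then show ?thesis by (simp add: mult_ac)
      qed
      moreover have "(2 * B)\<^sup>2 * measure lebesgue (\<Omega> - \<Union>(F m)) \<le> (2 * B)\<^sup>2 * \<delta>"
        using F(4)[of m] by (intro mult_left_mono) (auto simp: \<delta>_def)
      moreover have "16 * E * \<delta> + (2 * B)\<^sup>2 * \<delta> = C * \<delta>" by (simp add: C_def algebra_simps)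
      ultimately show ?thesis using N[OF kl(1)] N[OF kl(2)] C\<delta> by linarith
    qed
    then show "\<exists>N. \<forall>k\<ge>N. \<forall>l\<ge>N. L2sq \<mu> (\<lambda>x. u (r k) x - u (r l) x) < e" by blast
  qed
  then show ?thesis using that r(1) by blast
qed

text \<open>The components are treated one after the other; a further subsequence does not disturb
  those already settled.\<close>

lemma bounded_H1_tuple_subseq_L2_Cauchy:
  fixes u :: "nat \<Rightarrow> nat \<Rightarrow> complex \<Rightarrow> complex"
  assumes u: "\<And>j k. j \<in> {1..n} \<Longrightarrow> smoothly_approximable \<Omega> (u k j)"
    and B: "\<And>j k. j \<in> {1..n} \<Longrightarrow> AE x in \<mu>. cmod (u k j x) \<le> B"
    and E: "\<And>j k. j \<in> {1..n} \<Longrightarrow> dirichlet_energy \<Omega> (u k j) \<le> E"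
  obtains r :: "nat \<Rightarrow> nat" where "strict_mono r" "\<And>j. j \<in> {1..n} \<Longrightarrow> L2_Cauchy (\<lambda>k. u (r k) j)"
proof -
  have "\<exists>r::nat \<Rightarrow> nat. strict_mono r \<and> (\<forall>j\<in>{1..m}. L2_Cauchy (\<lambda>k. u (r k) j))" if "m \<le> n" for m
    using that
  proof (induction m)
    case 0
    show ?case by (intro exI[of _ id]) (auto simp: strict_mono_def)
  next
    case (Suc m)
    then obtain r :: "nat \<Rightarrow> nat" where r: "strict_mono r" "\<forall>j\<in>{1..m}. L2_Cauchy (\<lambda>k. u (r k) j)" by auto
    obtain s :: "nat \<Rightarrow> nat" where s: "strict_mono s" "L2_Cauchy (\<lambda>k. u (r (s k)) (Suc m))"
      using bounded_H1_subseq_L2_Cauchy[of "\<lambda>k. u (r k) (Suc m)" B E] u B E Suc.prems by auto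
    have "L2_Cauchy (\<lambda>k. u (r (s k)) j)" if "j \<in> {1..Suc m}" for j
      using that s r(2) L2_Cauchy_subseq[OF _ s(1), of "\<lambda>k. u (r k) j"]
      by (cases "j = Suc m") auto
    moreover have "strict_mono (\<lambda>k. r (s k))" using r(1) s(1) by (simp add: strict_mono_def)
    ultimately show ?case by blast
  qed
  then show ?thesis using that by blast
qed

end

section \<open>The direct method\<close>

lemma integral_norm_power2_midpoint_le:
  assumes "square_integrable M f" "square_integrable M g"
  shows "L2sq M (\<lambda>x. (f x + g x) / 2) \<le> (L2sq M f + L2sq M g) / 2"
proof -
  have m: "square_integrable M (\<lambda>x. (f x + g x) / 2)"
    using square_integrable_scaleR[OF square_integrable_add[OF assms], of "1/2"] by (simp add: scaleR_conv_of_real)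
  have "L2sq M (\<lambda>x. (f x + g x) / 2) \<le> (LINT x|M. ((cmod (f x))\<^sup>2 + (cmod (g x))\<^sup>2) / 2)"
  proof (rule integral_mono)
    show "(cmod ((f x + g x) / 2))\<^sup>2 \<le> ((cmod (f x))\<^sup>2 + (cmod (g x))\<^sup>2) / 2" for x
      using norm_add_power2_le[of "f x" "g x"] by (simp add: norm_divide power_divide)
  qed (use assms m in \<open>auto simp: square_integrable_def\<close>)
  also have "\<dots> = (L2sq M f + L2sq M g) / 2"
    using assms by (simp add: square_integrable_def)
  finally show ?thesis .
qed

text \<open>Young's inequality with weight \<delta>. The leading factor can be brought arbitrarily
  close to 1, as the comparison of the limit energy with the infimum requires.\<close>

lemma norm_power2_le_weighted:
  fixes a b :: "'a::real_normed_vector"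
  assumes "\<delta> > 0"
  shows "(norm a)\<^sup>2 \<le> (1 + \<delta>) * (norm b)\<^sup>2 + (1 + 1 / \<delta>) * (norm (a - b))\<^sup>2"
proof -
  have "norm a \<le> norm b + norm (a - b)" using norm_triangle_ineq[of b "a - b"] by simp
  then have "(norm a)\<^sup>2 \<le> (norm b + norm (a - b))\<^sup>2" by (intro power_mono) auto
  also have "\<dots> = (norm b)\<^sup>2 + (norm (a - b))\<^sup>2 + 2 * norm b * norm (a - b)" by (simp add: power2_sum)
  also have "2 * norm b * norm (a - b) \<le> \<delta> * (norm b)\<^sup>2 + (norm (a - b))\<^sup>2 / \<delta>"
  proof -
    have "0 \<le> (\<delta> * norm b - norm (a - b))\<^sup>2 / \<delta>" using assms by simp
    also have "\<dots> = \<delta> * (norm b)\<^sup>2 + (norm (a - b))\<^sup>2 / \<delta> - 2 * norm b * norm (a - b)"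
      using assms by (simp add: power2_diff field_simps power2_eq_square)
    finally show ?thesis by simp
  qed
  finally show ?thesis by (simp add: algebra_simps)
qed

lemma tendsto_0_midpoint_le:
  fixes f g h :: "nat \<Rightarrow> real"
  assumes "f \<longlonglongrightarrow> 0" "g \<longlonglongrightarrow> 0" "\<And>k. 0 \<le> h k" "\<And>k. h k \<le> (f k + g k) / 2"
  shows "h \<longlonglongrightarrow> 0"
proof (rule tendsto_sandwich[OF _ _ tendsto_const])
  show "(\<lambda>k. (f k + g k) / 2) \<longlonglongrightarrow> 0"
    using tendsto_divide[OF tendsto_add[OF assms(1,2)] tendsto_const, of 2] by simp
qed (use assms(3,4) in auto)

text \<open>A substitute for the convex hull: the parallelogram law needs midpoints only, and
  induction on membership transfers every property stable under midpoints. Midpoints are taken of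
  whole families, so all components are combined with the same weights.\<close>

inductive_set midpoint_hull :: "(nat \<Rightarrow> complex \<Rightarrow> complex) set \<Rightarrow> (nat \<Rightarrow> complex \<Rightarrow> complex) set"
  for S where
  base: "v \<in> S \<Longrightarrow> v \<in> midpoint_hull S"
| midpoint: "v \<in> midpoint_hull S \<Longrightarrow> w \<in> midpoint_hull S \<Longrightarrow> (\<lambda>j x. (v j x + w j x) / 2) \<in> midpoint_hull S"

lemma midpoint_hull_mono:
  assumes "S \<subseteq> T"
  shows "midpoint_hull S \<subseteq> midpoint_hull T"
proof
  fix v assume "v \<in> midpoint_hull S"
  then show "v \<in> midpoint_hull T"
    by induction (use assms in \<open>auto intro: midpoint_hull.intros\<close>)
qed

lemma energy_nonneg: "0 \<le> energy \<Omega> n u"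
  unfolding energy_def by (intro sum_nonneg dirichlet_energy_nonneg)

section \<open>Midpoints, limits and fixed boundary values\<close>

context bounded_open
begin

lemma H1_norm_midpoint_le:
  assumes "u \<in> H1 \<Omega>" "w \<in> H1 \<Omega>"
  shows "(H1_norm \<Omega> (\<lambda>x. (u x + w x) / 2))\<^sup>2 \<le> ((H1_norm \<Omega> u)\<^sup>2 + (H1_norm \<Omega> w)\<^sup>2) / 2"
proof -
  have "dirichlet_energy \<Omega> (\<lambda>x. (u x + w x) / 2) \<le> (dirichlet_energy \<Omega> u + dirichlet_energy \<Omega> w) / 2"
    using dirichlet_energy_parallelogram[OF assms] dirichlet_energy_nonneg[of \<Omega> "\<lambda>x. u x - w x"] by linarith
  moreover have "square_integrable \<mu> u" "square_integrable \<mu> w"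
    using assms by (auto simp: H1_def)
  note integral_norm_power2_midpoint_le[OF this]
  ultimately show ?thesis by (simp add: H1_norm_power2 field_simps)
qed

text \<open>Midpoints of the two approximating sequences approximate the midpoint, and on the
  boundary both sequences approach the same \<open>g\<close>, so the error there is averaged as
  well.\<close>

lemma H1_bc_midpoint:
  assumes \<Omega>: "smooth_bounded_domain \<Omega>" and u: "u \<in> H1_bc \<Omega> g" and w: "w \<in> H1_bc \<Omega> g"
  shows "(\<lambda>x. (u x + w x) / 2) \<in> H1_bc \<Omega> g"
proof -
  let ?m = "\<lambda>x. (u x + w x) / 2"
  have H: "u \<in> H1 \<Omega>" "w \<in> H1 \<Omega>" using u w by (auto simp: H1_bc_def)
  have mH: "?m \<in> H1 \<Omega>"
    using H1_linear[OF H, of "1/2" "1/2"] by (simp add: scaleR_conv_of_real add_divide_distrib)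
  have g: "square_integrable (boundary_measure \<Omega>) g" using u by (simp add: H1_bc_def has_trace_def)
  obtain \<phi> where \<phi>: "\<And>k. smooth_on UNIV (\<phi> k)" "(\<lambda>k. H1_norm \<Omega> (\<lambda>x. \<phi> k x - u x)) \<longlonglongrightarrow> 0"
    "(\<lambda>k. L2sq (boundary_measure \<Omega>) (\<lambda>x. \<phi> k x - g x)) \<longlonglongrightarrow> 0"
    using u unfolding H1_bc_def has_trace_def by blast
  obtain \<psi> where \<psi>: "\<And>k. smooth_on UNIV (\<psi> k)" "(\<lambda>k. H1_norm \<Omega> (\<lambda>x. \<psi> k x - w x)) \<longlonglongrightarrow> 0"
    "(\<lambda>k. L2sq (boundary_measure \<Omega>) (\<lambda>x. \<psi> k x - g x)) \<longlonglongrightarrow> 0"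
    using w unfolding H1_bc_def has_trace_def by blast
  define \<theta> where "\<theta> k x = (\<phi> k x + \<psi> k x) / 2" for k x
  have \<theta>s: "smooth_on UNIV (\<theta> k)" for k
    using smooth_on_scaleR[OF open_UNIV smooth_on_const[OF open_UNIV, of "1/2"] smooth_on_add[OF open_UNIV \<phi>(1)[of k] \<psi>(1)[of k]]]
    by (simp add: \<theta>_def[abs_def] scaleR_conv_of_real)
  have 1: "(H1_norm \<Omega> (\<lambda>x. \<theta> k x - ?m x))\<^sup>2
      \<le> ((H1_norm \<Omega> (\<lambda>x. \<phi> k x - u x))\<^sup>2 + (H1_norm \<Omega> (\<lambda>x. \<psi> k x - w x))\<^sup>2) / 2" for k
  proof -
    have "(\<lambda>x. \<theta> k x - ?m x) = (\<lambda>x. ((\<phi> k x - u x) + (\<psi> k x - w x)) / 2)"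
      by (simp add: \<theta>_def fun_eq_iff field_simps)
    then show ?thesis
      using H1_norm_midpoint_le[OF H1_diff[OF smooth_H1[OF \<phi>(1)] H(1)] H1_diff[OF smooth_H1[OF \<psi>(1)] H(2)]] by simp
  qed
  have L1: "(\<lambda>k. H1_norm \<Omega> (\<lambda>x. \<theta> k x - ?m x)) \<longlonglongrightarrow> 0"
    using tendsto_0_midpoint_le[OF \<phi>(2)[unfolded H1_norm_tendsto_0_iff] \<psi>(2)[unfolded H1_norm_tendsto_0_iff] _ 1]
    unfolding H1_norm_tendsto_0_iff by simp
  have 2: "L2sq (boundary_measure \<Omega>) (\<lambda>x. \<theta> k x - g x)
    \<le> (L2sq (boundary_measure \<Omega>) (\<lambda>x. \<phi> k x - g x) + L2sq (boundary_measure \<Omega>) (\<lambda>x. \<psi> k x - g x)) / 2" for k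
  proof -
    have eq: "\<theta> k x - g x = ((\<phi> k x - g x) + (\<psi> k x - g x)) / 2" for x by (simp add: \<theta>_def field_simps)
    show ?thesis
      unfolding eq
      by (intro integral_norm_power2_midpoint_le square_integrable_diff g square_integrable_boundary[OF \<Omega>]
          smooth_on_imp_continuous_on \<phi>(1) \<psi>(1))
  qed
  have L2: "(\<lambda>k. L2sq (boundary_measure \<Omega>) (\<lambda>x. \<theta> k x - g x)) \<longlonglongrightarrow> 0"
    using tendsto_0_midpoint_le[OF \<phi>(3) \<psi>(3) _ 2] by simp
  show ?thesis
    unfolding H1_bc_def has_trace_def using mH g \<theta>s L1 L2 by blast
qed

text \<open>A diagonal choice: each \<open>v m\<close> has a smooth approximation whose squared
  errors, in \<open>H1_norm\<close> and on the boundary, are below 1/(m+1). These functions witness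
  the trace of the limit.\<close>

lemma H1_bc_closed:
  assumes v: "\<And>m. v m \<in> H1_bc \<Omega> g" and u: "u \<in> H1 \<Omega>"
    and lim: "(\<lambda>m. (H1_norm \<Omega> (\<lambda>x. u x - v m x))\<^sup>2) \<longlonglongrightarrow> 0"
  shows "u \<in> H1_bc \<Omega> g"
proof -
  have vH: "v m \<in> H1 \<Omega>" for m using v by (simp add: H1_bc_def)
  have g: "square_integrable (boundary_measure \<Omega>) g" using v[of 0] by (simp add: H1_bc_def has_trace_def)
  have "\<exists>\<phi>. smooth_on UNIV \<phi> \<and> (H1_norm \<Omega> (\<lambda>x. \<phi> x - v m x))\<^sup>2 < 1 / real (Suc m) \<and>
      L2sq (boundary_measure \<Omega>) (\<lambda>x. \<phi> x - g x) < 1 / real (Suc m)" for m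
  proof -
    obtain \<phi> where \<phi>: "\<And>k. smooth_on UNIV (\<phi> k)" "(\<lambda>k. H1_norm \<Omega> (\<lambda>x. \<phi> k x - v m x)) \<longlonglongrightarrow> 0"
      "(\<lambda>k. L2sq (boundary_measure \<Omega>) (\<lambda>x. \<phi> k x - g x)) \<longlonglongrightarrow> 0"
      using v[of m] unfolding H1_bc_def has_trace_def by blast
    have p: "0 < 1 / real (Suc m)" by simp
    have "\<forall>\<^sub>F k in sequentially. (H1_norm \<Omega> (\<lambda>x. \<phi> k x - v m x))\<^sup>2 < 1 / real (Suc m) \<and>
        L2sq (boundary_measure \<Omega>) (\<lambda>x. \<phi> k x - g x) < 1 / real (Suc m)"
      using order_tendstoD(2)[OF iffD1[OF H1_norm_tendsto_0_iff \<phi>(2)] p] order_tendstoD(2)[OF \<phi>(3) p]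
      by (rule eventually_conj)
    then show ?thesis using \<phi>(1) by (auto simp: eventually_sequentially)
  qed
  then have "\<forall>m. \<exists>\<phi>. smooth_on UNIV \<phi> \<and> (H1_norm \<Omega> (\<lambda>x. \<phi> x - v m x))\<^sup>2 < 1 / real (Suc m) \<and>
      L2sq (boundary_measure \<Omega>) (\<lambda>x. \<phi> x - g x) < 1 / real (Suc m)" ..
  then obtain \<phi> where "\<forall>m. smooth_on UNIV (\<phi> m) \<and> (H1_norm \<Omega> (\<lambda>x. \<phi> m x - v m x))\<^sup>2 < 1 / real (Suc m) \<and>
      L2sq (boundary_measure \<Omega>) (\<lambda>x. \<phi> m x - g x) < 1 / real (Suc m)"
    unfolding choice_iff ..
  then have \<phi>: "\<And>m. smooth_on UNIV (\<phi> m)" "\<And>m. (H1_norm \<Omega> (\<lambda>x. \<phi> m x - v m x))\<^sup>2 < 1 / real (Suc m)"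
      "\<And>m. L2sq (boundary_measure \<Omega>) (\<lambda>x. \<phi> m x - g x) < 1 / real (Suc m)" by blast+
  have inv: "(\<lambda>m. 1 / real (Suc m)) \<longlonglongrightarrow> 0"
    using LIMSEQ_inverse_real_of_nat by (simp add: inverse_eq_divide)
  have 1: "(H1_norm \<Omega> (\<lambda>x. \<phi> m x - u x))\<^sup>2
      \<le> 2 * (1 / real (Suc m)) + 2 * (H1_norm \<Omega> (\<lambda>x. u x - v m x))\<^sup>2" for m
    using H1_norm_triangle[OF smooth_H1[OF \<phi>(1)[of m]] vH[of m] u] \<phi>(2)[of m] by linarith
  have "(\<lambda>m. 2 * (1 / real (Suc m)) + 2 * (H1_norm \<Omega> (\<lambda>x. u x - v m x))\<^sup>2) \<longlonglongrightarrow> 2 * 0 + 2 * 0"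
    by (intro tendsto_intros inv lim)
  then have "(\<lambda>m. 2 * (1 / real (Suc m)) + 2 * (H1_norm \<Omega> (\<lambda>x. u x - v m x))\<^sup>2) \<longlonglongrightarrow> 0" by simp
  from tendsto_sandwich[OF _ _ tendsto_const this, of "\<lambda>m. (H1_norm \<Omega> (\<lambda>x. \<phi> m x - u x))\<^sup>2"] 1
  have L1: "(\<lambda>m. H1_norm \<Omega> (\<lambda>x. \<phi> m x - u x)) \<longlonglongrightarrow> 0"
    unfolding H1_norm_tendsto_0_iff by simp
  from tendsto_sandwich[OF _ _ tendsto_const inv, of "\<lambda>m. L2sq (boundary_measure \<Omega>) (\<lambda>x. \<phi> m x - g x)"]
    less_imp_le[OF \<phi>(3)]
  have "(\<lambda>m. L2sq (boundary_measure \<Omega>) (\<lambda>x. \<phi> m x - g x)) \<longlonglongrightarrow> 0"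
    by simp
  then show ?thesis
    unfolding H1_bc_def has_trace_def using u g \<phi>(1) L1 by blast
qed

lemma dirichlet_energy_le_weighted:
  assumes "u \<in> H1 \<Omega>" "w \<in> H1 \<Omega>" "\<delta> > 0"
  shows "dirichlet_energy \<Omega> u \<le> (1 + \<delta>) * dirichlet_energy \<Omega> w + (1 + 1 / \<delta>) * dirichlet_energy \<Omega> (\<lambda>x. u x - w x)"
proof -
  obtain p q where p: "has_weak_gradient \<Omega> u p" and q: "has_weak_gradient \<Omega> w q"
    using assms by (auto simp: H1_iff_weak_gradient)
  have d: "has_weak_gradient \<Omega> (\<lambda>x. u x - w x) (\<lambda>b x. p b x - q b x)"
    using weak_gradient_linear[OF p q, of 1 "-1"] by simp
  have "L2sq \<mu> (p b) \<le> (1 + \<delta>) * L2sq \<mu> (q b)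
      + (1 + 1 / \<delta>) * L2sq \<mu> (\<lambda>x. p b x - q b x)" if b: "b \<in> Basis" for b
  proof -
    have i: "integrable \<mu> (\<lambda>x. (cmod (p b x))\<^sup>2)" "integrable \<mu> (\<lambda>x. (cmod (q b x))\<^sup>2)"
      "integrable \<mu> (\<lambda>x. (cmod (p b x - q b x))\<^sup>2)"
      using p q d b by (auto simp: has_weak_gradient_def intro: square_integrable_integrable)
    have "L2sq \<mu> (p b)
        \<le> (LINT x|\<mu>. (1 + \<delta>) * (cmod (q b x))\<^sup>2 + (1 + 1 / \<delta>) * (cmod (p b x - q b x))\<^sup>2)"
      using i by (intro integral_mono norm_power2_le_weighted assms(3)) auto
    then show ?thesis using i by simp
  qed
  then show ?thesis
    unfolding dirichlet_energy_eq[OF p] dirichlet_energy_eq[OF q] dirichlet_energy_eq[OF d]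
      sum_distrib_left sum.distrib[symmetric]
    by (rule sum_mono)
qed

lemma energy_parallelogram:
  assumes "\<And>j. j \<in> {1..n} \<Longrightarrow> v j \<in> H1 \<Omega>" "\<And>j. j \<in> {1..n} \<Longrightarrow> w j \<in> H1 \<Omega>"
  shows "energy \<Omega> n (\<lambda>j x. (v j x + w j x) / 2) + energy \<Omega> n (\<lambda>j x. v j x - w j x) / 4
    = (energy \<Omega> n v + energy \<Omega> n w) / 2"
  unfolding energy_def sum_divide_distrib sum.distrib[symmetric]
  by (intro sum.cong refl dirichlet_energy_parallelogram assms)

lemma midpoint_hull_H1_bc:
  assumes "smooth_bounded_domain \<Omega>" "v \<in> midpoint_hull S" "\<And>w. w \<in> S \<Longrightarrow> w j \<in> H1_bc \<Omega> g"
  shows "v j \<in> H1_bc \<Omega> g"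
  using assms(2) by induction (auto intro: assms(3) H1_bc_midpoint[OF assms(1)])

text \<open>Balls in L^2 are stable under midpoints, so the hull of a tail stays as close to the
  limit as the tail itself.\<close>

lemma midpoint_hull_L2_le:
  assumes "v \<in> midpoint_hull S" "square_integrable \<mu> f"
    and "\<And>w. w \<in> S \<Longrightarrow> square_integrable \<mu> (w j)
      \<and> L2sq \<mu> (\<lambda>x. w j x - f x) \<le> \<epsilon>"
  shows "square_integrable \<mu> (v j) \<and> L2sq \<mu> (\<lambda>x. v j x - f x) \<le> \<epsilon>"
  using assms(1)
proof induction
  case (midpoint v w)
  have eq: "(v j x + w j x) / 2 - f x = ((v j x - f x) + (w j x - f x)) / 2" for x by (simp add: field_simps)
  have "square_integrable \<mu> (\<lambda>x. (v j x + w j x) / 2)"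
    using square_integrable_scaleR[OF square_integrable_add[of _ "v j" "w j"], of _ "1/2"] midpoint.IH
    by (simp add: scaleR_conv_of_real)
  moreover have "L2sq \<mu> (\<lambda>x. (v j x + w j x) / 2 - f x) \<le> \<epsilon>"
    using integral_norm_power2_midpoint_le[OF square_integrable_diff[OF _ assms(2)] square_integrable_diff[OF _ assms(2)], of "v j" "w j"]
      midpoint.IH
    unfolding eq by simp
  ultimately show ?case by simp
qed (rule assms(3))

text \<open>The a.e. constraint is not convex, so it is passed to the limit separately, along an a.e. convergent
  subsequence.\<close>

lemma AE_norm_constraint_limit:
  fixes w :: "nat \<Rightarrow> nat \<Rightarrow> complex \<Rightarrow> complex"
  assumes w: "\<And>j k. j \<in> {1..n} \<Longrightarrow> square_integrable \<mu> (w k j)"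
    and U: "\<And>j. j \<in> {1..n} \<Longrightarrow> square_integrable \<mu> (U j)"
    and lim: "\<And>j. j \<in> {1..n} \<Longrightarrow> (\<lambda>k. L2sq \<mu> (\<lambda>x. w k j x - U j x)) \<longlonglongrightarrow> 0"
    and c: "\<And>k. AE x in \<mu>. (\<Sum>j=1..n. (cmod (w k j x))\<^sup>2) = c"
  shows "AE x in \<mu>. (\<Sum>j=1..n. (cmod (U j x))\<^sup>2) = c"
proof -
  \<comment> \<open>Summing over the components lets a single extraction of a subsequence serve all
    of them.\<close>
  define s where "s k x = (\<Sum>j=1..n. (cmod (w k j x - U j x))\<^sup>2)" for k x
  have di: "integrable \<mu> (\<lambda>x. (cmod (w k j x - U j x))\<^sup>2)" if "j \<in> {1..n}" for j k
    using square_integrable_diff[OF w[OF that] U[OF that]] by (rule square_integrable_integrable)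
  have si: "integrable \<mu> (s k)" for k
    unfolding s_def using di by (intro Bochner_Integration.integrable_sum) auto
  have "(LINT x|\<mu>. norm (s k x)) = (\<Sum>j=1..n. L2sq \<mu> (\<lambda>x. w k j x - U j x))" for k
  proof -
    have "norm (s k x) = s k x" for x by (simp add: s_def sum_nonneg)
    then show ?thesis unfolding s_def using di by (simp add: Bochner_Integration.integral_sum)
  qed
  moreover have "(\<lambda>k. \<Sum>j=1..n. L2sq \<mu> (\<lambda>x. w k j x - U j x)) \<longlonglongrightarrow> (\<Sum>j=1..n. 0)"
    by (intro tendsto_sum lim)
  ultimately have "(\<lambda>k. LINT x|\<mu>. norm (s k x)) \<longlonglongrightarrow> 0" by simp
  from tendsto_L1_AE_subseq[OF si this]
  obtain q :: "nat \<Rightarrow> nat" where "AE x in \<mu>. (\<lambda>k. s (q k) x) \<longlonglongrightarrow> 0" by blast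
  moreover have "AE x in \<mu>. \<forall>k. (\<Sum>j=1..n. (cmod (w k j x))\<^sup>2) = c"
    using c by (simp add: AE_all_countable)
  ultimately show ?thesis
  proof eventually_elim
    case (elim x)
    have "(\<lambda>k. w (q k) j x) \<longlonglongrightarrow> U j x" if j: "j \<in> {1..n}" for j
    proof -
      have le: "(cmod (w (q k) j x - U j x))\<^sup>2 \<le> s (q k) x" for k
        unfolding s_def using j by (intro member_le_sum) auto
      have "(\<lambda>k. (cmod (w (q k) j x - U j x))\<^sup>2) \<longlonglongrightarrow> 0"
        by (rule tendsto_sandwich[OF _ _ tendsto_const elim(1)]) (auto intro!: always_eventually le)
      then have "(\<lambda>k. sqrt ((cmod (w (q k) j x - U j x))\<^sup>2)) \<longlonglongrightarrow> sqrt 0" by (rule tendsto_real_sqrt)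
      then show ?thesis by (simp add: tendsto_norm_zero_iff Lim_null[of _ "U j x"])
    qed
    then have "(\<lambda>k. \<Sum>j=1..n. (cmod (w (q k) j x))\<^sup>2) \<longlonglongrightarrow> (\<Sum>j=1..n. (cmod (U j x))\<^sup>2)"
      by (intro tendsto_intros) auto
    then show ?case using elim(2) by (simp add: LIMSEQ_const_iff)
  qed
qed

text \<open>The energy is a quadratic form, so near-minimizers \<open>v m\<close> in the decreasing midpoint hulls of the tails
  of an \<open>L\<^sup>2\<close>-convergent minimizing sequence have Cauchy gradients by the parallelogram law. Hence they
  converge in \<open>H\<^sup>1\<close>, to the \<open>L\<^sup>2\<close> limit of the minimizing sequence, and no weak topology is needed.\<close>

lemma minimizer_exists:
  assumes \<Omega>: "smooth_bounded_domain \<Omega>" and ne: "admissible \<Omega> n g \<noteq> {}"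
  shows "\<exists>u\<in>admissible \<Omega> n g. energy \<Omega> n u = min_energy \<Omega> n g"
proof -
  define \<beta> where "\<beta> = min_energy \<Omega> n g"
  have bdd: "bdd_below (energy \<Omega> n ` X)" for X by (rule bdd_belowI[of _ 0]) (auto simp: energy_nonneg)
  have "\<exists>u\<in>admissible \<Omega> n g. energy \<Omega> n u < \<beta> + 1 / real (Suc k)" for k
    using cINF_less_iff[OF ne bdd, of "\<beta> + 1 / real (Suc k)"] by (simp add: \<beta>_def min_energy_def)
  then obtain u where u: "\<And>k. u k \<in> admissible \<Omega> n g" "\<And>k. energy \<Omega> n (u k) < \<beta> + 1 / real (Suc k)" by metis
  have ubc: "u k j \<in> H1_bc \<Omega> (g j)" if "j \<in> {1..n}" for k j
    using u(1)[of k] that by (auto simp: admissible_def PiE_def)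
  have uc: "AE x in \<mu>. (\<Sum>j=1..n. (cmod (u k j x))\<^sup>2) = real n" for k
    using u(1)[of k] by (simp add: admissible_def)
  have uB: "AE x in \<mu>. cmod (u k j x) \<le> sqrt (real n)" if j: "j \<in> {1..n}" for k j
    using uc[of k]
  proof eventually_elim
    case (elim x)
    have "(cmod (u k j x))\<^sup>2 \<le> (\<Sum>j=1..n. (cmod (u k j x))\<^sup>2)"
      using j by (intro member_le_sum) auto
    then show ?case using elim by (simp add: real_le_rsqrt)
  qed
  have uE: "dirichlet_energy \<Omega> (u k j) \<le> \<beta> + 1" if j: "j \<in> {1..n}" for k j
  proof -
    have "dirichlet_energy \<Omega> (u k j) \<le> energy \<Omega> n (u k)"
      unfolding energy_def using j by (intro member_le_sum) (auto simp: dirichlet_energy_nonneg)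
    also have "\<dots> \<le> \<beta> + 1 / real (Suc k)" using u(2)[of k] by simp
    also have "1 / real (Suc k) \<le> 1" by simp
    finally show ?thesis by simp
  qed
  obtain r :: "nat \<Rightarrow> nat" where r: "strict_mono r" "\<And>j. j \<in> {1..n} \<Longrightarrow> L2_Cauchy (\<lambda>k. u (r k) j)"
    using bounded_H1_tuple_subseq_L2_Cauchy[of n u "sqrt (real n)" "\<beta> + 1"]
      H1_bc_smoothly_approximable[OF ubc] uB uE by blast
  define w where "w k = u (r k)" for k
  have wbc: "w k j \<in> H1_bc \<Omega> (g j)" if "j \<in> {1..n}" for k j unfolding w_def using ubc that .
  have wsq: "square_integrable \<mu> (w k j)" if "j \<in> {1..n}" for k j
    using wbc[OF that] by (simp add: H1_bc_def H1_def)
  \<comment> \<open>As \<open>r k\<close> is at least k, the subsequence keeps the rate of the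
    minimizing sequence.\<close>
  have wE: "energy \<Omega> n (w k) \<le> \<beta> + 1 / real (Suc k)" for k
  proof -
    have "1 / real (Suc (r k)) \<le> 1 / real (Suc k)"
      using seq_suble[OF r(1), of k] by (intro divide_left_mono) auto
    then show ?thesis using u(2)[of "r k"] by (simp add: w_def)
  qed
  have "\<exists>f. square_integrable \<mu> f \<and> (\<lambda>k. L2sq \<mu> (\<lambda>x. w k j x - f x)) \<longlonglongrightarrow> 0"
    if j: "j \<in> {1..n}" for j
  proof (rule M.square_integrable_complete[of "\<lambda>k. w k j"])
    show "\<exists>N. \<forall>k\<ge>N. \<forall>l\<ge>N. L2sq \<mu> (\<lambda>x. w k j x - w l j x) < e" if "e > 0" for e
      using r(2)[OF j] that by (simp add: L2_Cauchy_def w_def)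
  qed (use wsq[OF j] in auto)
  then have "\<exists>U. \<forall>j\<in>{1..n}. square_integrable \<mu> (U j) \<and>
      (\<lambda>k. L2sq \<mu> (\<lambda>x. w k j x - U j x)) \<longlonglongrightarrow> 0"
    by (intro bchoice ballI)
  then obtain U where U: "\<forall>j\<in>{1..n}. square_integrable \<mu> (U j) \<and>
      (\<lambda>k. L2sq \<mu> (\<lambda>x. w k j x - U j x)) \<longlonglongrightarrow> 0" ..
  have Usq: "square_integrable \<mu> (U j)"
    and Ulim: "(\<lambda>k. L2sq \<mu> (\<lambda>x. w k j x - U j x)) \<longlonglongrightarrow> 0" if "j \<in> {1..n}" for j
    using bspec[OF U that] by simp_all
  have Uc: "AE x in \<mu>. (\<Sum>j=1..n. (cmod (U j x))\<^sup>2) = real n"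
    by (rule AE_norm_constraint_limit[OF wsq Usq Ulim]; (assumption | (unfold w_def, rule uc)))
  define C where "C m = midpoint_hull (w ` {m..})" for m
  have Cbc: "v j \<in> H1_bc \<Omega> (g j)" if "v \<in> C m" "j \<in> {1..n}" for v m j
    using that(1) unfolding C_def by (rule midpoint_hull_H1_bc[OF \<Omega>]) (use wbc[OF that(2)] in auto)
  have CH1: "v j \<in> H1 \<Omega>" if "v \<in> C m" "j \<in> {1..n}" for v m j
    using Cbc[OF that] by (simp add: H1_bc_def)
  have wC: "w m \<in> C m" for m unfolding C_def by (intro midpoint_hull.base) auto
  have Csub: "C l \<subseteq> C m" if "m \<le> l" for m l unfolding C_def using that by (intro midpoint_hull_mono) auto
  \<comment> \<open>The infimum over the hull of a tail may lie below \<open>\<beta>\<close>, since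
    elements of the hull need not satisfy the pointwise constraint. It cannot decrease as the hulls
    shrink.\<close>
  define a where "a m = (INF v\<in>C m. energy \<Omega> n v)" for m
  have a_le: "a m \<le> energy \<Omega> n v" if "v \<in> C m" for v m
    unfolding a_def using bdd that by (rule cINF_lower)
  have a_mono: "a m \<le> a l" if "m \<le> l" for m l
    unfolding a_def using wC by (intro cINF_superset_mono bdd Csub that) auto
  have inv: "(\<lambda>m. 1 / real (Suc m)) \<longlonglongrightarrow> 0"
    using LIMSEQ_inverse_real_of_nat by (simp add: inverse_eq_divide)
  \<comment> \<open>\<open>C m\<close> contains all later \<open>w k\<close>, and their energies
    have upper bounds tending to \<open>\<beta>\<close>.\<close>
  have a_\<beta>: "a m \<le> \<beta>" for m
  proof (rule LIMSEQ_le_const[of "\<lambda>k. \<beta> + 1 / real (Suc k)"])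
    show "(\<lambda>k. \<beta> + 1 / real (Suc k)) \<longlonglongrightarrow> \<beta>" using tendsto_add[OF tendsto_const inv, of \<beta>] by simp
    show "\<exists>N. \<forall>k\<ge>N. a m \<le> \<beta> + 1 / real (Suc k)"
      using a_mono a_le[OF wC] wE by (meson order_trans)
  qed
  obtain A where A: "a \<longlonglongrightarrow> A" "\<And>m. a m \<le> A"
    using incseq_convergent[of a \<beta>] a_mono a_\<beta> by (auto simp: incseq_def)
  have "\<exists>v\<in>C m. energy \<Omega> n v < a m + 1 / real (Suc m)" for m
  proof -
    have "C m \<noteq> {}" using wC by blast
    from cINF_less_iff[OF this bdd, of "a m + 1 / real (Suc m)"] show ?thesis by (simp add: a_def)
  qed
  then obtain v where v: "\<And>m. v m \<in> C m" "\<And>m. energy \<Omega> n (v m) < a m + 1 / real (Suc m)" by metis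
  have vH: "v m j \<in> H1 \<Omega>" if "j \<in> {1..n}" for m j using CH1[OF v(1) that] .
  have vgrad: "has_weak_gradient \<Omega> (v m j) (\<lambda>b. weak_partial \<Omega> b (v m j))" if "j \<in> {1..n}" for m j
    by (rule weak_gradient_weak_partial[OF vH[OF that]])
  have vsq: "square_integrable \<mu> (v m j)" if "j \<in> {1..n}" for m j
    using vH[OF that] by (simp add: H1_def)
  have vU: "(\<lambda>m. L2sq \<mu> (\<lambda>x. v m j x - U j x)) \<longlonglongrightarrow> 0" if j: "j \<in> {1..n}" for j
  proof (rule LIMSEQ_I)
    fix e :: real assume e: "e > 0"
    from order_tendstoD(2)[OF Ulim[OF j], of "e / 2"]
    obtain N where N: "\<And>k. k \<ge> N \<Longrightarrow> L2sq \<mu> (\<lambda>x. w k j x - U j x) < e / 2"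
      using e by (auto simp: eventually_sequentially)
    have "norm (L2sq \<mu> (\<lambda>x. v m j x - U j x) - 0) < e" if m: "m \<ge> N" for m
    proof -
      have "L2sq \<mu> (\<lambda>x. v m j x - U j x) \<le> e / 2"
        using midpoint_hull_L2_le[OF v(1)[of m, unfolded C_def] Usq[OF j], of j "e / 2"] N wsq[OF j] m
        by (force intro: less_imp_le)
      then show ?thesis using e by simp
    qed
    then show "\<exists>no. \<forall>m\<ge>no. norm (L2sq \<mu> (\<lambda>x. v m j x - U j x) - 0) < e" by blast
  qed
  \<comment> \<open>The midpoint of \<open>v m\<close> and \<open>v l\<close> belongs to
    \<open>C m\<close>, so its energy is at least \<open>a m\<close>. The energies of
    \<open>v m\<close> and \<open>v l\<close> exceed \<open>a m\<close> and \<open>A\<close> by at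
    most 1/(m+1), so the parallelogram law leaves little room for their difference.\<close>
  have close: "energy \<Omega> n (\<lambda>j x. v m j x - v l j x) \<le> 2 * (A - a m) + 4 / real (Suc m)" if "m \<le> l" for m l
  proof -
    have "(\<lambda>j x. (v m j x + v l j x) / 2) \<in> C m"
      using v(1)[of m] v(1)[of l] Csub[OF that] unfolding C_def by (intro midpoint_hull.midpoint) auto
    from a_le[OF this] have "a m \<le> (energy \<Omega> n (v m) + energy \<Omega> n (v l)) / 2 - energy \<Omega> n (\<lambda>j x. v m j x - v l j x) / 4"
      using energy_parallelogram[of n "v m" "v l", OF vH vH] by linarith
    moreover have "energy \<Omega> n (v m) \<le> a m + 1 / real (Suc m)" "energy \<Omega> n (v l) \<le> A + 1 / real (Suc m)"
    proof -
      have "1 / real (Suc l) \<le> 1 / real (Suc m)" using that by (intro divide_left_mono) auto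
      then show "energy \<Omega> n (v l) \<le> A + 1 / real (Suc m)" using v(2)[of l] A(2)[of l] by linarith
    qed (use v(2)[of m] in simp)
    moreover have "4 / real (Suc m) = 4 * (1 / real (Suc m))" by simp
    moreover have "y \<le> 2 * (A - x) + s" if "x \<le> (p + q) / 2 - y / 4" "p \<le> x + t" "q \<le> A + t" "s = 4 * t"
      for x y p q s t :: real using that by argo
    ultimately show ?thesis by blast
  qed
  have bound0: "(\<lambda>m. 2 * (A - a m) + 4 / real (Suc m)) \<longlonglongrightarrow> 0"
  proof -
    have "(\<lambda>m. 2 * (A - a m) + 4 * (1 / real (Suc m))) \<longlonglongrightarrow> 2 * (A - A) + 4 * 0"
      by (intro tendsto_intros A(1) inv)
    then show ?thesis by simp
  qed
  have grad_le: "L2sq \<mu> (\<lambda>x. weak_partial \<Omega> b (v m j) x - weak_partial \<Omega> b (v l j) x)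
      \<le> 2 * (A - a m) + 4 / real (Suc m)" if j: "j \<in> {1..n}" and b: "b \<in> Basis" and ml: "m \<le> l" for j b m l
  proof -
    have d: "has_weak_gradient \<Omega> (\<lambda>x. v m j x - v l j x) (\<lambda>b x. weak_partial \<Omega> b (v m j) x - weak_partial \<Omega> b (v l j) x)"
      using weak_gradient_linear[OF vgrad[OF j] vgrad[OF j], of 1 m "-1" l] by simp
    have "L2sq \<mu> (\<lambda>x. weak_partial \<Omega> b (v m j) x - weak_partial \<Omega> b (v l j) x)
        \<le> dirichlet_energy \<Omega> (\<lambda>x. v m j x - v l j x)"
      unfolding dirichlet_energy_eq[OF d] using b
      by (intro member_le_sum[where f="\<lambda>b. L2sq \<mu> (\<lambda>x. weak_partial \<Omega> b (v m j) x - weak_partial \<Omega> b (v l j) x)"]) auto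
    also have "\<dots> \<le> energy \<Omega> n (\<lambda>j x. v m j x - v l j x)"
      unfolding energy_def using j
      by (intro member_le_sum[where f="\<lambda>j. dirichlet_energy \<Omega> (\<lambda>x. v m j x - v l j x)"]) (auto simp: dirichlet_energy_nonneg)
    finally show ?thesis using close[OF ml] by linarith
  qed
  have "\<exists>f. square_integrable \<mu> f \<and>
      (\<lambda>m. L2sq \<mu> (\<lambda>x. weak_partial \<Omega> b (v m j) x - f x)) \<longlonglongrightarrow> 0"
    if j: "j \<in> {1..n}" and b: "b \<in> Basis" for j b
  proof (rule M.square_integrable_complete[of "\<lambda>m. weak_partial \<Omega> b (v m j)"])
    show "square_integrable \<mu> (weak_partial \<Omega> b (v m j))" for m
      using vgrad[OF j] b by (simp add: has_weak_gradient_def)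
    fix e :: real assume e: "e > 0"
    from order_tendstoD(2)[OF bound0 e] obtain N where N: "\<And>m. m \<ge> N \<Longrightarrow> 2 * (A - a m) + 4 / real (Suc m) < e"
      by (auto simp: eventually_sequentially)
    have "L2sq \<mu> (\<lambda>x. weak_partial \<Omega> b (v k j) x - weak_partial \<Omega> b (v l j) x) < e"
      if "k \<ge> N" "l \<ge> N" for k l
    proof (cases "k \<le> l")
      case True
      then show ?thesis using grad_le[OF j b True] N[OF that(1)] by linarith
    next
      case False
      then have "l \<le> k" by simp
      then show ?thesis using grad_le[OF j b \<open>l \<le> k\<close>] N[OF that(2)] by (simp add: norm_minus_commute)
    qed
    then show "\<exists>N. \<forall>k\<ge>N. \<forall>l\<ge>N. L2sq \<mu> (\<lambda>x. weak_partial \<Omega> b (v k j) x - weak_partial \<Omega> b (v l j) x) < e"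
      by blast
  qed auto
  \<comment> \<open>With the membership conditions under the existential quantifier,
    \<open>choice_iff\<close> can pick all limits at once.\<close>
  then have "\<forall>j. \<forall>b. \<exists>f. j \<in> {1..n} \<longrightarrow> b \<in> Basis \<longrightarrow> square_integrable \<mu> f \<and>
      (\<lambda>m. L2sq \<mu> (\<lambda>x. weak_partial \<Omega> b (v m j) x - f x)) \<longlonglongrightarrow> 0"
    by blast
  then obtain G where "\<forall>j b. j \<in> {1..n} \<longrightarrow> b \<in> Basis \<longrightarrow> square_integrable \<mu> (G j b) \<and>
      (\<lambda>m. L2sq \<mu> (\<lambda>x. weak_partial \<Omega> b (v m j) x - G j b x)) \<longlonglongrightarrow> 0"
    unfolding choice_iff by blast
  then have Gsq: "\<And>j b. j \<in> {1..n} \<Longrightarrow> b \<in> Basis \<Longrightarrow> square_integrable \<mu> (G j b)"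
    and Glim: "\<And>j b. j \<in> {1..n} \<Longrightarrow> b \<in> Basis \<Longrightarrow>
      (\<lambda>m. L2sq \<mu> (\<lambda>x. weak_partial \<Omega> b (v m j) x - G j b x)) \<longlonglongrightarrow> 0"
    by blast+
  \<comment> \<open>Closedness of weak derivatives under L^2 limits identifies the limits of the
    gradients with the gradient of \<open>U j\<close>.\<close>
  have UG: "has_weak_gradient \<Omega> (U j) (G j)" if j: "j \<in> {1..n}" for j
    unfolding has_weak_gradient_def
  proof (intro conjI ballI)
    fix b :: complex assume b: "b \<in> Basis"
    show "has_weak_partial \<Omega> b (U j) (G j b)"
      using vgrad[OF j] b
      by (intro has_weak_partial_limit[OF _ b vsq[OF j] Usq[OF j] _ Gsq[OF j b] vU[OF j] Glim[OF j b]])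
        (auto simp: has_weak_gradient_def)
  qed (use Usq Gsq j in auto)
  then have UH: "U j \<in> H1 \<Omega>" if "j \<in> {1..n}" for j using that by (auto simp: H1_iff_weak_gradient)
  have dUG: "has_weak_gradient \<Omega> (\<lambda>x. U j x - v m j x) (\<lambda>b x. G j b x - weak_partial \<Omega> b (v m j) x)"
    if j: "j \<in> {1..n}" for j m
    using weak_gradient_linear[OF UG[OF j] vgrad[OF j], of 1 "-1" m] by simp
  have dlim: "(\<lambda>m. dirichlet_energy \<Omega> (\<lambda>x. U j x - v m j x)) \<longlonglongrightarrow> 0" if j: "j \<in> {1..n}" for j
  proof -
    have "(\<lambda>m. \<Sum>b\<in>Basis. L2sq \<mu> (\<lambda>x. weak_partial \<Omega> b (v m j) x - G j b x))
        \<longlonglongrightarrow> (\<Sum>b\<in>(Basis :: complex set). 0)"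
      by (intro tendsto_sum Glim j)
    then show ?thesis
      unfolding dirichlet_energy_eq[OF dUG[OF j]] by (simp add: norm_minus_commute)
  qed
  have "(\<lambda>m. (H1_norm \<Omega> (\<lambda>x. U j x - v m j x))\<^sup>2) \<longlonglongrightarrow> 0" if j: "j \<in> {1..n}" for j
    using tendsto_add[OF vU[OF j] dlim[OF j]] by (simp add: H1_norm_power2 norm_minus_commute)
  then have Ubc: "U j \<in> H1_bc \<Omega> (g j)" if j: "j \<in> {1..n}" for j
    using H1_bc_closed[of "\<lambda>m. v m j" "g j" "U j"] Cbc[OF v(1) j] UH[OF j] j by blast
  define U' where "U' = restrict U {1..n}"
  have U': "U' \<in> admissible \<Omega> n g"
    unfolding admissible_def U'_def using Ubc Uc by auto
  have "energy \<Omega> n U' \<le> \<beta>"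
  proof (rule field_le_epsilon)
    fix \<epsilon> :: real assume "\<epsilon> > 0"
    have \<beta>0: "\<beta> \<ge> 0" unfolding \<beta>_def min_energy_def using ne by (intro cINF_greatest energy_nonneg)
    \<comment> \<open>The summand 1 covers the case that \<open>\<beta>\<close> is zero.\<close>
    define \<delta> where "\<delta> = \<epsilon> / (\<beta> + 1)"
    have \<delta>: "\<delta> > 0" using \<open>\<epsilon> > 0\<close> \<beta>0 by (simp add: \<delta>_def)
    have "energy \<Omega> n U' \<le> (1 + \<delta>) * \<beta>"
    proof (rule LIMSEQ_le_const)
      show "(\<lambda>m. (1 + \<delta>) * (\<beta> + 1 / real (Suc m))
          + (1 + 1 / \<delta>) * (\<Sum>j=1..n. dirichlet_energy \<Omega> (\<lambda>x. U j x - v m j x))) \<longlonglongrightarrow> (1 + \<delta>) * \<beta>"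
      proof -
        have "(\<lambda>m. (1 + \<delta>) * (\<beta> + 1 / real (Suc m))
          + (1 + 1 / \<delta>) * (\<Sum>j=1..n. dirichlet_energy \<Omega> (\<lambda>x. U j x - v m j x)))
          \<longlonglongrightarrow> (1 + \<delta>) * (\<beta> + 0) + (1 + 1 / \<delta>) * (\<Sum>j=1..n. 0)"
          by (intro tendsto_intros inv dlim)
        then show ?thesis by simp
      qed
      have "energy \<Omega> n U' \<le> (1 + \<delta>) * (\<beta> + 1 / real (Suc m))
          + (1 + 1 / \<delta>) * (\<Sum>j=1..n. dirichlet_energy \<Omega> (\<lambda>x. U j x - v m j x))" for m
      proof -
        have "energy \<Omega> n U' = (\<Sum>j=1..n. dirichlet_energy \<Omega> (U j))"
          by (simp add: energy_def U'_def)
        also have "\<dots> \<le> (\<Sum>j=1..n. (1 + \<delta>) * dirichlet_energy \<Omega> (v m j)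
            + (1 + 1 / \<delta>) * dirichlet_energy \<Omega> (\<lambda>x. U j x - v m j x))"
          by (intro sum_mono dirichlet_energy_le_weighted UH vH \<delta>)
        also have "\<dots> = (1 + \<delta>) * energy \<Omega> n (v m)
            + (1 + 1 / \<delta>) * (\<Sum>j=1..n. dirichlet_energy \<Omega> (\<lambda>x. U j x - v m j x))"
          by (simp only: sum.distrib sum_distrib_left energy_def)
        also have "(1 + \<delta>) * energy \<Omega> n (v m) \<le> (1 + \<delta>) * (\<beta> + 1 / real (Suc m))"
          using v(2)[of m] a_\<beta>[of m] \<delta> by (intro mult_left_mono) auto
        finally show ?thesis by simp
      qed
      then show "\<exists>N. \<forall>m\<ge>N. energy \<Omega> n U' \<le> (1 + \<delta>) * (\<beta> + 1 / real (Suc m))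
          + (1 + 1 / \<delta>) * (\<Sum>j=1..n. dirichlet_energy \<Omega> (\<lambda>x. U j x - v m j x))" by blast
    qed
    also have "\<dots> = \<beta> + \<delta> * \<beta>" by (simp add: algebra_simps)
    also have "\<delta> * \<beta> \<le> \<delta> * (\<beta> + 1)" using \<delta> by simp
    also have "\<delta> * (\<beta> + 1) = \<epsilon>" using \<beta>0 by (simp add: \<delta>_def)
    finally show "energy \<Omega> n U' \<le> \<beta> + \<epsilon>" by simp
  qed
  \<comment> \<open>The \<open>v m\<close> only yield the upper bound; the lower bound comes from
    the admissibility of the limit.\<close>
  moreover have "\<beta> \<le> energy \<Omega> n U'"
    unfolding \<beta>_def min_energy_def using bdd U' by (rule cINF_lower)
  ultimately show ?thesis using U' by (intro bexI[of _ U']) (simp_all add: \<beta>_def)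
qed

end

theorem theorem1p1:
  fixes n :: nat and \<Omega> :: "complex set" and g :: "nat \<Rightarrow> complex \<Rightarrow> complex"
  assumes "n \<ge> 2"
    and "smooth_bounded_domain \<Omega>" and "simply_connected \<Omega>"
    and "\<And>j. j \<in> {1..n} \<Longrightarrow> smooth_boundary_map \<Omega> (g j)"
    and "\<And>j. j \<in> {1..n} \<Longrightarrow> boundary_degree \<Omega> (g j) \<ge> 0"
  shows "admissible \<Omega> n g \<noteq> {}
    \<and> (\<exists>u\<in>admissible \<Omega> n g. energy \<Omega> n u = min_energy \<Omega> n g)"
proof
  show "admissible \<Omega> n g \<noteq> {}"
    using assms(1,2,4) by (rule admissible_nonempty)
  then show "\<exists>u\<in>admissible \<Omega> n g. energy \<Omega> n u = min_energy \<Omega> n g"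
    using assms(2)
    by (intro bounded_open.minimizer_exists bounded_open.intro) (auto simp: smooth_bounded_domain_def)
qed

end
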